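(* The operators $e_k$, $d_\pm$, $T_i$ on $V_*=\bigoplus_{k\ge0}V_k$ define a representation of the Dyck path algebra $\mathbb{A}=\mathbb{A}_q$ on $V_*$. Furthermore, there is an isomorphism of representations $$\varphi:\mathbb{A}e_0\xrightarrow{\ \sim\ }V_*$$ which sends $e_0$ to $1\in V_0$ and maps $e_k\mathbb{A}e_0$ isomorphically onto $V_k$ for every $k\geq 0$.
   Context: Plethysm. $\mathrm{Sym}[X]$ is the ring of symmetric functions over $\mathbb{Q}(q,t)$ in $X=x_1+x_2+\cdots$. For an expression $A$, $p_n[A]$ is obtained by replacing every variable and parameter (including $q,t,x_i,y_i$) by its $n$-th power (with $p_n[-A]=-p_n[A]$), and $F[A]$ is the image of $F\in\mathrm{Sym}[X]$ under $p_n\mapsto p_n[A]$ (coefficients fixed). $\mathrm{Exp}[A]=\sum_{n\ge0}h_n[A]$. Operators. $V_k=\mathrm{Sym}[X]\otimes\mathbb{Q}[y_1,\dots,y_k]$; plethystic substitutions act on the $\mathrm{Sym}[X]$ factor only; $e_k$ is the projection of $V_*$ onto $V_k$. For $1\le i\le k-1$, $T_i:V_k\to V_k$ is $T_iP=\frac{(q-1)y_iP+(y_{i+1}-qy_i)s_iP}{y_{i+1}-y_i}$, where $s_i$ exchanges $y_i$ and $y_{i+1}$. Define $d_+:V_k\to V_{k+1}$ and $d_-:V_k\to V_{k-1}$ ($k\ge1$) by $$d_+F=T_1\cdots T_k\big(F[X+(q-1)y_{k+1}]\big),\qquad d_-F=-F[X-(q-1)y_k]\,\mathrm{Exp}[-y_k^{-1}X]\big|_{y_k^{-1}},$$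 where $|_{y_k^{-1}}$ is the coefficient of $y_k^{-1}$. The Dyck path algebra $\mathbb{A}=\mathbb{A}_q$ (over $\mathbb{Q}(q,t)$) is the path algebra of the quiver with vertex set $\mathbb{Z}_{\ge0}$, arrows $d_+$ from $i$ to $i+1$, arrows $d_-$ from $i+1$ to $i$, and loops $T_1,\dots,T_{k-1}$ at vertex $k$ (products are read as compositions of operators, right to left; $e_k$ is the idempotent at vertex $k$), modulo the relations, for paths beginning at vertex $k$, whenever all terms make sense: $$(T_i-1)(T_i+q)=0,\quad T_iT_{i+1}T_i=T_{i+1}T_iT_{i+1},\quad T_iT_j=T_jT_i\ (|i-j|>1),$$ $$T_id_-=d_-T_i,\quad d_+T_i=T_{i+1}d_+,\quad T_1d_+^2=d_+^2,\quad d_-^2T_{k-1}=d_-^2,$$ $$d_-(d_+d_--d_-d_+)T_{k-1}=q(d_+d_--d_-d_+)d_-\ (k\ge2),\qquad T_1(d_+d_--d_-d_+)d_+=q\,d_+(d_+d_--d_-d_+).$$ *)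

theory Defs
  imports
    "HOL-Library.Poly_Mapping"
    "HOL-Combinatorics.Transposition"
    "HOL-Computational_Algebra.Polynomial"
    "HOL-Computational_Algebra.Fraction_Field"
    "HOL-Computational_Algebra.Formal_Laurent_Series"
begin

section \<open>The ground field\<close>

text \<open>\<open>\<rat>(q,t)\<close> as the fraction field of \<open>\<rat>[q][t]\<close>: the inner polynomial variable is \<open>q\<close>,
  the outer one is \<open>t\<close>.\<close>

type_synonym qt = "rat poly poly fract"

definition qq :: qt where
  "qq = Fraction_Field.Fract [:[:0, 1:]:] 1"


section \<open>Symmetric functions\<close>

text \<open>A monomial in countably many variables is its finitely supported exponent vector.\<close>

type_synonym monom = "nat \<Rightarrow>\<^sub>0 nat"

definition mdeg :: "monom \<Rightarrow> nat" where
  "mdeg m = (\<Sum>i\<in>Poly_Mapping.keys m. Poly_Mapping.lookup m i)"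

lemma mdeg_superset:
  assumes "finite A" "Poly_Mapping.keys m \<subseteq> A"
  shows "mdeg m = (\<Sum>i\<in>A. Poly_Mapping.lookup m i)"
  unfolding mdeg_def
  by (rule sum.mono_neutral_left) (use assms in \<open>auto simp: in_keys_iff\<close>)

lemma mdeg_add: "mdeg (a + b) = mdeg a + mdeg b"
proof -
  let ?A = "Poly_Mapping.keys a \<union> Poly_Mapping.keys b"
  have "finite ?A" "Poly_Mapping.keys (a + b) \<subseteq> ?A"
    by (simp, rule Poly_Mapping.keys_add)
  then show ?thesis
    using mdeg_superset[of ?A a] mdeg_superset[of ?A b] mdeg_superset[of ?A "a + b"]
    by (simp add: lookup_add sum.distrib)
qed

lemma mdeg_zero [simp]: "mdeg 0 = 0"
  by (simp add: mdeg_def)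

definition splits :: "monom \<Rightarrow> (monom \<times> monom) set" where
  "splits m = {(a, b). a + b = m}"

lemma finite_splits: "finite (splits m)"
proof -
  let ?F = "{f. \<forall>i. (i \<in> Poly_Mapping.keys m \<longrightarrow> f i \<in> {..mdeg m}) \<and>
     (i \<notin> Poly_Mapping.keys m \<longrightarrow> f i = (0::nat))}"
  have F: "finite ?F"
    by (rule finite_set_of_finite_funs) auto
  have le: "Poly_Mapping.lookup m i \<le> mdeg m" if "i \<in> Poly_Mapping.keys m" for i
    unfolding mdeg_def by (rule member_le_sum) (use that in auto)
  have "fst ` splits m \<subseteq> Poly_Mapping.lookup -` ?F"
  proof
    fix a assume "a \<in> fst ` splits m"
    then obtain b where "m = a + b"
      by (auto simp: splits_def)
    then have a: "Poly_Mapping.lookup a i \<le> Poly_Mapping.lookup m i" for i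
      by (simp add: lookup_add)
    have "Poly_Mapping.lookup a i \<le> mdeg m" if "i \<in> Poly_Mapping.keys m" for i
      using a[of i] le[OF that] by (rule order_trans)
    moreover have "Poly_Mapping.lookup a i = 0" if "i \<notin> Poly_Mapping.keys m" for i
      using a[of i] that by (simp add: in_keys_iff)
    ultimately show "a \<in> Poly_Mapping.lookup -` ?F"
      by blast
  qed
  moreover have "inj (Poly_Mapping.lookup :: monom \<Rightarrow> _)"
    by (rule injI) (simp add: lookup_inject)
  then have "finite (Poly_Mapping.lookup -` ?F :: monom set)"
    by (rule finite_vimageI[OF F])
  ultimately have "finite (fst ` splits m)"
    by (rule finite_subset)
  moreover have "inj_on fst (splits m)"
    by (auto simp: inj_on_def splits_def)
  ultimately show ?thesis
    by (rule finite_imageD)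
qed

text \<open>A symmetric function is a power series in \<open>x\<^sub>0, x\<^sub>1, \<dots>\<close> (given by its coefficients) of bounded
  degree that is invariant under all permutations of the variables.\<close>

definition symmetric_series :: "(monom \<Rightarrow> qt) \<Rightarrow> bool" where
  "symmetric_series f \<longleftrightarrow>
     (\<exists>d. \<forall>m. d < mdeg m \<longrightarrow> f m = 0) \<and>
     (\<forall>\<sigma> m. bij \<sigma> \<longrightarrow> f (Poly_Mapping.map_key \<sigma> m) = f m)"

typedef sym = "{f. symmetric_series f}"
  morphisms scoeff Abs_sym
  by (rule exI[of _ "\<lambda>_. 0"]) (simp add: symmetric_series_def)

setup_lifting type_definition_sym

lemma map_key_inv:
  assumes "bij \<sigma>"
  shows "Poly_Mapping.map_key \<sigma> (Poly_Mapping.map_key (inv \<sigma>) m) = m"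
    and "Poly_Mapping.map_key (inv \<sigma>) (Poly_Mapping.map_key \<sigma> m) = m"
proof -
  have i: "inj \<sigma>" "inj (inv \<sigma>)"
    using assms by (auto simp: bij_is_inj bij_imp_bij_inv)
  show "Poly_Mapping.map_key \<sigma> (Poly_Mapping.map_key (inv \<sigma>) m) = m"
    using i assms by (intro poly_mapping_eqI) (simp add: map_key.rep_eq bij_is_inj)
  show "Poly_Mapping.map_key (inv \<sigma>) (Poly_Mapping.map_key \<sigma> m) = m"
    using i assms
    by (intro poly_mapping_eqI) (simp add: map_key.rep_eq bij_is_surj surj_f_inv_f)
qed

lemma mdeg_map_key:
  assumes "bij \<sigma>"
  shows "mdeg (Poly_Mapping.map_key \<sigma> m) = mdeg m"
proof -
  have i: "inj \<sigma>" using assms by (simp add: bij_is_inj)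
  have "bij_betw \<sigma> (\<sigma> -` Poly_Mapping.keys m) (Poly_Mapping.keys m)"
    using assms by (auto simp: bij_betw_def inj_on_def bij_def image_vimage_eq)
  then have "(\<Sum>j\<in>\<sigma> -` Poly_Mapping.keys m. Poly_Mapping.lookup m (\<sigma> j)) =
      (\<Sum>j\<in>Poly_Mapping.keys m. Poly_Mapping.lookup m j)"
    by (rule sum.reindex_bij_betw)
  then show ?thesis
    using i by (simp add: mdeg_def keys_map_key map_key.rep_eq)
qed

lemma symmetric_series_mult:
  assumes "symmetric_series f" "symmetric_series g"
  shows "symmetric_series (\<lambda>m. \<Sum>(a, b)\<in>splits m. f a * g b)"
proof -
  obtain d e where d: "\<And>m. d < mdeg m \<Longrightarrow> f m = 0" and e: "\<And>m. e < mdeg m \<Longrightarrow> g m = 0"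
    using assms unfolding symmetric_series_def by blast
  have "(\<Sum>(a, b)\<in>splits m. f a * g b) = 0" if "d + e < mdeg m" for m
  proof (rule sum.neutral, safe)
    fix a b assume "(a, b) \<in> splits m"
    then have "mdeg a + mdeg b = mdeg m"
      by (auto simp: splits_def mdeg_add)
    then have "d < mdeg a \<or> e < mdeg b"
      using that by linarith
    then show "f a * g b = 0"
      using d e by auto
  qed
  moreover have "(\<Sum>(a, b)\<in>splits (Poly_Mapping.map_key \<sigma> m). f a * g b) =
      (\<Sum>(a, b)\<in>splits m. f a * g b)" if \<sigma>: "bij \<sigma>" for \<sigma> m
  proof -
    have i: "inj \<sigma>" "inj (inv \<sigma>)" and b: "bij (inv \<sigma>)"
      using \<sigma> by (auto simp: bij_is_inj bij_imp_bij_inv)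
    have fg: "f (Poly_Mapping.map_key (inv \<sigma>) x) = f x" "g (Poly_Mapping.map_key (inv \<sigma>) x) = g x"
      for x
      using assms b unfolding symmetric_series_def by blast+
    note plus = map_key_plus[OF i(1), symmetric] map_key_plus[OF i(2), symmetric]
    show ?thesis
      by (rule sum.reindex_bij_witness[where
            j = "\<lambda>(a, b). (Poly_Mapping.map_key (inv \<sigma>) a, Poly_Mapping.map_key (inv \<sigma>) b)" and
            i = "\<lambda>(a, b). (Poly_Mapping.map_key \<sigma> a, Poly_Mapping.map_key \<sigma> b)"])
        (clarsimp simp: splits_def map_key_inv[OF \<sigma>] fg plus)+
  qed
  ultimately show ?thesis
    unfolding symmetric_series_def by blast
qed

lemma symmetric_series_const: "symmetric_series (\<lambda>m. if m = 0 then c else 0)"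
proof -
  have "Poly_Mapping.map_key \<sigma> m = 0 \<longleftrightarrow> m = 0" if "bij \<sigma>"
    for \<sigma> :: "nat \<Rightarrow> nat" and m :: monom
    using map_key_inv(2)[OF that, of m] map_key_zero[OF bij_is_inj[OF that]]
      map_key_zero[OF bij_is_inj[OF bij_imp_bij_inv[OF that]]] by metis
  then show ?thesis
    unfolding symmetric_series_def by (auto intro!: exI[of _ 0])
qed

instantiation sym :: comm_ring_1
begin

lift_definition zero_sym :: sym is "\<lambda>_. 0"
  by (simp add: symmetric_series_def)

lift_definition one_sym :: sym is "\<lambda>m. if m = 0 then 1 else 0"
  by (rule symmetric_series_const)

lift_definition plus_sym :: "sym \<Rightarrow> sym \<Rightarrow> sym" is "\<lambda>f g m. f m + g m"
proof -
  fix f g assume fg: "symmetric_series f" "symmetric_series g"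
  then obtain d e where "\<And>m. d < mdeg m \<Longrightarrow> f m = 0" "\<And>m. e < mdeg m \<Longrightarrow> g m = 0"
    unfolding symmetric_series_def by blast
  then have "\<forall>m. max d e < mdeg m \<longrightarrow> f m + g m = 0" by auto
  then show "symmetric_series (\<lambda>m. f m + g m)"
    using fg unfolding symmetric_series_def by (intro conjI exI[of _ "max d e"]) auto
qed

lift_definition uminus_sym :: "sym \<Rightarrow> sym" is "\<lambda>f m. - f m"
  by (simp add: symmetric_series_def)

lift_definition minus_sym :: "sym \<Rightarrow> sym \<Rightarrow> sym" is "\<lambda>f g m. f m - g m"
proof -
  fix f g assume fg: "symmetric_series f" "symmetric_series g"
  then obtain d e where "\<And>m. d < mdeg m \<Longrightarrow> f m = 0" "\<And>m. e < mdeg m \<Longrightarrow> g m = 0"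
    unfolding symmetric_series_def by blast
  then have "\<forall>m. max d e < mdeg m \<longrightarrow> f m - g m = 0" by auto
  then show "symmetric_series (\<lambda>m. f m - g m)"
    using fg unfolding symmetric_series_def by (intro conjI exI[of _ "max d e"]) auto
qed

lift_definition times_sym :: "sym \<Rightarrow> sym \<Rightarrow> sym" is
  "\<lambda>f g m. \<Sum>(a, b)\<in>splits m. f a * g b"
  by (rule symmetric_series_mult)

instance
proof
  fix a b c :: sym
  show "a * b * c = a * (b * c)"
  proof (transfer, rule ext)
    fix f g h :: "monom \<Rightarrow> qt" and m
    have "(\<Sum>(a, b)\<in>splits m. (\<Sum>(a', b')\<in>splits a. f a' * g b') * h b) =
        (\<Sum>(x, y)\<in>Sigma (splits m) (\<lambda>x. splits (fst x)). f (fst y) * g (snd y) * h (snd x))"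
      by (subst sum.Sigma[symmetric])
         (auto simp: finite_splits sum_distrib_right case_prod_unfold)
    also have "\<dots> =
        (\<Sum>(x, y)\<in>Sigma (splits m) (\<lambda>x. splits (snd x)). f (fst x) * g (fst y) * h (snd y))"
      by (rule sum.reindex_bij_witness[where
            j = "\<lambda>(x, y). ((fst y, snd y + snd x), (snd y, snd x))" and
            i = "\<lambda>(x, y). ((fst x + fst y, snd y), (fst x, fst y))"])
         (auto simp: splits_def add.assoc)
    also have "\<dots> = (\<Sum>(a, b)\<in>splits m. f a * (\<Sum>(a', b')\<in>splits b. g a' * h b'))"
      by (subst sum.Sigma[symmetric])
         (auto simp: finite_splits sum_distrib_left case_prod_unfold mult.assoc)
    finally show "(\<Sum>(a, b)\<in>splits m. (\<Sum>(a', b')\<in>splits a. f a' * g b') * h b) =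
        (\<Sum>(a, b)\<in>splits m. f a * (\<Sum>(a', b')\<in>splits b. g a' * h b'))" .
  qed
  show "a * b = b * a"
  proof (transfer, rule ext)
    fix f g :: "monom \<Rightarrow> qt" and m
    show "(\<Sum>(a, b)\<in>splits m. f a * g b) = (\<Sum>(a, b)\<in>splits m. g a * f b)"
      by (rule sum.reindex_bij_witness[where i = prod.swap and j = prod.swap])
         (auto simp: splits_def add.commute mult.commute)
  qed
  show "1 * a = a"
  proof (transfer, rule ext)
    fix f :: "monom \<Rightarrow> qt" and m
    have "(\<Sum>(a, b)\<in>splits m. (if a = 0 then 1 else 0) * f b) =
        (\<Sum>(a, b)\<in>{(0 :: monom, m)}. (if a = 0 then 1 else 0) * f b)"
      by (intro sum.mono_neutral_right finite_splits) (auto simp: splits_def split: if_splits)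
    then show "(\<Sum>(a, b)\<in>splits m. (if a = 0 then 1 else 0) * f b) = f m" by simp
  qed
  show "(a + b) * c = a * c + b * c"
    by transfer (simp add: fun_eq_iff distrib_right sum.distrib case_prod_unfold)
  show "(0::sym) \<noteq> 1"
    by transfer (auto simp: fun_eq_iff intro!: exI[of _ 0])
qed (transfer; simp add: fun_eq_iff algebra_simps)+

end

text \<open>The scalar is fixed in a context, as otherwise \<open>lift_definition\<close> would also try to lift along
  the quotient type \<open>qt\<close>.\<close>

context
  fixes c :: qt
begin

lift_definition sym_const :: sym is "\<lambda>m. if m = 0 then c else 0"
  by (rule symmetric_series_const)

end

text \<open>The power sums; only indices \<open>n \<ge> 1\<close> matter.\<close>

lift_definition powersum :: "nat \<Rightarrow> sym" is
  "\<lambda>n m. if 0 < n \<and> (\<exists>i. m = Poly_Mapping.single i n) then 1 else 0"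
proof -
  fix n
  have deg: "mdeg (Poly_Mapping.single i n) \<le> n" for i
    by (simp add: mdeg_def)
  have "(\<exists>i. Poly_Mapping.map_key \<sigma> m = Poly_Mapping.single i n) \<longleftrightarrow>
      (\<exists>i. m = Poly_Mapping.single i n)" if \<sigma>: "bij \<sigma>"
    for \<sigma> :: "nat \<Rightarrow> nat" and m
  proof -
    have i: "inj \<sigma>" "inj (inv \<sigma>)" using \<sigma> by (auto simp: bij_is_inj bij_imp_bij_inv)
    have 1: "Poly_Mapping.map_key \<sigma> (Poly_Mapping.single (\<sigma> j) n) = Poly_Mapping.single j n" for j
      using i(1) by (rule map_key_single)
    show ?thesis
    proof
      assume "\<exists>i. Poly_Mapping.map_key \<sigma> m = Poly_Mapping.single i n"
      then obtain j where "Poly_Mapping.map_key \<sigma> m =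
          Poly_Mapping.map_key \<sigma> (Poly_Mapping.single (\<sigma> j) n)"
        by (auto simp: 1)
      then have "Poly_Mapping.map_key (inv \<sigma>) (Poly_Mapping.map_key \<sigma> m) =
          Poly_Mapping.map_key (inv \<sigma>) (Poly_Mapping.map_key \<sigma> (Poly_Mapping.single (\<sigma> j) n))"
        by (rule arg_cong)
      then show "\<exists>i. m = Poly_Mapping.single i n"
        by (auto simp only: map_key_inv(2)[OF \<sigma>])
    next
      assume "\<exists>i. m = Poly_Mapping.single i n"
      then obtain i where "m = Poly_Mapping.single (\<sigma> (inv \<sigma> i)) n"
        using \<sigma> by (auto simp: bij_is_surj surj_f_inv_f)
      then show "\<exists>i. Poly_Mapping.map_key \<sigma> m = Poly_Mapping.single i n"
        using 1 by blast
    qed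
  qed
  moreover have "\<not> n < mdeg m" if "m = Poly_Mapping.single i n" for m i
    unfolding that using deg[of i] by simp
  ultimately show "symmetric_series
      (\<lambda>m. if 0 < n \<and> (\<exists>i. m = Poly_Mapping.single i n) then 1 else 0)"
    unfolding symmetric_series_def by (intro conjI exI[of _ n]) auto
qed

text \<open>The complete homogeneous symmetric functions.\<close>

lift_definition hsym :: "nat \<Rightarrow> sym" is "\<lambda>n m. if mdeg m = n then 1 else 0"
proof -
  fix n
  show "symmetric_series (\<lambda>m. if mdeg m = n then 1 else 0)"
    unfolding symmetric_series_def by (auto simp: mdeg_map_key intro!: exI[of _ n])
qed


section \<open>Plethysm\<close>

text \<open>Let \<open>\<iota>\<close> embed the ground field into a commutative ring.  If \<open>p\<^sub>n[A] = a n\<close> in this ring for all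
  \<open>n \<ge> 1\<close>, then \<open>pleth \<iota> a F\<close> is \<open>F[A]\<close>: the image of \<open>F\<close> under the algebra homomorphism with
  \<open>p\<^sub>n \<mapsto> p\<^sub>n[A]\<close>.  It exists and is unique since the power sums are algebraically independent
  generators of the ring of symmetric functions.\<close>

definition pleth_hom :: "(qt \<Rightarrow> 'r::comm_ring_1) \<Rightarrow> (nat \<Rightarrow> 'r) \<Rightarrow> (sym \<Rightarrow> 'r) \<Rightarrow> bool" where
  "pleth_hom \<iota> a \<phi> \<longleftrightarrow>
     (\<forall>F G. \<phi> (F + G) = \<phi> F + \<phi> G) \<and>
     (\<forall>F G. \<phi> (F * G) = \<phi> F * \<phi> G) \<and>
     (\<forall>c. \<phi> (sym_const c) = \<iota> c) \<and>
     (\<forall>n\<ge>1. \<phi> (powersum n) = a n)"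

definition pleth :: "(qt \<Rightarrow> 'r::comm_ring_1) \<Rightarrow> (nat \<Rightarrow> 'r) \<Rightarrow> sym \<Rightarrow> 'r" where
  "pleth \<iota> a = (THE \<phi>. pleth_hom \<iota> a \<phi>)"

text \<open>\<open>Exp[A]\<close>, an infinite sum in the topology of the target ring.\<close>

definition pleth_Exp :: "(qt \<Rightarrow> 'r::{comm_ring_1, t2_space}) \<Rightarrow> (nat \<Rightarrow> 'r) \<Rightarrow> 'r" where
  "pleth_Exp \<iota> a = suminf (\<lambda>n. pleth \<iota> a (hsym n))"


section \<open>The spaces \<open>V\<^sub>k\<close> and the operators\<close>

text \<open>Polynomials in \<open>y\<^sub>1, y\<^sub>2, \<dots>\<close> with coefficients in the ring of symmetric functions; those
  involving only \<open>y\<^sub>1, \<dots>, y\<^sub>k\<close> form \<open>V\<^sub>k\<close>.\<close>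

type_synonym symy = "monom \<Rightarrow>\<^sub>0 sym"

definition V :: "nat \<Rightarrow> symy set" where
  "V k = {F. \<forall>m\<in>Poly_Mapping.keys F. Poly_Mapping.keys m \<subseteq> {1..k}}"

definition of_sym :: "sym \<Rightarrow> symy" where
  "of_sym = Poly_Mapping.single 0"

definition of_qt :: "qt \<Rightarrow> symy" where
  "of_qt c = of_sym (sym_const c)"

definition ymon :: "monom \<Rightarrow> symy" where
  "ymon m = Poly_Mapping.single m 1"

definition yvar :: "nat \<Rightarrow> symy" where
  "yvar i = ymon (Poly_Mapping.single i 1)"

text \<open>Plethystic substitution in the coefficients, leaving the \<open>y\<close>-monomials fixed.\<close>

definition plethV :: "(nat \<Rightarrow> symy) \<Rightarrow> symy \<Rightarrow> symy" where
  "plethV a F =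
     (\<Sum>m\<in>Poly_Mapping.keys F. pleth of_qt a (Poly_Mapping.lookup F m) * ymon m)"

definition swap_y :: "nat \<Rightarrow> symy \<Rightarrow> symy" where
  "swap_y i = Poly_Mapping.map_key (Poly_Mapping.map_key (transpose i (Suc i)))"

text \<open>\<open>T\<^sub>i P\<close> is the exact quotient by \<open>y\<^sub>i\<^sub>+\<^sub>1 - y\<^sub>i\<close> in the polynomial ring.\<close>

definition opT :: "nat \<Rightarrow> symy \<Rightarrow> symy" where
  "opT i P = (THE R. (yvar (Suc i) - yvar i) * R =
     of_qt (qq - 1) * yvar i * P + (yvar (Suc i) - of_qt qq * yvar i) * swap_y i P)"

text \<open>The operator \<open>d\<^sub>+\<close> on \<open>V\<^sub>k\<close>; here \<open>p\<^sub>n[X + (q - 1)y\<^sub>k\<^sub>+\<^sub>1] = p\<^sub>n + (q\<^sup>n - 1)y\<^sub>k\<^sub>+\<^sub>1\<^sup>n\<close>.\<close>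

definition opdplus :: "nat \<Rightarrow> symy \<Rightarrow> symy" where
  "opdplus k F = foldr opT [1..<Suc k]
     (plethV (\<lambda>n. of_sym (powersum n) + of_qt (qq ^ n - 1) * yvar (Suc k) ^ n) F)"

text \<open>A polynomial as a Laurent series in the variable \<open>z = y\<^sub>k\<^sup>-\<^sup>1\<close>.\<close>

definition laurent_y :: "nat \<Rightarrow> symy \<Rightarrow> symy fls" where
  "laurent_y k G = (\<Sum>m\<in>Poly_Mapping.keys G.
     fls_const (Poly_Mapping.single (Poly_Mapping.update k 0 m) (Poly_Mapping.lookup G m)) *
     fls_X_intpow (- int (Poly_Mapping.lookup m k)))"

text \<open>\<open>Exp[-zX]\<close> as a power series in \<open>z\<close>; here \<open>p\<^sub>n[-zX] = -z\<^sup>n p\<^sub>n\<close>.\<close>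

definition Exp_minus_zX :: "symy fps" where
  "Exp_minus_zX = pleth_Exp (\<lambda>c. fps_const (of_qt c))
     (\<lambda>n. - (fps_X ^ n * fps_const (of_sym (powersum n))))"

text \<open>The operator \<open>d\<^sub>-\<close> on \<open>V\<^sub>k\<close>, \<open>k \<ge> 1\<close>: the coefficient of \<open>y\<^sub>k\<^sup>-\<^sup>1\<close> is that of \<open>z\<^sup>1\<close>.\<close>

definition opdminus :: "nat \<Rightarrow> symy \<Rightarrow> symy" where
  "opdminus k F = - fls_nth
     (laurent_y k (plethV (\<lambda>n. of_sym (powersum n) - of_qt (qq ^ n - 1) * yvar k ^ n) F) *
      fps_to_fls Exp_minus_zX) 1"

text \<open>The direct sum \<open>V\<^sub>*\<close> of the \<open>V\<^sub>k\<close>; \<open>V\<^sub>k\<close> sits in it as \<open>inV k ` V k\<close>.\<close>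

definition Vstar :: "(nat \<Rightarrow>\<^sub>0 symy) set" where
  "Vstar = {v. \<forall>k. Poly_Mapping.lookup v k \<in> V k}"

definition inV :: "nat \<Rightarrow> symy \<Rightarrow> (nat \<Rightarrow>\<^sub>0 symy)" where
  "inV = Poly_Mapping.single"

definition scaleV :: "qt \<Rightarrow> (nat \<Rightarrow>\<^sub>0 symy) \<Rightarrow> (nat \<Rightarrow>\<^sub>0 symy)" where
  "scaleV c v = Poly_Mapping.map (\<lambda>F. of_qt c * F) v"


section \<open>The path algebra of the quiver\<close>

text \<open>Arrows are indexed by their source vertex; \<open>Loop i k\<close> is the loop \<open>T\<^sub>i\<close> at \<open>k\<close>.\<close>

datatype arrow = Dplus nat | Dminus nat | Loop nat nat

fun is_arrow :: "arrow \<Rightarrow> bool" where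
  "is_arrow (Dplus k) = True"
| "is_arrow (Dminus k) = (1 \<le> k)"
| "is_arrow (Loop i k) = (1 \<le> i \<and> i < k)"

fun arrow_src :: "arrow \<Rightarrow> nat" where
  "arrow_src (Dplus k) = k"
| "arrow_src (Dminus k) = k"
| "arrow_src (Loop i k) = k"

fun arrow_tgt :: "arrow \<Rightarrow> nat" where
  "arrow_tgt (Dplus k) = k + 1"
| "arrow_tgt (Dminus k) = k - 1"
| "arrow_tgt (Loop i k) = k"

text \<open>A path is its initial vertex together with its list of arrows, the last arrow travelled
  coming first.\<close>

fun list_tgt :: "nat \<times> arrow list \<Rightarrow> nat" where
  "list_tgt (k, []) = k"
| "list_tgt (k, a # as) = arrow_tgt a"

fun is_path :: "nat \<times> arrow list \<Rightarrow> bool" where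
  "is_path (k, []) = True"
| "is_path (k, a # as) = (is_path (k, as) \<and> is_arrow a \<and> arrow_src a = list_tgt (k, as))"

lemma list_tgt_append: "list_tgt (k, as @ bs) = list_tgt (list_tgt (k, bs), as)"
  by (cases as) auto

lemma is_path_append: "is_path (k, as @ bs) \<longleftrightarrow> is_path (k, bs) \<and> is_path (list_tgt (k, bs), as)"
  by (induction as) (auto simp: list_tgt_append)

typedef path = "{p. is_path p}"
  by (rule exI[of _ "(0, [])"]) simp

setup_lifting type_definition_path

text \<open>\<open>path_comp p r\<close> is the path \<open>r\<close> followed by \<open>p\<close>.\<close>

lift_definition path_comp :: "path \<Rightarrow> path \<Rightarrow> path option" is
  "\<lambda>p r. if fst p = list_tgt r then Some (fst r, snd p @ snd r) else None"
  by (auto simp: is_path_append)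

lemma path_comp_assoc:
  "Option.bind (path_comp p r) (\<lambda>x. path_comp x s) = Option.bind (path_comp r s) (path_comp p)"
proof (transfer, safe)
  fix k as l bs m cs
  show "Option.bind (if fst (k, as) = list_tgt (l, bs)
          then Some (fst (l, bs), snd (k, as) @ snd (l, bs)) else None)
          (\<lambda>x. if fst x = list_tgt (m, cs) then Some (fst (m, cs), snd x @ snd (m, cs)) else None) =
        Option.bind (if fst (l, bs) = list_tgt (m, cs)
          then Some (fst (m, cs), snd (l, bs) @ snd (m, cs)) else None)
          (\<lambda>r. if fst (k, as) = list_tgt r then Some (fst r, snd (k, as) @ snd r) else None)"
    by (simp add: list_tgt_append)
qed

definition basis_mult :: "path \<Rightarrow> path \<Rightarrow> qt \<Rightarrow> path \<Rightarrow>\<^sub>0 qt" where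
  "basis_mult r s c =
     (case path_comp r s of None \<Rightarrow> 0 | Some p \<Rightarrow> Poly_Mapping.single p c)"

definition path_mult :: "(path \<Rightarrow>\<^sub>0 qt) \<Rightarrow> (path \<Rightarrow>\<^sub>0 qt) \<Rightarrow> path \<Rightarrow>\<^sub>0 qt" where
  "path_mult f g = (\<Sum>r\<in>Poly_Mapping.keys f. \<Sum>s\<in>Poly_Mapping.keys g.
     basis_mult r s (Poly_Mapping.lookup f r * Poly_Mapping.lookup g s))"

lemma basis_mult_zero [simp]: "basis_mult r s 0 = 0"
  by (simp add: basis_mult_def split: option.split)

lemma basis_mult_add: "basis_mult r s (c + d) = basis_mult r s c + basis_mult r s d"
  by (simp add: basis_mult_def single_add split: option.split)

lemma path_mult_superset:
  assumes "finite A" "finite B" "Poly_Mapping.keys f \<subseteq> A" "Poly_Mapping.keys g \<subseteq> B"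
  shows "path_mult f g = (\<Sum>r\<in>A. \<Sum>s\<in>B.
     basis_mult r s (Poly_Mapping.lookup f r * Poly_Mapping.lookup g s))"
proof -
  have "path_mult f g = (\<Sum>r\<in>Poly_Mapping.keys f. \<Sum>s\<in>B.
     basis_mult r s (Poly_Mapping.lookup f r * Poly_Mapping.lookup g s))"
    unfolding path_mult_def
    by (rule sum.cong[OF refl], rule sum.mono_neutral_left)
       (use assms in \<open>auto simp: in_keys_iff\<close>)
  also have "\<dots> = (\<Sum>r\<in>A. \<Sum>s\<in>B.
     basis_mult r s (Poly_Mapping.lookup f r * Poly_Mapping.lookup g s))"
    by (rule sum.mono_neutral_left) (use assms in \<open>auto simp: in_keys_iff\<close>)
  finally show ?thesis .
qed

lemma path_mult_add_left: "path_mult (f + g) h = path_mult f h + path_mult g h"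
proof -
  let ?A = "Poly_Mapping.keys f \<union> Poly_Mapping.keys g" and ?B = "Poly_Mapping.keys h"
  have "Poly_Mapping.keys (f + g) \<subseteq> ?A" by (rule Poly_Mapping.keys_add)
  then show ?thesis
    using path_mult_superset[of ?A ?B f h] path_mult_superset[of ?A ?B g h]
      path_mult_superset[of ?A ?B "f + g" h]
    by (simp add: lookup_add distrib_right basis_mult_add sum.distrib)
qed

lemma path_mult_add_right: "path_mult h (f + g) = path_mult h f + path_mult h g"
proof -
  let ?A = "Poly_Mapping.keys f \<union> Poly_Mapping.keys g" and ?B = "Poly_Mapping.keys h"
  have "Poly_Mapping.keys (f + g) \<subseteq> ?A" by (rule Poly_Mapping.keys_add)
  then show ?thesis
    using path_mult_superset[of ?B ?A h f] path_mult_superset[of ?B ?A h g]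
      path_mult_superset[of ?B ?A h "f + g"]
    by (simp add: lookup_add distrib_left basis_mult_add sum.distrib)
qed

lemma path_mult_zero [simp]: "path_mult 0 f = 0" "path_mult f 0 = 0"
  by (simp_all add: path_mult_def)

lemma path_mult_sum:
  "path_mult (\<Sum>i\<in>I. F i) g = (\<Sum>i\<in>I. path_mult (F i) g)"
  "path_mult g (\<Sum>i\<in>I. F i) = (\<Sum>i\<in>I. path_mult g (F i))"
  by (induction I rule: infinite_finite_induct)
     (auto simp: path_mult_add_left path_mult_add_right)

lemma path_mult_single:
  "path_mult (Poly_Mapping.single r c) (Poly_Mapping.single s d) = basis_mult r s (c * d)"
  by (subst path_mult_superset[of "{r}" "{s}"]) (auto simp: lookup_single)

lemma path_mult_single_assoc:
  "path_mult (path_mult (Poly_Mapping.single p a) (Poly_Mapping.single r b)) (Poly_Mapping.single s c) =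
   path_mult (Poly_Mapping.single p a) (path_mult (Poly_Mapping.single r b) (Poly_Mapping.single s c))"
  using path_comp_assoc[of p r s]
  by (auto simp: path_mult_single basis_mult_def mult.assoc split: option.splits)

lemma sum_singles: "f = (\<Sum>r\<in>Poly_Mapping.keys f. Poly_Mapping.single r (Poly_Mapping.lookup f r))"
  by (rule poly_mapping_eqI)
     (auto simp: lookup_sum lookup_single when_def in_keys_iff if_distrib cong: if_cong)

lemma path_mult_assoc: "path_mult (path_mult f g) h = path_mult f (path_mult g h)"
  by (subst (1 2) sum_singles[of f], subst (1 2) sum_singles[of g], subst (1 2) sum_singles[of h])
     (simp only: path_mult_sum path_mult_single_assoc)

text \<open>The path algebra over the ground field, a ring without unit; a copy of the type of finitely
  supported functions on paths, because multiplication on the latter is already taken by the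
  convolution product for monoids.\<close>

typedef pathalg = "UNIV :: (path \<Rightarrow>\<^sub>0 qt) set" ..

setup_lifting type_definition_pathalg

instantiation pathalg :: ring
begin

lift_definition zero_pathalg :: pathalg is 0 .
lift_definition plus_pathalg :: "pathalg \<Rightarrow> pathalg \<Rightarrow> pathalg" is "(+)" .
lift_definition uminus_pathalg :: "pathalg \<Rightarrow> pathalg" is uminus .
lift_definition minus_pathalg :: "pathalg \<Rightarrow> pathalg \<Rightarrow> pathalg" is "(-)" .
lift_definition times_pathalg :: "pathalg \<Rightarrow> pathalg \<Rightarrow> pathalg" is path_mult .

instance
  by standard
     (transfer; simp add: path_mult_assoc path_mult_add_left path_mult_add_right algebra_simps)+

end

context
  fixes c :: qt
begin

lift_definition path_scale :: "pathalg \<Rightarrow> pathalg" is "Poly_Mapping.map ((*) c)" .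

end

lemma lookup_scale:
  "Poly_Mapping.lookup (Poly_Mapping.map ((*) c) f) x = (c :: qt) * Poly_Mapping.lookup f x"
  by (simp add: map.rep_eq when_def)

lemma path_mult_scale:
  "path_mult (Poly_Mapping.map ((*) c) f) g = Poly_Mapping.map ((*) c) (path_mult f g)"
  "path_mult f (Poly_Mapping.map ((*) c) g) = Poly_Mapping.map ((*) c) (path_mult f g)"
proof -
  have k: "Poly_Mapping.keys (Poly_Mapping.map ((*) c) f) \<subseteq> Poly_Mapping.keys f"
    for f :: "path \<Rightarrow>\<^sub>0 qt"
    by (rule subsetI) (simp add: in_keys_iff lookup_scale)
  have s: "Poly_Mapping.map ((*) c) (\<Sum>i\<in>I. F i) = (\<Sum>i\<in>I. Poly_Mapping.map ((*) c) (F i))"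
    for I :: "path set" and F :: "path \<Rightarrow> path \<Rightarrow>\<^sub>0 qt"
    by (rule poly_mapping_eqI) (simp add: lookup_scale lookup_sum sum_distrib_left)
  have b: "Poly_Mapping.map ((*) c) (basis_mult r u d) = basis_mult r u (c * d)" for r u d
    by (rule poly_mapping_eqI)
       (simp add: lookup_scale basis_mult_def lookup_single when_def split: option.split)
  show "path_mult (Poly_Mapping.map ((*) c) f) g = Poly_Mapping.map ((*) c) (path_mult f g)"
    unfolding path_mult_superset[OF finite_keys finite_keys k order_refl]
    by (simp only: path_mult_def lookup_scale s b mult.assoc)
  show "path_mult f (Poly_Mapping.map ((*) c) g) = Poly_Mapping.map ((*) c) (path_mult f g)"
    unfolding path_mult_superset[OF finite_keys finite_keys order_refl k]
    by (simp only: path_mult_def lookup_scale s b mult.left_commute)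
qed

lemma path_scale_mult:
  "path_scale c x * y = path_scale c (x * y)" "x * path_scale c y = path_scale c (x * y)"
  by (transfer fixing: c, simp only: path_mult_scale)+

interpretation pathalg: vector_space path_scale
proof
  fix a b :: qt and x y :: pathalg
  show "path_scale a (x + y) = path_scale a x + path_scale a y"
    by (transfer fixing: a b, rule poly_mapping_eqI)
       (simp add: lookup_scale lookup_add algebra_simps)
  show "path_scale (a + b) x = path_scale a x + path_scale b x"
    by (transfer fixing: a b, rule poly_mapping_eqI)
       (simp add: lookup_scale lookup_add algebra_simps)
  show "path_scale a (path_scale b x) = path_scale (a * b) x"
    by (transfer fixing: a b, rule poly_mapping_eqI)
       (simp add: lookup_scale algebra_simps)
  show "path_scale 1 x = x"
    by (transfer, rule poly_mapping_eqI) (simp add: lookup_scale)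
qed

definition path_basis :: "path \<Rightarrow> pathalg" where
  "path_basis p = Abs_pathalg (Poly_Mapping.single p 1)"

definition pe :: "nat \<Rightarrow> pathalg" where
  "pe k = path_basis (Abs_path (k, []))"

text \<open>The element given by an arrow (zero if the quiver has no such arrow).\<close>

definition arrow_elem :: "arrow \<Rightarrow> pathalg" where
  "arrow_elem a = (if is_arrow a then path_basis (Abs_path (arrow_src a, [a])) else 0)"

abbreviation pdp :: "nat \<Rightarrow> pathalg" where "pdp k \<equiv> arrow_elem (Dplus k)"
abbreviation pdm :: "nat \<Rightarrow> pathalg" where "pdm k \<equiv> arrow_elem (Dminus k)"
abbreviation pT :: "nat \<Rightarrow> nat \<Rightarrow> pathalg" where "pT i k \<equiv> arrow_elem (Loop i k)"


section \<open>The Dyck path algebra\<close>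

text \<open>The defining relations for paths beginning at vertex \<open>k\<close>.\<close>

inductive dyck_rel :: "pathalg \<Rightarrow> pathalg \<Rightarrow> bool" where
  quadratic:
  "1 \<le> i \<Longrightarrow> i < k \<Longrightarrow> dyck_rel ((pT i k - pe k) * (pT i k + path_scale qq (pe k))) 0"
| braid:
  "1 \<le> i \<Longrightarrow> i + 1 < k \<Longrightarrow>
     dyck_rel (pT i k * pT (i + 1) k * pT i k) (pT (i + 1) k * pT i k * pT (i + 1) k)"
| commute:
  "1 \<le> i \<Longrightarrow> i < k \<Longrightarrow> 1 \<le> j \<Longrightarrow> j < k \<Longrightarrow> i + 1 < j \<or> j + 1 < i \<Longrightarrow>
     dyck_rel (pT i k * pT j k) (pT j k * pT i k)"
| T_dminus:
  "1 \<le> i \<Longrightarrow> i + 1 < k \<Longrightarrow> dyck_rel (pT i (k - 1) * pdm k) (pdm k * pT i k)"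
| dplus_T:
  "1 \<le> i \<Longrightarrow> i < k \<Longrightarrow> dyck_rel (pdp k * pT i k) (pT (i + 1) (k + 1) * pdp k)"
| T_dplus_dplus:
  "dyck_rel (pT 1 (k + 2) * pdp (k + 1) * pdp k) (pdp (k + 1) * pdp k)"
| dminus_dminus_T:
  "2 \<le> k \<Longrightarrow> dyck_rel (pdm (k - 1) * pdm k * pT (k - 1) k) (pdm (k - 1) * pdm k)"
| dminus_commutator:
  "2 \<le> k \<Longrightarrow>
     dyck_rel (pdm k * (pdp (k - 1) * pdm k - pdm (k + 1) * pdp k) * pT (k - 1) k)
       (path_scale qq ((pdp (k - 2) * pdm (k - 1) - pdm k * pdp (k - 1)) * pdm k))"
| commutator_dplus:
  "1 \<le> k \<Longrightarrow>
     dyck_rel (pT 1 (k + 1) * (pdp k * pdm (k + 1) - pdm (k + 2) * pdp (k + 1)) * pdp k)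
       (path_scale qq (pdp k * (pdp (k - 1) * pdm k - pdm (k + 1) * pdp k)))"

text \<open>The two-sided ideal generated by the relations.\<close>

inductive_set dyck_ideal :: "pathalg set" where
  rel: "dyck_rel x y \<Longrightarrow> x - y \<in> dyck_ideal"
| zero: "0 \<in> dyck_ideal"
| add: "x \<in> dyck_ideal \<Longrightarrow> y \<in> dyck_ideal \<Longrightarrow> x + y \<in> dyck_ideal"
| scale: "x \<in> dyck_ideal \<Longrightarrow> path_scale c x \<in> dyck_ideal"
| mult_left: "x \<in> dyck_ideal \<Longrightarrow> a * x \<in> dyck_ideal"
| mult_right: "x \<in> dyck_ideal \<Longrightarrow> x * a \<in> dyck_ideal"

lemma dyck_ideal_uminus: "x \<in> dyck_ideal \<Longrightarrow> - x \<in> dyck_ideal"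
  using dyck_ideal.scale[of x "-1"] by simp

definition dyck_eq :: "pathalg \<Rightarrow> pathalg \<Rightarrow> bool" where
  "dyck_eq x y \<longleftrightarrow> x - y \<in> dyck_ideal"

quotient_type dyck = pathalg / dyck_eq
proof (rule equivpI)
  show "reflp dyck_eq"
    by (simp add: reflp_def dyck_eq_def dyck_ideal.zero)
  show "symp dyck_eq"
    using dyck_ideal_uminus by (force simp: symp_def dyck_eq_def)
  show "transp dyck_eq"
    using dyck_ideal.add by (force simp: transp_def dyck_eq_def)
qed

instantiation dyck :: ring
begin

lift_definition zero_dyck :: dyck is 0 .

lift_definition plus_dyck :: "dyck \<Rightarrow> dyck \<Rightarrow> dyck" is "(+)"
  unfolding dyck_eq_def using dyck_ideal.add by (metis add_diff_add)

lift_definition uminus_dyck :: "dyck \<Rightarrow> dyck" is uminus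
  unfolding dyck_eq_def using dyck_ideal_uminus by (metis minus_diff_minus)

lift_definition minus_dyck :: "dyck \<Rightarrow> dyck \<Rightarrow> dyck" is "(-)"
proof -
  fix a b c d assume "dyck_eq a b" "dyck_eq c d"
  then have "(a - b) + - (c - d) \<in> dyck_ideal"
    unfolding dyck_eq_def by (intro dyck_ideal.add dyck_ideal_uminus)
  then show "dyck_eq (a - c) (b - d)"
    by (simp add: dyck_eq_def algebra_simps)
qed

lift_definition times_dyck :: "dyck \<Rightarrow> dyck \<Rightarrow> dyck" is "(*)"
proof -
  fix a b c d assume "dyck_eq a b" "dyck_eq c d"
  then have "(a - b) * c + b * (c - d) \<in> dyck_ideal"
    unfolding dyck_eq_def
    by (intro dyck_ideal.add dyck_ideal.mult_left dyck_ideal.mult_right)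
  then show "dyck_eq (a * c) (b * d)"
    by (simp add: dyck_eq_def algebra_simps)
qed

instance
proof
  have eq: "dyck_eq x y" if "x = y" for x y
    using that by (simp add: dyck_eq_def dyck_ideal.zero)
  fix a b c :: dyck
  show "a + b + c = a + (b + c)" by transfer (rule eq, simp add: algebra_simps)
  show "a + b = b + a" by transfer (rule eq, simp add: algebra_simps)
  show "0 + a = a" by transfer (rule eq, simp)
  show "- a + a = 0" by transfer (rule eq, simp)
  show "a - b = a + - b" by transfer (rule eq, simp)
  show "a * b * c = a * (b * c)" by transfer (rule eq, simp add: algebra_simps)
  show "(a + b) * c = a * c + b * c" by transfer (rule eq, simp add: algebra_simps)
  show "a * (b + c) = a * b + a * c" by transfer (rule eq, simp add: algebra_simps)
qed

end

context
  fixes c :: qt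
begin

lift_definition dyck_scale :: "dyck \<Rightarrow> dyck" is "path_scale c"
  unfolding dyck_eq_def by (metis dyck_ideal.scale pathalg.scale_right_diff_distrib)

end

interpretation dyck: vector_space dyck_scale
proof
  have eq: "dyck_eq x y" if "x = y" for x y
    using that by (simp add: dyck_eq_def dyck_ideal.zero)
  fix a b :: qt and x y :: dyck
  show "dyck_scale a (x + y) = dyck_scale a x + dyck_scale a y"
    by (transfer fixing: a b) (rule eq, simp add: pathalg.scale_right_distrib)
  show "dyck_scale (a + b) x = dyck_scale a x + dyck_scale b x"
    by (transfer fixing: a b) (rule eq, simp add: pathalg.scale_left_distrib)
  show "dyck_scale a (dyck_scale b x) = dyck_scale (a * b) x"
    by (transfer fixing: a b) (rule eq, simp)
  show "dyck_scale 1 x = x"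
    by (transfer fixing: a b) (rule eq, simp)
qed

lift_definition dyck_e :: "nat \<Rightarrow> dyck" is pe .
lift_definition dyck_dplus :: "nat \<Rightarrow> dyck" is "\<lambda>k. pdp k" .
lift_definition dyck_dminus :: "nat \<Rightarrow> dyck" is "\<lambda>k. pdm k" .
lift_definition dyck_T :: "nat \<Rightarrow> nat \<Rightarrow> dyck" is "\<lambda>i k. pT i k" .

definition Ae0 :: "dyck set" where
  "Ae0 = {a * dyck_e 0 | a. True}"

definition ekAe0 :: "nat \<Rightarrow> dyck set" where
  "ekAe0 k = {dyck_e k * a * dyck_e 0 | a. True}"


section \<open>Representations\<close>

definition linear_map_on ::
  "'a::ab_group_add set \<Rightarrow> (qt \<Rightarrow> 'a \<Rightarrow> 'a) \<Rightarrow> (qt \<Rightarrow> 'b::ab_group_add \<Rightarrow> 'b) \<Rightarrow> ('a \<Rightarrow> 'b) \<Rightarrow> bool"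
where
  "linear_map_on S s1 s2 f \<longleftrightarrow>
     (\<forall>x\<in>S. \<forall>y\<in>S. f (x + y) = f x + f y) \<and> (\<forall>c. \<forall>x\<in>S. f (s1 c x) = s2 c (f x))"

text \<open>A representation of the Dyck path algebra on the subspace \<open>W\<close>: an algebra homomorphism into the
  linear endomorphisms of \<open>W\<close> (the algebra has no unit to preserve).\<close>

definition dyck_representation ::
  "'v::ab_group_add set \<Rightarrow> (qt \<Rightarrow> 'v \<Rightarrow> 'v) \<Rightarrow> (dyck \<Rightarrow> 'v \<Rightarrow> 'v) \<Rightarrow> bool"
where
  "dyck_representation W s \<rho> \<longleftrightarrow>
     (\<forall>a. \<forall>v\<in>W. \<rho> a v \<in> W) \<and>
     (\<forall>a. linear_map_on W s s (\<rho> a)) \<and>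
     (\<forall>v\<in>W. linear_map_on UNIV dyck_scale s (\<lambda>a. \<rho> a v)) \<and>
     (\<forall>a b. \<forall>v\<in>W. \<rho> (a * b) v = \<rho> a (\<rho> b v))"

definition dyck_rep_iso ::
  "'v::ab_group_add set \<Rightarrow> (qt \<Rightarrow> 'v \<Rightarrow> 'v) \<Rightarrow> (dyck \<Rightarrow> 'v \<Rightarrow> 'v) \<Rightarrow>
   'w::ab_group_add set \<Rightarrow> (qt \<Rightarrow> 'w \<Rightarrow> 'w) \<Rightarrow> (dyck \<Rightarrow> 'w \<Rightarrow> 'w) \<Rightarrow> ('v \<Rightarrow> 'w) \<Rightarrow> bool"
where
  "dyck_rep_iso W s \<rho> W' s' \<rho>' \<phi> \<longleftrightarrow>
     bij_betw \<phi> W W' \<and> linear_map_on W s s' \<phi> \<and>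
     (\<forall>a. \<forall>v\<in>W. \<phi> (\<rho> a v) = \<rho>' a (\<phi> v))"

text \<open>\<open>\<rho>\<close> is given on generators by the operators on \<open>V\<^sub>*\<close>, each extended by zero to the components
  other than the one at its source vertex.\<close>

definition acts_by_operators :: "(dyck \<Rightarrow> (nat \<Rightarrow>\<^sub>0 symy) \<Rightarrow> (nat \<Rightarrow>\<^sub>0 symy)) \<Rightarrow> bool" where
  "acts_by_operators \<rho> \<longleftrightarrow> (\<forall>v\<in>Vstar. \<forall>k.
     \<rho> (dyck_e k) v = inV k (Poly_Mapping.lookup v k) \<and>
     \<rho> (dyck_dplus k) v = inV (k + 1) (opdplus k (Poly_Mapping.lookup v k)) \<and>
     (1 \<le> k \<longrightarrow> \<rho> (dyck_dminus k) v = inV (k - 1) (opdminus k (Poly_Mapping.lookup v k))) \<and>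
     (\<forall>i. 1 \<le> i \<and> i < k \<longrightarrow> \<rho> (dyck_T i k) v = inV k (opT i (Poly_Mapping.lookup v k))))"

end

theory Submission
  imports Defs "HOL-Combinatorics.Permutations"
begin

text \<open>On \<open>V\<^sub>*\<close>, write \<open>\<theta>\<^sub>k\<close> for the automorphism \<open>F \<mapsto> F[X + (q-1) y\<^sub>k]\<close>.  Then \<open>d\<^sub>+ = T\<^sub>1 \<cdots> T\<^sub>k \<theta>\<^sub>k\<^sub>+\<^sub>1\<close> and
  \<open>d\<^sub>- = L\<^sub>k \<theta>\<^sub>k\<^sup>-\<^sup>1\<close>, where \<open>L\<^sub>k\<close> is linear over the polynomials without \<open>y\<^sub>k\<close> and sends \<open>y\<^sub>k\<^sup>n\<close> to
  \<open>\<epsilon>\<^sub>n = -h\<^sub>n\<^sub>+\<^sub>1[-X]\<close>.  The key identity \<open>\<theta>\<^sub>k d\<^sub>- - d\<^sub>- T\<^sub>k \<theta>\<^sub>k\<^sub>+\<^sub>1 = (q-1) y\<^sub>k\<close> gives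
  \<open>[d\<^sub>+, d\<^sub>-] = (q-1) T\<^sub>1 \<cdots> T\<^sub>k\<^sub>-\<^sub>1 y\<^sub>k\<close>, from which the relations of the algebra follow.

  Conversely, in the algebra this formula defines commuting elements \<open>y\<^sub>1, \<dots>, y\<^sub>k\<close> that satisfy the affine
  Hecke relations with the \<open>T\<^sub>i\<close>.  The elements \<open>E\<^sub>n = d\<^sub>- y\<^sub>1\<^sup>n d\<^sub>+ e\<^sub>0\<close> commute with each other, and the
  products \<open>y\<^sup>a d\<^sub>+\<^sup>k E\<^sub>n\<^sub>1 \<cdots> E\<^sub>n\<^sub>r\<close> span \<open>e\<^sub>k A e\<^sub>0\<close>.  They act on \<open>1\<close> as
  \<open>\<theta>\<^sub>1 \<cdots> \<theta>\<^sub>k (y\<^sup>a \<epsilon>\<^sub>n\<^sub>1 \<cdots> \<epsilon>\<^sub>n\<^sub>r)\<close>, and since the \<open>\<epsilon>\<^sub>n\<close> are algebraically independent generators of the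
  symmetric functions, these form a basis of \<open>V\<^sub>k\<close>.\<close>

subsection \<open>Linear and multiplicative extension over finitely supported functions\<close>

text \<open>The two halves bound \<open>e_k A e_0\<close> from opposite sides: the relations alone
  show that the listed products span, and the action on 1 shows that nothing more collapses. No
  normal form of paths is required. The obstacle in the spanning half is \<open>d_-\<close>. It can
  be moved past \<open>y_1, ..., y_(k-1)\<close> but not past \<open>y_k\<close>, so the elements
  \<open>d_- y_k^n d_+^k\<close> have to be rewritten: the algebra form of the key identity lowers
  \<open>k\<close>, and a recursion for \<open>T_i\<close> on powers of \<open>y_i\<close> raises
  \<open>n\<close>. Injectivity is not phrased as linear independence. Every element of the span is
  the image of a polynomial \<open>P\<close> under one fixed map, and its action on 1 returns an
  automorphism applied to \<open>P\<close>, so \<open>P\<close> and hence the element can be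
  recovered. Since \<open>pleth\<close> and \<open>opT\<close> are definite descriptions, computing
  with them presupposes that the power sums are algebraically independent generators and that an
  exact quotient by \<open>y_(i+1) - y_i\<close> exists and is unique. Identities between the
  \<open>h_n[A]\<close> are compared through Newton's recursion, whose solution is unique in
  characteristic 0.\<close>

lemma pm_induct [case_names add single]:
  fixes f :: "'a \<Rightarrow>\<^sub>0 'b::comm_monoid_add"
  assumes add: "\<And>f g. P f \<Longrightarrow> P g \<Longrightarrow> P (f + g)"
    and single: "\<And>m c. P (Poly_Mapping.single m c)"
  shows "P f"
proof -
  have "P (\<Sum>m\<in>A. Poly_Mapping.single m (Poly_Mapping.lookup f m))" if "finite A" for A
    using that
  proof (induction A)
    case empty
    show ?case using single[of undefined 0] by simp
  qed (simp add: add single)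
  from this[of "Poly_Mapping.keys f"] show ?thesis
    by (simp flip: sum_singles)
qed

text \<open>Shared shape of \<open>meval\<close>, \<open>plethV\<close>, \<open>swap_y\<close>,
  \<open>Ly\<close> and \<open>mact\<close>: \<open>f\<close> acts on coefficients and
  \<open>\<mu>\<close> on basis elements. Multiplicativity is not built in, because
  \<open>Ly\<close> and \<open>mact\<close> are only linear.\<close>

definition pm_lift ::
  "('b::comm_monoid_add \<Rightarrow> 'c::comm_semiring_0) \<Rightarrow> ('a \<Rightarrow> 'c) \<Rightarrow> ('a \<Rightarrow>\<^sub>0 'b) \<Rightarrow> 'c" where
  "pm_lift f \<mu> F = (\<Sum>m\<in>Poly_Mapping.keys F. f (Poly_Mapping.lookup F m) * \<mu> m)"

lemma pm_lift_superset:
  assumes "f 0 = 0" "finite A" "Poly_Mapping.keys F \<subseteq> A"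
  shows "pm_lift f \<mu> F = (\<Sum>m\<in>A. f (Poly_Mapping.lookup F m) * \<mu> m)"
  unfolding pm_lift_def
  by (rule sum.mono_neutral_left) (use assms in \<open>auto simp: in_keys_iff\<close>)

lemma pm_lift_add:
  assumes "f 0 = 0" "\<And>x y. f (x + y) = f x + f y"
  shows "pm_lift f \<mu> (F + G) = pm_lift f \<mu> F + pm_lift f \<mu> G"
proof -
  let ?A = "Poly_Mapping.keys F \<union> Poly_Mapping.keys G"
  have "Poly_Mapping.keys (F + G) \<subseteq> ?A"
    by (rule Poly_Mapping.keys_add)
  then show ?thesis
    using pm_lift_superset[of f ?A F \<mu>] pm_lift_superset[of f ?A G \<mu>]
      pm_lift_superset[of f ?A "F + G" \<mu>] assms
    by (simp add: lookup_add distrib_right sum.distrib)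
qed

lemma pm_lift_single: "f 0 = 0 \<Longrightarrow> pm_lift f \<mu> (Poly_Mapping.single m c) = f c * \<mu> m"
  by (subst pm_lift_superset[of _ "{m}"]) auto

lemma pm_lift_0 [simp]: "pm_lift f \<mu> 0 = 0"
  by (simp add: pm_lift_def)

lemma pm_lift_mult:
  fixes F G :: "'a::comm_monoid_add \<Rightarrow>\<^sub>0 'b::comm_semiring_0"
  assumes f: "f 0 = 0" "\<And>x y. f (x + y) = f x + f y" "\<And>x y. f (x * y) = f x * f y"
    and \<mu>: "\<And>m n. \<mu> (m + n) = \<mu> m * \<mu> n"
  shows "pm_lift f \<mu> (F * G) = pm_lift f \<mu> F * pm_lift f \<mu> G"
proof (induction F rule: pm_induct)
  case (add F F')
  then show ?case by (simp add: pm_lift_add f distrib_right)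
next
  case (single m c)
  show ?case
  proof (induction G rule: pm_induct)
    case (add G G')
    then show ?case by (simp add: pm_lift_add f distrib_left)
  next
    case (single n d)
    show ?case by (simp add: pm_lift_single f mult_single \<mu> algebra_simps)
  qed
qed

definition ring_map :: "('a::comm_ring_1 \<Rightarrow> 'b::comm_ring_1) \<Rightarrow> bool" where
  "ring_map f \<longleftrightarrow> (\<forall>x y. f (x + y) = f x + f y) \<and> (\<forall>x y. f (x * y) = f x * f y) \<and> f 1 = 1"

lemma ring_mapI:
  "(\<And>x y. f (x + y) = f x + f y) \<Longrightarrow> (\<And>x y. f (x * y) = f x * f y) \<Longrightarrow> f 1 = 1 \<Longrightarrow> ring_map f"
  by (auto simp: ring_map_def)

lemma ring_mapD:
  assumes "ring_map f"
  shows "f (x + y) = f x + f y" "f (x * y) = f x * f y" "f 1 = 1" "f 0 = 0"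
    "f (- x) = - f x" "f (x - y) = f x - f y" "f (x ^ n) = f x ^ n" "f (of_nat n) = of_nat n"
    "f (sum g A) = (\<Sum>a\<in>A. f (g a))" "f (prod_mset M) = prod_mset (image_mset f M)"
proof -
  show add: "f (x + y) = f x + f y" for x y using assms by (simp add: ring_map_def)
  show mult: "f (x * y) = f x * f y" for x y using assms by (simp add: ring_map_def)
  show one: "f 1 = 1" using assms by (simp add: ring_map_def)
  show zero: "f 0 = 0" using add[of 0 0] by simp
  show um: "f (- x) = - f x" for x
    using add[of x "- x"] zero by (simp add: minus_unique)
  show "f (x - y) = f x - f y" using add[of x "- y"] um by simp
  show "f (x ^ n) = f x ^ n" by (induction n) (simp_all add: mult one)
  show "f (of_nat n) = of_nat n" by (induction n) (simp_all add: add one zero)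
  show "f (sum g A) = (\<Sum>a\<in>A. f (g a))"
    by (induction A rule: infinite_finite_induct) (simp_all add: add zero)
  show "f (prod_mset M) = prod_mset (image_mset f M)"
    by (induction M) (simp_all add: mult one)
qed

lemma ring_map_comp: "ring_map f \<Longrightarrow> ring_map g \<Longrightarrow> ring_map (\<lambda>x. f (g x))"
  by (simp add: ring_map_def)

lemma ring_map_pm_lift:
  assumes f: "ring_map f"
    and \<mu>: "\<And>m n :: 'a::comm_monoid_add. \<mu> (m + n) = \<mu> m * \<mu> n" "\<mu> 0 = 1"
  shows "ring_map (pm_lift f \<mu>)"
proof (rule ring_mapI)
  note [simp] = ring_mapD[OF f] \<mu>
  show "pm_lift f \<mu> (x + y) = pm_lift f \<mu> x + pm_lift f \<mu> y" for x y
    by (simp add: pm_lift_add)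
  show "pm_lift f \<mu> (x * y) = pm_lift f \<mu> x * pm_lift f \<mu> y" for x y
    by (rule pm_lift_mult) simp_all
  show "pm_lift f \<mu> 1 = 1"
    using pm_lift_single[of f \<mu> 0 1] by simp
qed

subsection \<open>Polynomials in countably many variables\<close>

text \<open>A monomial is a multiset of variable indices, so its value is a
  \<open>prod_mset\<close>, and products of commuting algebra elements can later be folded over the
  same index.\<close>

type_synonym 'a mpoly = "nat multiset \<Rightarrow>\<^sub>0 'a"

definition mvar :: "nat \<Rightarrow> 'a::comm_ring_1 mpoly" where
  "mvar n = Poly_Mapping.single {#n#} 1"

abbreviation mconst :: "'a::comm_ring_1 \<Rightarrow> 'a mpoly" where
  "mconst \<equiv> Poly_Mapping.single 0"

definition meval :: "('a::comm_ring_1 \<Rightarrow> 'r::comm_ring_1) \<Rightarrow> (nat \<Rightarrow> 'r) \<Rightarrow> 'a mpoly \<Rightarrow> 'r" where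
  "meval \<iota> a = pm_lift \<iota> (\<lambda>M. prod_mset (image_mset a M))"

lemma ring_map_mconst: "ring_map mconst"
  by (rule ring_mapI) (simp_all add: single_add mult_single)

lemma ring_map_meval: "ring_map \<iota> \<Longrightarrow> ring_map (meval \<iota> a)"
  unfolding meval_def by (rule ring_map_pm_lift) simp_all

lemma meval_single: "ring_map \<iota> \<Longrightarrow> meval \<iota> a (Poly_Mapping.single M c) = \<iota> c * prod_mset (image_mset a M)"
  by (simp add: meval_def pm_lift_single ring_mapD)

lemma meval_mconst: "ring_map \<iota> \<Longrightarrow> meval \<iota> a (mconst c) = \<iota> c"
  by (simp add: meval_single)

lemma meval_mvar: "ring_map \<iota> \<Longrightarrow> meval \<iota> a (mvar n) = a n"
  by (simp add: mvar_def meval_single ring_mapD)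

lemma ring_map_meval_comp:
  assumes "ring_map f" "ring_map \<iota>"
  shows "f (meval \<iota> a F) = meval (\<lambda>c. f (\<iota> c)) (\<lambda>n. f (a n)) F"
  using assms
  by (simp add: meval_def pm_lift_def ring_mapD multiset.map_comp comp_def)

lemma prod_mset_mvar: "prod_mset (image_mset mvar M) = (Poly_Mapping.single M 1 :: 'a::comm_ring_1 mpoly)"
  by (induction M) (auto simp: mvar_def mult_single zero_multiset_def[symmetric])

lemma meval_id: "meval mconst mvar F = F"
  unfolding meval_def pm_lift_def prod_mset_mvar
  by (simp add: mult_single flip: sum_singles)

subsection \<open>Symmetric functions as polynomials in the power sums\<close>

text \<open>Characteristic 0: it lets Newton's identities be solved for \<open>h n\<close> and keeps
  positive integer coefficients from vanishing.\<close>

lemma of_nat_qt_eq_0 [simp]: "(of_nat n :: qt) = 0 \<longleftrightarrow> n = 0"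
  by (simp add: of_nat_fract Zero_fract_def eq_fract of_nat_poly)

lemma ring_map_sym_const: "ring_map sym_const"
proof (rule ring_mapI)
  show "sym_const (x + y) = sym_const x + sym_const y" for x y
    by (rule scoeff_inject[THEN iffD1]) (auto simp: sym_const.rep_eq plus_sym.rep_eq)
  have "(\<Sum>(a, b)\<in>splits m. (if a = 0 then x else 0) * (if b = 0 then y else 0)) =
      (if m = 0 then x * y else 0)" for x y :: qt and m
  proof -
    have "(\<Sum>(a, b)\<in>splits m. (if a = 0 then x else 0) * (if b = 0 then y else 0)) =
        (\<Sum>(a, b)\<in>{(0 :: monom, m)}. (if a = 0 then x else 0) * (if b = 0 then y else 0))"
      by (intro sum.mono_neutral_right finite_splits) (auto simp: splits_def split: if_splits)
    then show ?thesis by simp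
  qed
  then show "sym_const (x * y) = sym_const x * sym_const y" for x y
    by (intro scoeff_inject[THEN iffD1]) (auto simp: sym_const.rep_eq times_sym.rep_eq)
  show "sym_const 1 = 1"
    by (rule scoeff_inject[THEN iffD1]) (auto simp: sym_const.rep_eq one_sym.rep_eq)
qed

lemma scoeff_const_mult: "scoeff (sym_const c * F) m = c * scoeff F m"
proof -
  have "(\<Sum>(a, b)\<in>splits m. (if a = 0 then c else 0) * scoeff F b) =
      (\<Sum>(a, b)\<in>{(0 :: monom, m)}. (if a = 0 then c else 0) * scoeff F b)"
    by (intro sum.mono_neutral_right finite_splits) (auto simp: splits_def split: if_splits)
  then show ?thesis
    by (simp add: sym_const.rep_eq times_sym.rep_eq)
qed

lemma scoeff_sum: "scoeff (sum F A) m = (\<Sum>a\<in>A. scoeff (F a) m)"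
  by (induction A rule: infinite_finite_induct) (simp_all add: plus_sym.rep_eq zero_sym.rep_eq)

text \<open>Only splittings whose first part is a pure power \<open>x_i^n\<close> contribute, and
  \<open>0 < n\<close> makes \<open>i\<close> recoverable from that power.\<close>

lemma scoeff_powersum_mult:
  assumes "0 < n"
  shows "scoeff (powersum n * G) m =
    (\<Sum>i\<in>{i. n \<le> Poly_Mapping.lookup m i}. scoeff G (m - Poly_Mapping.single i n))"
proof -
  let ?I = "{i. n \<le> Poly_Mapping.lookup m i}"
  let ?h = "\<lambda>i. (Poly_Mapping.single i n, m - Poly_Mapping.single i n)"
  let ?f = "\<lambda>(a, b). scoeff (powersum n) a * scoeff G b"
  have inj: "inj_on ?h ?I"
  proof (rule inj_onI)
    fix i j assume "?h i = ?h j"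
    then have "Poly_Mapping.lookup (Poly_Mapping.single i n) i = Poly_Mapping.lookup (Poly_Mapping.single j n) i"
      by simp
    then show "i = j" using assms by (simp add: lookup_single when_def split: if_splits)
  qed
  have "?h ` ?I \<subseteq> splits m"
  proof safe
    fix i assume i: "n \<le> Poly_Mapping.lookup m i"
    have "Poly_Mapping.single i n + (m - Poly_Mapping.single i n) = m"
      by (rule poly_mapping_eqI) (use i in \<open>auto simp: lookup_add lookup_minus lookup_single when_def\<close>)
    then show "?h i \<in> splits m" by (simp add: splits_def)
  qed
  moreover have "?f x = 0" if "x \<in> splits m - ?h ` ?I" for x
  proof (rule ccontr)
    obtain a b where x: "x = (a, b)" by fastforce
    assume "?f x \<noteq> 0"
    then obtain i where i: "a = Poly_Mapping.single i n"
      by (auto simp: powersum.rep_eq x split: if_splits)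
    have m: "m = a + b" using that x by (auto simp: splits_def)
    have "b = m - a" by (simp add: m)
    moreover have "n \<le> Poly_Mapping.lookup m i"
      by (simp add: m i lookup_add)
    ultimately show False using that x i by auto
  qed
  ultimately have "sum ?f (splits m) = sum ?f (?h ` ?I)"
    by (intro sum.mono_neutral_right finite_splits) auto
  also have "\<dots> = (\<Sum>i\<in>?I. scoeff G (m - Poly_Mapping.single i n))"
    by (subst sum.reindex[OF inj]) (rule sum.cong, use assms in \<open>auto simp: powersum.rep_eq\<close>)
  finally show ?thesis by (simp add: times_sym.rep_eq)
qed

text \<open>The partition formed by the nonzero exponents; it labels the orbit of a monomial under
  permutations of the variables.\<close>

definition shape :: "monom \<Rightarrow> nat multiset" where
  "shape m = image_mset (Poly_Mapping.lookup m) (mset_set (Poly_Mapping.keys m))"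

lemma size_shape [simp]: "size (shape m) = card (Poly_Mapping.keys m)"
  by (simp add: shape_def)

lemma shape_add_single:
  assumes "Poly_Mapping.lookup m i = 0" "0 < n"
  shows "shape (Poly_Mapping.single i n + m) = add_mset n (shape m)"
proof -
  have k: "Poly_Mapping.keys (Poly_Mapping.single i n + m) = insert i (Poly_Mapping.keys m)"
    using assms by (auto simp: in_keys_iff lookup_add lookup_single when_def split: if_splits)
  have i: "i \<notin> Poly_Mapping.keys m" using assms by (simp add: in_keys_iff)
  show ?thesis
    unfolding shape_def k mset_set.insert[OF finite_keys i] image_mset_add_mset
  proof (intro arg_cong2[of _ _ _ _ add_mset] image_mset_cong)
    show "Poly_Mapping.lookup (Poly_Mapping.single i n + m) i = n"
      using assms by (simp add: lookup_add)
    show "Poly_Mapping.lookup (Poly_Mapping.single i n + m) x = Poly_Mapping.lookup m x"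
      if "x \<in># mset_set (Poly_Mapping.keys m)" for x
      using i that by (auto simp: lookup_add lookup_single when_def)
  qed
qed

lemma scoeff_shape_cong:
  assumes "shape m = shape m'"
  shows "scoeff F m = scoeff F m'"
proof -
  let ?A = "Poly_Mapping.keys m \<union> Poly_Mapping.keys m'"
  \<comment> \<open>Padding with zeros over the common support turns equal shapes into equal
    multisets of exponents on one finite set, which yields a permutation of that set.\<close>
  have *: "image_mset (Poly_Mapping.lookup x) (mset_set ?A) =
      shape x + replicate_mset (card ?A - size (shape x)) 0"
    if "Poly_Mapping.keys x \<subseteq> ?A" for x :: monom
  proof -
    have "mset_set ?A = mset_set (Poly_Mapping.keys x) + mset_set (?A - Poly_Mapping.keys x)"
      by (subst mset_set_Union[symmetric]) (use that in \<open>auto intro!: arg_cong[of _ _ mset_set]\<close>)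
    moreover have "image_mset (Poly_Mapping.lookup x) (mset_set (?A - Poly_Mapping.keys x)) =
        image_mset (\<lambda>_. 0) (mset_set (?A - Poly_Mapping.keys x))"
      by (rule image_mset_cong) (auto simp: in_keys_iff)
    ultimately show ?thesis
      using that by (simp add: shape_def image_mset_const_eq card_Diff_subset)
  qed
  have "image_mset (Poly_Mapping.lookup m) (mset_set ?A) = image_mset (Poly_Mapping.lookup m') (mset_set ?A)"
    using *[of m] *[of m'] assms by simp
  then obtain p where p: "p permutes ?A" "\<forall>x\<in>?A. Poly_Mapping.lookup m x = Poly_Mapping.lookup m' (p x)"
    by (rule image_mset_eq_implies_permutes[rotated]) auto
  have b: "bij p" using p(1) by (rule permutes_bij)
  have "m = Poly_Mapping.map_key p m'"
  proof (rule poly_mapping_eqI)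
    fix x
    show "Poly_Mapping.lookup m x = Poly_Mapping.lookup (Poly_Mapping.map_key p m') x"
    proof (cases "x \<in> ?A")
      case True
      then show ?thesis using p(2) by (simp add: map_key.rep_eq[OF bij_is_inj[OF b]])
    next
      case False
      then have "Poly_Mapping.lookup m x = 0" "Poly_Mapping.lookup m' x = 0"
        by (simp_all add: in_keys_iff)
      then show ?thesis
        using permutes_not_in[OF p(1) False] by (simp add: map_key.rep_eq[OF bij_is_inj[OF b]])
    qed
  qed
  then show ?thesis
    using scoeff[of F] b by (simp add: symmetric_series_def)
qed

text \<open>Index \<open>n\<close> stands for the power sum of degree \<open>n + 1\<close>, so that
  every multiset of naturals encodes a partition with positive parts.\<close>

definition pprod :: "nat multiset \<Rightarrow> sym" where
  "pprod M = prod_mset (image_mset (\<lambda>n. powersum (Suc n)) M)"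

lemma pprod_add_mset [simp]: "pprod (add_mset n M) = powersum (Suc n) * pprod M"
  by (simp add: pprod_def)

text \<open>Each factor raises a single exponent, so it brings in at most one new variable; if every
  factor brings in its own, the exponents are the parts. This triangularity drives both the
  injectivity and the surjectivity of \<open>peval\<close>.\<close>

lemma scoeff_pprod_nonzero:
  assumes "scoeff (pprod M) m \<noteq> 0"
  shows "card (Poly_Mapping.keys m) \<le> size M \<and>
    (card (Poly_Mapping.keys m) = size M \<longrightarrow> shape m = image_mset Suc M)"
  using assms
proof (induction M arbitrary: m)
  case empty
  then have "m = 0" by (simp add: pprod_def one_sym.rep_eq split: if_splits)
  then show ?case by (simp add: shape_def)
next
  case (add n M)
  have "scoeff (powersum (Suc n) * pprod M) m \<noteq> 0"
    using add.prems by simp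
  then obtain i where i: "Suc n \<le> Poly_Mapping.lookup m i"
    and nz: "scoeff (pprod M) (m - Poly_Mapping.single i (Suc n)) \<noteq> 0"
    unfolding scoeff_powersum_mult[OF zero_less_Suc]
    by (elim sum.not_neutral_contains_not_neutral) blast
  define m' where "m' = m - Poly_Mapping.single i (Suc n)"
  have m: "m = Poly_Mapping.single i (Suc n) + m'"
    unfolding m'_def
    by (rule poly_mapping_eqI) (use i in \<open>auto simp: lookup_add lookup_minus lookup_single when_def\<close>)
  note IH = add.IH[OF nz, folded m'_def]
  have k: "Poly_Mapping.keys m = insert i (Poly_Mapping.keys m')"
    by (auto simp: m in_keys_iff lookup_add lookup_single when_def split: if_splits)
  show ?case
  proof (cases "i \<in> Poly_Mapping.keys m'")
    case True
    then have "Poly_Mapping.keys m = Poly_Mapping.keys m'" using k by auto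
    then show ?thesis using IH by simp
  next
    case False
    then have "card (Poly_Mapping.keys m) = Suc (card (Poly_Mapping.keys m'))"
      using k by simp
    moreover have "shape m = add_mset (Suc n) (shape m')"
      unfolding m using False by (intro shape_add_single) (auto simp: in_keys_iff)
    ultimately show ?thesis using IH by simp
  qed
qed

text \<open>Coefficients are counts, so nothing cancels; in characteristic 0 the diagonal
  coefficients of the triangular system are therefore nonzero.\<close>

lemma scoeff_pprod_nat:
  "\<exists>N. scoeff (pprod M) m = of_nat N \<and> (shape m = image_mset Suc M \<longrightarrow> 0 < N)"
proof (induction M arbitrary: m)
  case empty
  have "m = 0" if "shape m = {#}"
    using that by (simp add: shape_def mset_set_empty_iff)
  then show ?case
    by (intro exI[of _ "if m = 0 then 1 else 0"]) (auto simp: pprod_def one_sym.rep_eq)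
next
  case (add n M)
  obtain N where N: "\<And>m. scoeff (pprod M) m = of_nat (N m)"
    and pos: "\<And>m. shape m = image_mset Suc M \<Longrightarrow> 0 < N m"
  proof -
    have "\<forall>m. \<exists>N. scoeff (pprod M) m = of_nat N \<and> (shape m = image_mset Suc M \<longrightarrow> 0 < N)"
      using add.IH by blast
    from choice[OF this] show ?thesis using that by blast
  qed
  let ?I = "{i. Suc n \<le> Poly_Mapping.lookup m i}"
  have fin: "finite ?I"
    by (rule finite_subset[OF _ finite_keys[of m]]) (auto simp: in_keys_iff)
  have eq: "scoeff (pprod (add_mset n M)) m = of_nat (\<Sum>i\<in>?I. N (m - Poly_Mapping.single i (Suc n)))"
    by (simp add: scoeff_powersum_mult N)
  have "0 < (\<Sum>i\<in>?I. N (m - Poly_Mapping.single i (Suc n)))"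
    if sh: "shape m = image_mset Suc (add_mset n M)"
  proof -
    have "Suc n \<in># shape m" by (simp add: sh)
    then obtain i where i: "Poly_Mapping.lookup m i = Suc n"
      by (auto simp: shape_def)
    define m' where "m' = m - Poly_Mapping.single i (Suc n)"
    have m: "m = Poly_Mapping.single i (Suc n) + m'" and 0: "Poly_Mapping.lookup m' i = 0"
      unfolding m'_def
      by (rule poly_mapping_eqI) (use i in \<open>auto simp: lookup_add lookup_minus lookup_single when_def\<close>)
    have "shape m' = image_mset Suc M"
      using shape_add_single[OF 0, of "Suc n"] sh unfolding m by simp
    then have "0 < N m'" by (rule pos)
    also have "N m' \<le> (\<Sum>i\<in>?I. N (m - Poly_Mapping.single i (Suc n)))"
      unfolding m'_def by (rule member_le_sum[where f = "\<lambda>i. N (m - Poly_Mapping.single i (Suc n))"])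
         (use i fin in auto)
    finally show ?thesis .
  qed
  then show ?case using eq by blast
qed

lemma shape_exists:
  assumes "0 \<notin># M"
  shows "\<exists>m. shape m = M"
proof -
  \<comment> \<open>The extra clause keeps the variable with index \<open>size M\<close> free for
    the next part.\<close>
  have "\<exists>m. shape m = M \<and> (\<forall>i\<ge>size M. Poly_Mapping.lookup m i = 0)"
    using assms
  proof (induction M)
    case empty
    show ?case by (intro exI[of _ 0]) (simp add: shape_def)
  next
    case (add n M)
    then obtain m where "shape m = M" "\<forall>i\<ge>size M. Poly_Mapping.lookup m i = 0" by auto
    then show ?case
      using add.prems shape_add_single[of m "size M" n]
      by (intro exI[of _ "Poly_Mapping.single (size M) n + m"])
        (auto simp: lookup_add lookup_single when_def)
  qed
  then show ?thesis by blast
qed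

definition peval :: "qt mpoly \<Rightarrow> sym" where
  "peval = meval sym_const (\<lambda>n. powersum (Suc n))"

lemma ring_map_peval: "ring_map peval"
  unfolding peval_def by (intro ring_map_meval ring_map_sym_const)

lemma peval_single: "peval (Poly_Mapping.single M c) = sym_const c * pprod M"
  by (simp add: peval_def meval_single ring_map_sym_const pprod_def)

lemma scoeff_peval:
  "scoeff (peval f) m = (\<Sum>M\<in>Poly_Mapping.keys f. Poly_Mapping.lookup f M * scoeff (pprod M) m)"
  by (simp add: peval_def meval_def pm_lift_def scoeff_sum scoeff_const_mult flip: pprod_def)

text \<open>Among the power sum products in \<open>f\<close>, only the one of shape \<open>M\<close> with the most factors
  contributes to the monomial of shape \<open>M\<close>.\<close>

lemma peval_eq_0_imp:
  assumes "peval f = 0"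
  shows "f = 0"
proof (rule ccontr)
  assume "f \<noteq> 0"
  then have ne: "Poly_Mapping.keys f \<noteq> {}" by simp
  define L where "L = Max (size ` Poly_Mapping.keys f)"
  have "L \<in> size ` Poly_Mapping.keys f"
    unfolding L_def using ne by (intro Max_in) auto
  then obtain M where M: "M \<in> Poly_Mapping.keys f" "size M = L" by auto
  have max: "size M' \<le> size M" if "M' \<in> Poly_Mapping.keys f" for M'
    using that by (simp add: M L_def)
  obtain m where m: "shape m = image_mset Suc M"
    using shape_exists[of "image_mset Suc M"] by auto
  have "scoeff (pprod M') m = 0" if "M' \<in> Poly_Mapping.keys f - {M}" for M'
  proof (rule ccontr)
    assume "scoeff (pprod M') m \<noteq> 0"
    from scoeff_pprod_nonzero[OF this] have "size M \<le> size M'"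
      "size M = size M' \<longrightarrow> image_mset Suc M = image_mset Suc M'"
      using m size_shape[of m] by auto
    then have "image_mset Suc M = image_mset Suc M'"
      using max[of M'] that by auto
    then have "M = M'"
      by (rule injD[OF multiset.inj_map[OF inj_Suc]])
    then show False using that by simp
  qed
  then have "scoeff (peval f) m = (\<Sum>M'\<in>{M}. Poly_Mapping.lookup f M' * scoeff (pprod M') m)"
    unfolding scoeff_peval using M(1) by (intro sum.mono_neutral_right) auto
  moreover have "scoeff (pprod M) m \<noteq> 0"
    using scoeff_pprod_nat[of M m] m by auto
  ultimately have "scoeff (peval f) m \<noteq> 0"
    using M(1) by (simp add: in_keys_iff)
  then show False using assms by (simp add: zero_sym.rep_eq)
qed

lemma inj_peval: "inj peval"
proof (rule injI)
  fix f g assume "peval f = peval g"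
  then have "peval (f - g) = 0" by (simp add: ring_mapD(6)[OF ring_map_peval])
  then have "f - g = 0" by (rule peval_eq_0_imp)
  then show "f = g" by simp
qed

text \<open>Induction on a strict bound for the number of variables per monomial: a combination of
  power sum products with as many factors as the largest allowed number of variables removes the top
  layer of \<open>F\<close>.\<close>

lemma peval_surj_bounded:
  assumes "\<And>m. scoeff F m \<noteq> 0 \<Longrightarrow> card (Poly_Mapping.keys m) < L"
  shows "\<exists>f. peval f = F"
  using assms
proof (induction L arbitrary: F)
  case 0
  then have "F = 0"
    by (intro scoeff_inject[THEN iffD1] ext) (auto simp: zero_sym.rep_eq)
  then have "peval 0 = F" by (simp add: ring_mapD(4)[OF ring_map_peval])
  then show ?case by blast
next
  case (Suc L)
  obtain d where d: "\<And>m. d < mdeg m \<Longrightarrow> scoeff F m = 0"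
    using scoeff[of F] by (auto simp: symmetric_series_def)
  define I where "I = {M. size M = L \<and> (\<exists>m. shape m = image_mset Suc M \<and> scoeff F m \<noteq> 0)}"
  define mon where "mon M = (SOME m. shape m = image_mset Suc M)" for M
  have mon: "shape (mon M) = image_mset Suc M" for M
    unfolding mon_def using shape_exists[of "image_mset Suc M"] by (auto intro: someI_ex)
  \<comment> \<open>The degree bound of \<open>F\<close> limits every part, so only finitely many
    partitions occur.\<close>
  have "I \<subseteq> mset ` {xs. set xs \<subseteq> {..d} \<and> length xs = L}"
  proof
    fix M assume "M \<in> I"
    then obtain m where m: "size M = L" "shape m = image_mset Suc M" "scoeff F m \<noteq> 0"
      by (auto simp: I_def)
    obtain xs where xs: "M = mset xs" by (metis ex_mset)
    have "n \<le> d" if "n \<in> set xs" for n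
    proof -
      have "Suc n \<in># shape m" using that by (simp add: m xs)
      then obtain i where i: "i \<in> Poly_Mapping.keys m" "Poly_Mapping.lookup m i = Suc n"
        by (auto simp: shape_def)
      then have "Suc n \<le> mdeg m"
        unfolding mdeg_def using member_le_sum[of i "Poly_Mapping.keys m" "Poly_Mapping.lookup m"]
        by simp
      then show ?thesis using d[of m] m(3) by linarith
    qed
    then show "M \<in> mset ` {xs. set xs \<subseteq> {..d} \<and> length xs = L}"
      using m(1) xs by auto
  qed
  then have fin: "finite I"
    by (rule finite_subset) (intro finite_imageI finite_lists_length_eq, simp)
  \<comment> \<open>Division by the diagonal coefficient; the other products indexed by
    \<open>I\<close> vanish on \<open>mon M\<close>.\<close>
  define c where "c M = scoeff F (mon M) / scoeff (pprod M) (mon M)" for M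
  define f where "f = (\<Sum>M\<in>I. Poly_Mapping.single M (c M))"
  have f: "scoeff (peval f) m = (\<Sum>M\<in>I. c M * scoeff (pprod M) m)" for m
    by (simp add: f_def ring_mapD(9)[OF ring_map_peval] peval_single scoeff_sum scoeff_const_mult)
  have eq: "scoeff (peval f) m = scoeff F m" if L: "L \<le> card (Poly_Mapping.keys m)" for m
  proof -
    define M where "M = image_mset (\<lambda>x. x - 1) (shape m)"
    have "image_mset (Suc \<circ> (\<lambda>x. x - 1)) (shape m) = image_mset (\<lambda>x. x) (shape m)"
      by (rule image_mset_cong) (auto simp: shape_def in_keys_iff)
    then have M: "shape m = image_mset Suc M"
      by (simp add: M_def multiset.map_comp comp_def)
    have nz: "scoeff (pprod M') m = 0" if "M' \<in> I" "M' \<noteq> M" for M'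
    proof (rule ccontr)
      assume "scoeff (pprod M') m \<noteq> 0"
      from scoeff_pprod_nonzero[OF this] that L M have "image_mset Suc M' = image_mset Suc M"
        by (auto simp: I_def)
      then have "M' = M" by (rule injD[OF multiset.inj_map[OF inj_Suc]])
      then show False using that by simp
    qed
    show ?thesis
    proof (cases "M \<in> I")
      case True
      have "(\<Sum>M\<in>I. c M * scoeff (pprod M) m) = (\<Sum>M\<in>{M}. c M * scoeff (pprod M) m)"
        by (intro sum.mono_neutral_right fin) (use True nz in auto)
      moreover have "scoeff F (mon M) = scoeff F m"
        "scoeff (pprod M) (mon M) = scoeff (pprod M) m"
        by (intro scoeff_shape_cong, simp add: mon M)+
      moreover have "scoeff (pprod M) m \<noteq> 0"
        using scoeff_pprod_nat[of M m] M by auto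
      ultimately show ?thesis by (simp add: f c_def)
    next
      case False
      have "scoeff F m = 0"
      proof (rule ccontr)
        assume "scoeff F m \<noteq> 0"
        moreover from this have "card (Poly_Mapping.keys m) = L"
          using Suc.prems L by fastforce
        then have "size M = L" by (simp add: M_def)
        ultimately show False using False M by (auto simp: I_def)
      qed
      moreover have "(\<Sum>M\<in>I. c M * scoeff (pprod M) m) = 0"
        by (rule sum.neutral) (use False nz in auto)
      ultimately show ?thesis by (simp add: f)
    qed
  qed
  have "scoeff (F - peval f) m = 0" if "\<not> card (Poly_Mapping.keys m) < L" for m
    using eq[of m] that by (simp add: minus_sym.rep_eq)
  then obtain g where "peval g = F - peval f" using Suc.IH by blast
  then have "peval (g + f) = F"
    by (simp add: ring_mapD(1)[OF ring_map_peval])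
  then show ?case by blast
qed

lemma surj_peval: "surj peval"
proof (rule surjI[of _ "\<lambda>F. SOME f. peval f = F"], rule someI_ex)
  fix F :: sym
  obtain d where d: "\<And>m. d < mdeg m \<Longrightarrow> scoeff F m = 0"
    using scoeff[of F] by (auto simp: symmetric_series_def)
  have "card (Poly_Mapping.keys m) < Suc d" if "scoeff F m \<noteq> 0" for m
  proof -
    have "card (Poly_Mapping.keys m) = (\<Sum>i\<in>Poly_Mapping.keys m. 1)" by simp
    also have "\<dots> \<le> mdeg m"
      unfolding mdeg_def by (rule sum_mono) (simp add: in_keys_iff)
    also have "\<dots> \<le> d" using d[of m] that by force
    finally show ?thesis by simp
  qed
  then show "\<exists>f. peval f = F" by (rule peval_surj_bounded)
qed

section \<open>Existence and uniqueness of plethystic substitution\<close>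

lemma sym_hom_eqI:
  assumes f: "ring_map f" and g: "ring_map g"
    and c: "\<And>c. f (sym_const c) = g (sym_const c)"
    and p: "\<And>n. 1 \<le> n \<Longrightarrow> f (powersum n) = g (powersum n)"
  shows "f F = g F"
proof -
  obtain h where h: "F = peval h" using surj_peval by (metis surjD)
  show ?thesis
    unfolding h peval_def ring_map_meval_comp[OF f ring_map_sym_const]
      ring_map_meval_comp[OF g ring_map_sym_const]
    by (simp add: c p)
qed

text \<open>Existence transports evaluation of polynomials along the bijection \<open>peval\<close>;
  uniqueness holds because constants and power sums generate. This discharges the definite
  description in \<open>pleth\<close>.\<close>

lemma pleth_hom_pleth:
  assumes \<iota>: "ring_map \<iota>"
  shows "pleth_hom \<iota> a (pleth \<iota> a)"
proof -
  let ?e = "meval \<iota> (\<lambda>n. a (Suc n))"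
  let ?\<phi> = "\<lambda>F. ?e (inv peval F)"
  note e = ring_map_meval[OF \<iota>, of "\<lambda>n. a (Suc n)"]
  have inv: "inv peval (peval f) = f" for f by (rule inv_f_f[OF inj_peval])
  have pinv: "peval (inv peval F) = F" for F by (rule surj_f_inv_f[OF surj_peval])
  have add: "inv peval (F + G) = inv peval F + inv peval G" for F G
    using inv[of "inv peval F + inv peval G"] by (simp add: ring_mapD[OF ring_map_peval] pinv)
  have mult: "inv peval (F * G) = inv peval F * inv peval G" for F G
    using inv[of "inv peval F * inv peval G"] by (simp add: ring_mapD[OF ring_map_peval] pinv)
  have const: "inv peval (sym_const c) = mconst c" for c
    using inv[of "mconst c"] by (simp add: peval_def meval_mconst ring_map_sym_const)
  have p: "inv peval (powersum n) = mvar (n - 1)" if "1 \<le> n" for n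
    using inv[of "mvar (n - 1)"] that by (simp add: peval_def meval_mvar ring_map_sym_const)
  have hom: "pleth_hom \<iota> a ?\<phi>"
    unfolding pleth_hom_def
    by (simp add: add mult const p ring_mapD[OF e] meval_mconst meval_mvar \<iota>)
  have "\<phi> = ?\<phi>" if \<phi>: "pleth_hom \<iota> a \<phi>" for \<phi>
  proof
    fix F
    have one: "sym_const 1 = 1" using ring_map_sym_const by (rule ring_mapD)
    \<comment> \<open>\<open>pleth_hom\<close> does not mention the unit; it is preserved because
      \<open>1\<close> is a constant.\<close>
    have r: "ring_map \<phi>" if "pleth_hom \<iota> a \<phi>" for \<phi>
      using that \<iota> one ring_mapD(3)[OF \<iota>] unfolding pleth_hom_def ring_map_def by metis
    show "\<phi> F = ?\<phi> F"
      by (rule sym_hom_eqI[OF r[OF \<phi>] r[OF hom]]) (use \<phi> hom in \<open>simp_all add: pleth_hom_def\<close>)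
  qed
  then have "pleth \<iota> a = ?\<phi>"
    unfolding pleth_def using hom by (intro the_equality)
  then show ?thesis using hom by simp
qed

lemma
  assumes "ring_map \<iota>"
  shows ring_map_pleth: "ring_map (pleth \<iota> a)"
    and pleth_const: "pleth \<iota> a (sym_const c) = \<iota> c"
    and pleth_powersum: "1 \<le> n \<Longrightarrow> pleth \<iota> a (powersum n) = a n"
proof -
  have one: "sym_const 1 = 1" using ring_map_sym_const by (rule ring_mapD)
  show "ring_map (pleth \<iota> a)"
    using pleth_hom_pleth[OF assms, of a] one ring_mapD(3)[OF assms]
    unfolding pleth_hom_def ring_map_def by metis
  show "pleth \<iota> a (sym_const c) = \<iota> c" "1 \<le> n \<Longrightarrow> pleth \<iota> a (powersum n) = a n"
    using pleth_hom_pleth[OF assms, of a] by (simp_all add: pleth_hom_def)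
qed

subsection \<open>Newton's identities\<close>

text \<open>Coefficientwise form of \<open>z H' = P H\<close> for the generating series
  \<open>H\<close> of \<open>h\<close> and \<open>P\<close> of \<open>p\<close>; it characterises
  \<open>H = exp (sum of p_n z^n / n)\<close> without infinite sums.\<close>

definition newton :: "(nat \<Rightarrow> 'r::comm_ring_1) \<Rightarrow> (nat \<Rightarrow> 'r) \<Rightarrow> bool" where
  "newton p h \<longleftrightarrow> h 0 = 1 \<and> (\<forall>n. of_nat n * h n = (\<Sum>i=1..n. p i * h (n - i)))"

lemma newtonD: "newton p h \<Longrightarrow> h 0 = 1" "newton p h \<Longrightarrow> of_nat n * h n = (\<Sum>i=1..n. p i * h (n - i))"
  by (auto simp: newton_def)

lemma newton_map:
  assumes "ring_map f" "newton p h" "\<And>n. 1 \<le> n \<Longrightarrow> f (p n) = p' n"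
  shows "newton p' (\<lambda>n. f (h n))"
  unfolding newton_def
proof (intro conjI allI)
  show "f (h 0) = 1" using assms by (simp add: newtonD ring_mapD)
  fix n
  have "of_nat n * f (h n) = f (of_nat n * h n)" using assms(1) by (simp add: ring_mapD)
  also have "\<dots> = (\<Sum>i=1..n. p' i * f (h (n - i)))"
    unfolding newtonD(2)[OF assms(2)] using assms(1,3) by (simp add: ring_mapD)
  finally show "of_nat n * f (h n) = (\<Sum>i=1..n. p' i * f (h (n - i)))" .
qed

lemma of_nat_cancel_qt_algebra:
  assumes \<iota>: "ring_map (\<iota> :: qt \<Rightarrow> 'r::comm_ring_1)" and "0 < n" "of_nat n * x = of_nat n * (y :: 'r)"
  shows "x = y"
proof -
  have "\<iota> (inverse (of_nat n)) * of_nat n = \<iota> (inverse (of_nat n) * of_nat n)"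
    using \<iota> by (simp add: ring_mapD)
  also have "\<dots> = 1" using assms by (simp add: ring_mapD)
  finally have *: "\<iota> (inverse (of_nat n)) * of_nat n = 1" .
  have "\<iota> (inverse (of_nat n)) * (of_nat n * x) = \<iota> (inverse (of_nat n)) * (of_nat n * y)"
    by (simp add: assms)
  then show ?thesis by (simp add: * flip: mult.assoc)
qed

text \<open>The recursion determines \<open>n h_n\<close>, and \<open>n\<close> is invertible in an
  algebra over \<open>qt\<close>. Identities for \<open>h_n[A]\<close> are proved later by checking
  the recursion for a candidate.\<close>

lemma newton_unique:
  assumes \<iota>: "ring_map (\<iota> :: qt \<Rightarrow> 'r::comm_ring_1)" and h: "newton p h" "newton p (h' :: nat \<Rightarrow> 'r)"
  shows "h n = h' n"
proof (induction n rule: less_induct)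
  case (less n)
  show ?case
  proof (cases "n = 0")
    case False
    have "of_nat n * h n = of_nat n * h' n"
      unfolding h[THEN newtonD(2)] by (rule sum.cong) (use less in auto)
    then show ?thesis using \<iota> False of_nat_cancel_qt_algebra by blast
  qed (simp add: h[THEN newtonD(1)])
qed

text \<open>In the coefficient of a monomial of degree \<open>n\<close>, both sides count pairs of a
  variable and an integer between 1 and its exponent, grouped by variable or by integer.\<close>

lemma newton_hsym: "newton powersum hsym"
  unfolding newton_def
proof (intro conjI allI)
  have md: "mdeg m = 0 \<longleftrightarrow> m = 0" for m
    unfolding mdeg_def by (auto simp: in_keys_iff intro!: poly_mapping_eqI)
  show "hsym 0 = 1"
    by (rule scoeff_inject[THEN iffD1]) (auto simp: hsym.rep_eq one_sym.rep_eq md)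
  fix n
  show "of_nat n * hsym n = (\<Sum>i=1..n. powersum i * hsym (n - i))"
  proof (rule scoeff_inject[THEN iffD1], rule ext)
    fix m
    have "of_nat n = sym_const (of_nat n)"
      using ring_mapD(8)[OF ring_map_sym_const] by simp
    then have l: "scoeff (of_nat n * hsym n) m = (if mdeg m = n then of_nat n else 0)"
      by (simp add: scoeff_const_mult hsym.rep_eq)
    have dm: "mdeg m = mdeg (m - Poly_Mapping.single j i) + i"
      if "i \<le> Poly_Mapping.lookup m j" for i j
    proof -
      have "m = (m - Poly_Mapping.single j i) + Poly_Mapping.single j i"
        by (rule poly_mapping_eqI)
          (use that in \<open>auto simp: lookup_add lookup_minus lookup_single when_def\<close>)
      then have "mdeg m = mdeg (m - Poly_Mapping.single j i) + mdeg (Poly_Mapping.single j i)"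
        using mdeg_add by metis
      then show ?thesis by (simp add: mdeg_def)
    qed
    have "scoeff (powersum i * hsym (n - i)) m =
        (\<Sum>j\<in>{j. i \<le> Poly_Mapping.lookup m j}. if mdeg m = n then 1 else 0)"
      if "i \<in> {1..n}" for i
    proof -
      have "0 < i" using that by simp
      then show ?thesis
        unfolding scoeff_powersum_mult[OF \<open>0 < i\<close>]
        by (intro sum.cong refl) (use that dm in \<open>auto simp: hsym.rep_eq\<close>)
    qed
    then have r: "scoeff (\<Sum>i=1..n. powersum i * hsym (n - i)) m =
        (\<Sum>i=1..n. \<Sum>j\<in>{j. i \<le> Poly_Mapping.lookup m j}. if mdeg m = n then 1 else 0)"
      by (simp add: scoeff_sum)
    show "scoeff (of_nat n * hsym n) m = scoeff (\<Sum>i=1..n. powersum i * hsym (n - i)) m"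
    proof (cases "mdeg m = n")
      case True
      have "(\<Sum>i=1..n. card {j. i \<le> Poly_Mapping.lookup m j}) =
          (\<Sum>i=1..n. card {j \<in> Poly_Mapping.keys m. i \<le> Poly_Mapping.lookup m j})"
        by (intro sum.cong refl arg_cong[of _ _ card]) (auto simp: in_keys_iff)
      also have "\<dots> = (\<Sum>j\<in>Poly_Mapping.keys m. card {i \<in> {1..n}. i \<le> Poly_Mapping.lookup m j})"
        by (rule sum_multicount_gen) auto
      also have "\<dots> = mdeg m"
        unfolding mdeg_def
      proof (rule sum.cong[OF refl])
        fix j assume "j \<in> Poly_Mapping.keys m"
        then have "Poly_Mapping.lookup m j \<le> n"
          using True member_le_sum[of j "Poly_Mapping.keys m" "Poly_Mapping.lookup m"]
          by (simp add: mdeg_def)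
        then have "{i \<in> {1..n}. i \<le> Poly_Mapping.lookup m j} = {1..Poly_Mapping.lookup m j}" by auto
        then show "card {i \<in> {1..n}. i \<le> Poly_Mapping.lookup m j} = Poly_Mapping.lookup m j" by simp
      qed
      finally have "(\<Sum>i=1..n. card {j. i \<le> Poly_Mapping.lookup m j}) = n" using True by simp
      then show ?thesis
        unfolding l r using True by (simp flip: of_nat_sum)
    qed (simp only: l r, simp)
  qed
qed

lemma newton_pleth:
  assumes "ring_map \<iota>"
  shows "newton a (\<lambda>n. pleth \<iota> a (hsym n))"
  by (rule newton_map[OF ring_map_pleth newton_hsym]) (simp_all add: assms pleth_powersum)

text \<open>\<open>hneg n\<close> is \<open>h\<^sub>n[-X]\<close>.\<close>

definition hneg :: "nat \<Rightarrow> sym" where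
  "hneg n = pleth sym_const (\<lambda>n. - powersum n) (hsym n)"

text \<open>Up to sign the elementary symmetric functions: \<open>h_n[-X] = (-1)^n e_n\<close>, so
  this is \<open>(-1)^n e_(n+1)\<close>.\<close>

definition eps :: "nat \<Rightarrow> sym" where
  "eps n = - hneg (Suc n)"

lemma newton_hneg: "newton (\<lambda>n. - powersum n) hneg"
  unfolding hneg_def[abs_def] by (rule newton_pleth[OF ring_map_sym_const])

lemma hneg_0 [simp]: "hneg 0 = 1"
  using newton_hneg by (rule newtonD)

definition eeval :: "qt mpoly \<Rightarrow> sym" where
  "eeval = meval sym_const eps"

lemma ring_map_eeval: "ring_map eeval"
  unfolding eeval_def by (intro ring_map_meval ring_map_sym_const)

text \<open>The power sums as polynomials in the \<open>eps n\<close>, by Newton's identities.\<close>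

fun pnew :: "nat \<Rightarrow> qt mpoly" where
  "pnew n = of_nat n * mvar (n - 1) + (\<Sum>i\<in>{1..<n}. pnew i * mvar (n - i - 1))"

declare pnew.simps [simp del]

lemma eeval_mvar: "eeval (mvar n) = eps n"
  by (simp add: eeval_def meval_mvar ring_map_sym_const)

lemma eeval_pnew: "1 \<le> n \<Longrightarrow> eeval (pnew n) = powersum n"
proof (induction n rule: less_induct)
  case (less n)
  have "of_nat n * hneg n = (\<Sum>i=1..n. - powersum i * hneg (n - i))"
    using newton_hneg by (rule newtonD)
  also have "{1..n} = insert n {1..<n}" using less.prems by auto
  finally have *: "of_nat n * hneg n = - powersum n - (\<Sum>i\<in>{1..<n}. powersum i * hneg (n - i))"
    by (simp add: sum_negf)
  have "eeval (pnew n) = of_nat n * eps (n - 1) + (\<Sum>i\<in>{1..<n}. eeval (pnew i) * eps (n - i - 1))"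
    by (subst pnew.simps) (simp add: ring_mapD[OF ring_map_eeval] eeval_mvar)
  also have "(\<Sum>i\<in>{1..<n}. eeval (pnew i) * eps (n - i - 1)) = (\<Sum>i\<in>{1..<n}. - (powersum i * hneg (n - i)))"
    by (rule sum.cong) (use less.IH in \<open>auto simp: eps_def Suc_diff_Suc\<close>)
  finally show ?case using * less.prems by (simp add: eps_def sum_negf)
qed

text \<open>The recursion of \<open>pnew\<close> is Newton's identity for \<open>h_0 = 1\<close> and
  \<open>h_n = - mvar (n - 1)\<close>, so uniqueness identifies the two sequences. It makes
  \<open>eeval\<close> injective, that is, the \<open>eps n\<close> algebraically
  independent.\<close>

lemma pleth_pnew_eps: "pleth mconst pnew (eps n) = mvar n"
proof -
  let ?h = "\<lambda>n. if n = 0 then 1 else - mvar (n - 1) :: qt mpoly"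
  have "newton (\<lambda>n. - pnew n) ?h"
    unfolding newton_def
  proof (intro conjI allI)
    fix n
    show "of_nat n * ?h n = (\<Sum>i=1..n. - pnew i * ?h (n - i))"
    proof (cases "n = 0")
      case False
      then have s: "{1..n} = insert n {1..<n}" by auto
      have "(\<Sum>i\<in>{1..<n}. - pnew i * ?h (n - i)) = (\<Sum>i\<in>{1..<n}. pnew i * mvar (n - i - 1))"
        by (rule sum.cong) auto
      then show ?thesis using False pnew.simps[of n] unfolding s by simp
    qed simp
  qed simp
  moreover have "newton (\<lambda>n. - pnew n) (\<lambda>n. pleth mconst pnew (hneg n))"
    by (rule newton_map[OF ring_map_pleth newton_hneg])
      (simp_all add: ring_map_mconst ring_mapD(5)[OF ring_map_pleth] pleth_powersum)
  ultimately have "pleth mconst pnew (hneg (Suc n)) = ?h (Suc n)"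
    by (rule newton_unique[OF ring_map_mconst, rotated])
  then show ?thesis
    by (simp add: eps_def ring_mapD(5)[OF ring_map_pleth] ring_map_mconst)
qed

lemma pleth_pnew_eeval: "pleth mconst pnew (eeval f) = f"
proof -
  have "pleth mconst pnew (eeval f) =
      meval (\<lambda>c. pleth mconst pnew (sym_const c)) (\<lambda>n. pleth mconst pnew (eps n)) f"
    unfolding eeval_def
    by (rule ring_map_meval_comp[OF ring_map_pleth[OF ring_map_mconst] ring_map_sym_const])
  also have "\<dots> = f"
    unfolding pleth_const[OF ring_map_mconst] pleth_pnew_eps by (rule meval_id)
  finally show ?thesis .
qed

lemma eeval_pleth_pnew: "eeval (pleth mconst pnew F) = F"
proof -
  note r = ring_map_mconst
  show "eeval (pleth mconst pnew F) = F"
  proof (rule sym_hom_eqI[of "\<lambda>F. eeval (pleth mconst pnew F)" "\<lambda>F. F"])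
    show "ring_map (\<lambda>F. eeval (pleth mconst pnew F))"
      by (rule ring_map_comp[OF ring_map_eeval ring_map_pleth[OF r]])
    show "ring_map (\<lambda>F :: sym. F)" by (simp add: ring_map_def)
    show "eeval (pleth mconst pnew (sym_const c)) = sym_const c" for c
      unfolding pleth_const[OF r] eeval_def by (rule meval_mconst[OF ring_map_sym_const])
    show "eeval (pleth mconst pnew (powersum n)) = powersum n" if "1 \<le> n" for n
      unfolding pleth_powersum[OF r that] by (rule eeval_pnew[OF that])
  qed
qed

lemma surj_eeval: "surj eeval"
  using eeval_pleth_pnew by (metis surjI)

subsection \<open>The ring of symmetric functions with polynomial variables\<close>

lemma ring_map_of_sym: "ring_map of_sym"
  unfolding of_sym_def by (rule ring_mapI) (simp_all add: single_add mult_single)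

lemma ring_map_of_qt: "ring_map of_qt"
  unfolding of_qt_def by (rule ring_map_comp[OF ring_map_of_sym ring_map_sym_const])

lemmas of_sym_simps = ring_mapD[OF ring_map_of_sym]
lemmas of_qt_simps = ring_mapD[OF ring_map_of_qt]

lemma ymon_add: "ymon (m + n) = ymon m * ymon n"
  by (simp add: ymon_def mult_single)

lemma ymon_0: "ymon 0 = 1"
  by (simp add: ymon_def)

lemma ymon_single: "ymon (Poly_Mapping.single i n) = yvar i ^ n"
proof (induction n)
  case (Suc n)
  have "Poly_Mapping.single i (Suc n) = Poly_Mapping.single i 1 + Poly_Mapping.single i n"
    by (simp flip: single_add)
  then show ?case by (simp add: ymon_add Suc yvar_def)
qed (simp add: ymon_0)

lemma single_eq_of_sym_ymon: "Poly_Mapping.single m c = of_sym c * ymon m"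
  by (simp add: of_sym_def ymon_def mult_single)

lemma monom_induct [case_names zero step]:
  assumes "P 0" "\<And>m i. i \<in> Poly_Mapping.keys M \<Longrightarrow> Poly_Mapping.keys m \<subseteq> Poly_Mapping.keys M \<Longrightarrow>
    P m \<Longrightarrow> P (Poly_Mapping.single i 1 + m)"
  shows "P (M :: monom)"
proof -
  have "P m" if "Poly_Mapping.keys m \<subseteq> Poly_Mapping.keys M" for m
    using that
  proof (induction "mdeg m" arbitrary: m rule: less_induct)
    case less
    show ?case
    proof (cases "m = 0")
      case False
      then obtain i where i: "i \<in> Poly_Mapping.keys m" by (metis equals0I keys_eq_empty)
      define m' where "m' = m - Poly_Mapping.single i 1"
      have m: "m = Poly_Mapping.single i 1 + m'"
        unfolding m'_def
        by (rule poly_mapping_eqI)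
          (use i in \<open>auto simp: lookup_add lookup_minus lookup_single when_def in_keys_iff\<close>)
      have k: "Poly_Mapping.keys m' \<subseteq> Poly_Mapping.keys M"
        using less.prems by (auto simp: m'_def in_keys_iff lookup_minus)
      have "mdeg m' < mdeg m"
        unfolding m by (simp add: mdeg_add) (simp add: mdeg_def)
      then have "P m'" using less.hyps k by blast
      then show ?thesis unfolding m using assms(2) i less.prems k by blast
    qed (simp add: assms)
  qed
  then show ?thesis by simp
qed

definition ypoly :: "nat set \<Rightarrow> symy set" where
  "ypoly S = {F. \<forall>m\<in>Poly_Mapping.keys F. Poly_Mapping.keys m \<subseteq> S}"

lemma V_eq_ypoly: "V k = ypoly {1..k}"
  by (simp add: V_def ypoly_def)

lemma ypoly_UNIV [simp]: "F \<in> ypoly UNIV"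
  by (simp add: ypoly_def)

lemma ypoly_mono: "S \<subseteq> S' \<Longrightarrow> F \<in> ypoly S \<Longrightarrow> F \<in> ypoly S'"
  by (auto simp: ypoly_def)

lemma ypoly_add: "F \<in> ypoly S \<Longrightarrow> G \<in> ypoly S \<Longrightarrow> F + G \<in> ypoly S"
  unfolding ypoly_def using Poly_Mapping.keys_add[of F G] by blast

lemma ypoly_uminus: "F \<in> ypoly S \<Longrightarrow> - F \<in> ypoly S"
  by (auto simp: ypoly_def in_keys_iff)

lemma ypoly_diff: "F \<in> ypoly S \<Longrightarrow> G \<in> ypoly S \<Longrightarrow> F - G \<in> ypoly S"
  using ypoly_add[of F S "- G"] ypoly_uminus[of G S] by simp

lemma ypoly_mult:
  assumes "F \<in> ypoly S" "G \<in> ypoly S"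
  shows "F * G \<in> ypoly S"
  unfolding ypoly_def
proof safe
  fix m i assume "m \<in> Poly_Mapping.keys (F * G)" and i: "i \<in> Poly_Mapping.keys m"
  then obtain a b where "m = a + b" "a \<in> Poly_Mapping.keys F" "b \<in> Poly_Mapping.keys G"
    using keys_mult[of F G] by auto
  then show "i \<in> S"
    using i assms Poly_Mapping.keys_add[of a b] by (fastforce simp: ypoly_def)
qed

lemma ypoly_of_sym: "of_sym F \<in> ypoly S"
  by (simp add: ypoly_def of_sym_def)

lemma ypoly_0: "0 \<in> ypoly S"
  by (simp add: ypoly_def)

lemma ypoly_1: "1 \<in> ypoly S"
  using ypoly_of_sym[of 1 S] by (simp add: of_sym_simps)

lemma ypoly_of_qt: "of_qt c \<in> ypoly S"
  by (simp add: of_qt_def ypoly_of_sym)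

lemma ypoly_yvar: "i \<in> S \<Longrightarrow> yvar i \<in> ypoly S"
  by (simp add: ypoly_def yvar_def ymon_def)

lemma ypoly_power: "F \<in> ypoly S \<Longrightarrow> F ^ n \<in> ypoly S"
  by (induction n) (auto intro: ypoly_1 ypoly_mult)

lemma ypoly_sum: "(\<And>a. a \<in> A \<Longrightarrow> f a \<in> ypoly S) \<Longrightarrow> sum f A \<in> ypoly S"
  by (induction A rule: infinite_finite_induct) (auto intro: ypoly_0 ypoly_add)

lemma ypoly_prod_mset: "(\<And>a. a \<in># A \<Longrightarrow> f a \<in> ypoly S) \<Longrightarrow> prod_mset (image_mset f A) \<in> ypoly S"
  by (induction A) (auto intro: ypoly_1 ypoly_mult)

lemmas ypoly_intros = ypoly_add ypoly_diff ypoly_uminus ypoly_mult ypoly_of_sym ypoly_of_qt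
  ypoly_yvar ypoly_power ypoly_0 ypoly_1

lemma ypoly_induct [consumes 1, case_names add of_sym yvar]:
  assumes F: "F \<in> ypoly S"
    and add: "\<And>F G. F \<in> ypoly S \<Longrightarrow> G \<in> ypoly S \<Longrightarrow> P F \<Longrightarrow> P G \<Longrightarrow> P (F + G)"
    and of_sym: "\<And>F. P (of_sym F)"
    and yvar: "\<And>i F. i \<in> S \<Longrightarrow> F \<in> ypoly S \<Longrightarrow> P F \<Longrightarrow> P (yvar i * F)"
  shows "P F"
proof -
  have single: "Poly_Mapping.single M c \<in> ypoly S \<and> P (Poly_Mapping.single M c)"
    if M: "Poly_Mapping.keys M \<subseteq> S" for M c
  proof (induction M rule: monom_induct)
    case zero
    show ?case using of_sym[of c] ypoly_of_sym[of c S] by (simp add: of_sym_def)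
  next
    case (step m i)
    have "Poly_Mapping.single (Poly_Mapping.single i 1 + m) c = yvar i * Poly_Mapping.single m c"
      by (simp add: yvar_def ymon_def mult_single)
    moreover have "i \<in> S" using step M by blast
    ultimately show ?case using step yvar[of i "Poly_Mapping.single m c"]
      by (metis ypoly_mult ypoly_yvar)
  qed
  have "finite A \<Longrightarrow> A \<subseteq> Poly_Mapping.keys F \<Longrightarrow>
      (\<Sum>m\<in>A. Poly_Mapping.single m (Poly_Mapping.lookup F m)) \<in> ypoly S \<and>
      P (\<Sum>m\<in>A. Poly_Mapping.single m (Poly_Mapping.lookup F m))" for A
  proof (induction A rule: finite_induct)
    case empty
    show ?case using of_sym[of 0] by (simp add: ypoly_0 of_sym_simps)
  next
    case (insert m A)
    have "Poly_Mapping.keys m \<subseteq> S" using F insert.prems by (auto simp: ypoly_def)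
    then show ?case using insert single[of m "Poly_Mapping.lookup F m"] by (auto intro: add ypoly_add)
  qed
  from this[of "Poly_Mapping.keys F"] show ?thesis by (simp flip: sum_singles)
qed

lemmas symy_induct [case_names add of_sym yvar] =
  ypoly_induct[of _ UNIV, OF ypoly_UNIV, simplified]

text \<open>Separates the powers of one variable: additive statements about \<open>opT\<close>,
  \<open>Ly\<close> and \<open>opdminus\<close> reduce to \<open>y_k^n\<close> times a factor
  constant in \<open>y_k\<close>.\<close>

lemma ypoly_decomp [consumes 1, case_names add power]:
  assumes F: "F \<in> ypoly S"
    and add: "\<And>F G. P F \<Longrightarrow> P G \<Longrightarrow> P (F + G)"
    and power: "\<And>n G. G \<in> ypoly (S - {k}) \<Longrightarrow> P (yvar k ^ n * G)"
  shows "P F"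
proof -
  have single: "P (Poly_Mapping.single m c)" if m: "Poly_Mapping.keys m \<subseteq> S" for m c
  proof -
    have "m = Poly_Mapping.single k (Poly_Mapping.lookup m k) + Poly_Mapping.update k 0 m"
      by (rule poly_mapping_eqI) (simp add: lookup_add lookup_single lookup_update when_def)
    then have "Poly_Mapping.single m c =
        yvar k ^ Poly_Mapping.lookup m k * Poly_Mapping.single (Poly_Mapping.update k 0 m) c"
      by (simp add: ymon_single[symmetric] ymon_def mult_single)
    moreover have "Poly_Mapping.single (Poly_Mapping.update k 0 m) c \<in> ypoly (S - {k})"
      using m by (auto simp: ypoly_def in_keys_iff lookup_update split: if_splits)
    ultimately show ?thesis using power by simp
  qed
  have "finite A \<Longrightarrow> A \<subseteq> Poly_Mapping.keys F \<Longrightarrow>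
      P (\<Sum>m\<in>A. Poly_Mapping.single m (Poly_Mapping.lookup F m))" for A
  proof (induction A rule: finite_induct)
    case empty
    show ?case using single[of 0 0] by simp
  next
    case (insert m A)
    have "Poly_Mapping.keys m \<subseteq> S" using F insert.prems by (auto simp: ypoly_def)
    then show ?case using insert single by (auto intro: add)
  qed
  from this[of "Poly_Mapping.keys F"] show ?thesis by (simp flip: sum_singles)
qed

subsection \<open>Plethystic substitution and exchange of variables\<close>

lemma plethV_eq: "plethV a = pm_lift (pleth of_qt a) ymon"
  by (simp add: fun_eq_iff plethV_def pm_lift_def)

lemma ring_map_plethV: "ring_map (plethV a)"
  unfolding plethV_eq by (intro ring_map_pm_lift ring_map_pleth ring_map_of_qt ymon_add ymon_0)

lemma plethV_of_sym: "plethV a (of_sym F) = pleth of_qt a F"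
  unfolding plethV_eq of_sym_def
  by (subst pm_lift_single) (simp_all add: ymon_0 ring_mapD(4)[OF ring_map_pleth[OF ring_map_of_qt]])

lemma plethV_of_qt [simp]: "plethV a (of_qt c) = of_qt c"
  by (subst of_qt_def) (simp add: plethV_of_sym pleth_const ring_map_of_qt)

lemma plethV_powersum: "1 \<le> n \<Longrightarrow> plethV a (of_sym (powersum n)) = a n"
  by (simp add: plethV_of_sym pleth_powersum ring_map_of_qt)

lemma plethV_yvar [simp]: "plethV a (yvar i) = yvar i"
proof -
  have "plethV a (Poly_Mapping.single m 1) = ymon m" for m
    unfolding plethV_eq
    by (simp add: pm_lift_single ring_mapD[OF ring_map_pleth[OF ring_map_of_qt]])
  then show ?thesis by (simp add: yvar_def ymon_def)
qed

lemma ypoly_pleth: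
  assumes a: "\<And>n. a n \<in> ypoly S"
  shows "pleth of_qt a F \<in> ypoly S"
proof -
  note r = ring_map_pleth[OF ring_map_of_qt, of a]
  obtain h where h: "F = peval h" using surj_peval by (metis surjD)
  have "pleth of_qt a F = meval of_qt (\<lambda>n. a (Suc n)) h"
    unfolding h peval_def ring_map_meval_comp[OF r ring_map_sym_const]
    by (simp add: pleth_const pleth_powersum ring_map_of_qt)
  also have "\<dots> \<in> ypoly S"
    unfolding meval_def pm_lift_def
    by (intro ypoly_sum ypoly_mult ypoly_of_qt ypoly_prod_mset a)
  finally show ?thesis .
qed

lemma ypoly_plethV:
  assumes "\<And>n. a n \<in> ypoly S" "F \<in> ypoly S"
  shows "plethV a F \<in> ypoly S"
  using assms(2)
proof (induction F rule: ypoly_induct)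
  case (add F G)
  then show ?case by (simp add: ring_mapD[OF ring_map_plethV] ypoly_add)
next
  case (of_sym F)
  show ?case unfolding plethV_of_sym by (rule ypoly_pleth) (rule assms)
next
  case (yvar i F)
  then show ?case by (simp add: ring_mapD[OF ring_map_plethV] ypoly_mult ypoly_yvar)
qed

lemma symy_hom_eqI:
  assumes f: "ring_map f" and g: "ring_map g"
    and c: "\<And>c. f (of_qt c) = g (of_qt c)"
    and p: "\<And>n. 1 \<le> n \<Longrightarrow> f (of_sym (powersum n)) = g (of_sym (powersum n))"
    and y: "\<And>i. f (yvar i) = g (yvar i)"
  shows "f F = g F"
proof (induction F rule: symy_induct)
  case (of_sym F)
  show ?case
    by (rule sym_hom_eqI[of "\<lambda>x. f (of_sym x)" "\<lambda>x. g (of_sym x)"])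
      (use c in \<open>auto intro: ring_map_comp[OF f ring_map_of_sym] ring_map_comp[OF g ring_map_of_sym] p
        simp: of_qt_def\<close>)
qed (simp_all add: ring_mapD[OF f] ring_mapD[OF g] y)

section \<open>The automorphisms \<open>theta\<close> and their inverses\<close>

definition theta :: "nat \<Rightarrow> symy \<Rightarrow> symy" where
  "theta k = plethV (\<lambda>n. of_sym (powersum n) + of_qt (qq ^ n - 1) * yvar k ^ n)"

definition theta_inv :: "nat \<Rightarrow> symy \<Rightarrow> symy" where
  "theta_inv k = plethV (\<lambda>n. of_sym (powersum n) - of_qt (qq ^ n - 1) * yvar k ^ n)"

lemma ring_map_theta: "ring_map (theta k)" "ring_map (theta_inv k)"
  by (simp_all add: theta_def theta_inv_def ring_map_plethV)

lemmas theta_simps = ring_mapD[OF ring_map_theta(1)] ring_mapD[OF ring_map_theta(2)]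

lemma theta_fixes [simp]:
  "theta k (of_qt c) = of_qt c" "theta k (yvar i) = yvar i"
  "theta_inv k (of_qt c) = of_qt c" "theta_inv k (yvar i) = yvar i"
  by (simp_all add: theta_def theta_inv_def)

lemma theta_powersum:
  "1 \<le> n \<Longrightarrow> theta k (of_sym (powersum n)) = of_sym (powersum n) + of_qt (qq ^ n - 1) * yvar k ^ n"
  "1 \<le> n \<Longrightarrow> theta_inv k (of_sym (powersum n)) = of_sym (powersum n) - of_qt (qq ^ n - 1) * yvar k ^ n"
  by (simp_all add: theta_def theta_inv_def plethV_powersum)

lemma theta_theta_inv [simp]: "theta k (theta_inv k F) = F" "theta_inv k (theta k F) = F"
proof -
  have i: "ring_map (\<lambda>F :: symy. F)" by (simp add: ring_map_def)
  show "theta k (theta_inv k F) = F"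
    by (rule symy_hom_eqI[OF ring_map_comp[OF ring_map_theta(1) ring_map_theta(2)] i])
      (simp_all add: theta_powersum theta_simps)
  show "theta_inv k (theta k F) = F"
    by (rule symy_hom_eqI[OF ring_map_comp[OF ring_map_theta(2) ring_map_theta(1)] i])
      (simp_all add: theta_powersum theta_simps)
qed

lemma theta_commute: "theta j (theta k F) = theta k (theta j F)"
  by (rule symy_hom_eqI[OF ring_map_comp[OF ring_map_theta(1) ring_map_theta(1)]
        ring_map_comp[OF ring_map_theta(1) ring_map_theta(1)]])
    (simp_all add: theta_powersum theta_simps)

lemma theta_inv_theta_commute: "theta_inv j (theta k F) = theta k (theta_inv j F)"
  by (metis theta_commute theta_theta_inv)

lemma ypoly_theta: "k \<in> S \<Longrightarrow> F \<in> ypoly S \<Longrightarrow> theta k F \<in> ypoly S"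
  "k \<in> S \<Longrightarrow> F \<in> ypoly S \<Longrightarrow> theta_inv k F \<in> ypoly S"
  unfolding theta_def theta_inv_def by (intro ypoly_plethV ypoly_intros; simp)+

section \<open>Exchange of neighbouring variables\<close>

definition mswap :: "nat \<Rightarrow> monom \<Rightarrow> monom" where
  "mswap i = Poly_Mapping.map_key (transpose i (Suc i))"

lemma lookup_mswap: "Poly_Mapping.lookup (mswap i m) j = Poly_Mapping.lookup m (transpose i (Suc i) j)"
  by (simp add: mswap_def map_key.rep_eq)

lemma mswap_mswap: "mswap i (mswap i m) = m"
  by (rule poly_mapping_eqI) (simp add: lookup_mswap)

lemma mswap_add: "mswap i (m + n) = mswap i m + mswap i n"
  by (rule poly_mapping_eqI) (simp add: lookup_mswap lookup_add)

lemma mswap_single: "mswap i (Poly_Mapping.single j n) = Poly_Mapping.single (transpose i (Suc i) j) n"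
  by (rule poly_mapping_eqI)
    (auto simp: lookup_mswap lookup_single when_def transpose_eq_iff)

lemma inj_mswap: "inj (mswap i)"
  by (metis injI mswap_mswap)

lemma swap_y_single: "swap_y i (Poly_Mapping.single m c) = Poly_Mapping.single (mswap i m) c"
  unfolding swap_y_def mswap_def[symmetric]
  using map_key_single[OF inj_mswap, of i "mswap i m" c] by (simp add: mswap_mswap)

lemma swap_y_eq: "swap_y i = pm_lift of_sym (\<lambda>m. ymon (mswap i m))"
proof
  fix F
  show "swap_y i F = pm_lift of_sym (\<lambda>m. ymon (mswap i m)) F"
  proof (induction F rule: pm_induct)
    case (add F G)
    then show ?case
      by (simp add: pm_lift_add of_sym_simps swap_y_def mswap_def[symmetric] map_key_plus inj_mswap)
  next
    case (single m c)
    show ?case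
      by (simp add: swap_y_single pm_lift_single of_sym_simps flip: single_eq_of_sym_ymon)
  qed
qed

lemma ring_map_swap_y: "ring_map (swap_y i)"
  unfolding swap_y_eq
proof (rule ring_map_pm_lift[OF ring_map_of_sym])
  show "ymon (mswap i 0) = 1"
    using mswap_single[of i 0 0] by (simp add: ymon_0)
qed (simp add: mswap_add ymon_add)

lemmas swap_y_simps = ring_mapD[OF ring_map_swap_y]

lemma swap_y_of_sym [simp]: "swap_y i (of_sym F) = of_sym F"
  using swap_y_single[of i 0 F] mswap_single[of i 0 0] by (simp add: of_sym_def)

lemma swap_y_of_qt [simp]: "swap_y i (of_qt c) = of_qt c"
  by (simp add: of_qt_def)

lemma swap_y_yvar: "swap_y i (yvar j) = yvar (transpose i (Suc i) j)"
  by (simp add: yvar_def ymon_def swap_y_single mswap_single)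

lemma swap_y_yvar_simps [simp]:
  "swap_y i (yvar i) = yvar (Suc i)" "swap_y i (yvar (Suc i)) = yvar i"
  "j \<noteq> i \<Longrightarrow> j \<noteq> Suc i \<Longrightarrow> swap_y i (yvar j) = yvar j"
  by (simp_all add: swap_y_yvar)

lemma swap_y_swap_y [simp]: "swap_y i (swap_y i F) = F"
proof (induction F rule: symy_induct)
  case (yvar j F)
  then show ?case by (simp add: swap_y_simps swap_y_yvar)
qed (simp_all add: swap_y_simps)

lemma swap_y_fixed: "F \<in> ypoly (- {i, Suc i}) \<Longrightarrow> swap_y i F = F"
  by (induction F rule: ypoly_induct) (simp_all add: swap_y_simps)

lemma swap_y_theta: "swap_y i (theta k F) = theta (transpose i (Suc i) k) (swap_y i F)"
  by (rule symy_hom_eqI[OF ring_map_comp[OF ring_map_swap_y ring_map_theta(1)]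
        ring_map_comp[OF ring_map_theta(1) ring_map_swap_y]])
    (simp_all add: theta_powersum theta_simps swap_y_simps swap_y_yvar)

lemma swap_y_theta_inv: "swap_y i (theta_inv k F) = theta_inv (transpose i (Suc i) k) (swap_y i F)"
  by (metis swap_y_theta theta_theta_inv)

subsection \<open>The Demazure--Lusztig operators\<close>

text \<open>A term of \<open>R\<close> with the largest exponent of \<open>y_(i+1)\<close>,
  multiplied by \<open>y_(i+1)\<close>, would have to occur in \<open>y_i R\<close> as well, hence
  come from a term with a still larger exponent. This gives the uniqueness in
  \<open>opT\<close>.\<close>

lemma yvar_diff_cancel:
  assumes "(yvar (Suc i) - yvar i) * R = 0"
  shows "R = 0"
proof (rule ccontr)
  assume "R \<noteq> 0"
  then have ne: "Poly_Mapping.keys R \<noteq> {}" by simp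
  let ?d = "\<lambda>m :: monom. Poly_Mapping.lookup m (Suc i)"
  have "Max (?d ` Poly_Mapping.keys R) \<in> ?d ` Poly_Mapping.keys R"
    using ne by (intro Max_in) auto
  then obtain m where m: "m \<in> Poly_Mapping.keys R" "?d m = Max (?d ` Poly_Mapping.keys R)"
    by auto
  have max: "?d n \<le> ?d m" if "n \<in> Poly_Mapping.keys R" for n
    using that by (simp add: m)
  let ?m = "Poly_Mapping.single (Suc i) 1 + m"
  have l: "Poly_Mapping.lookup (Poly_Mapping.single a 1 * R) (a + n) = Poly_Mapping.lookup R n"
    for a n :: monom
    by (induction R rule: pm_induct) (auto simp: distrib_left lookup_add mult_single lookup_single when_def)
  have "yvar i * R = yvar (Suc i) * R" using assms by (simp add: left_diff_distrib)
  then have "Poly_Mapping.lookup (yvar i * R) ?m \<noteq> 0"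
    using m(1) by (simp add: yvar_def ymon_def l in_keys_iff)
  then have "?m \<in> Poly_Mapping.keys (yvar i * R)" by (simp add: in_keys_iff)
  then obtain n where n: "?m = Poly_Mapping.single i 1 + n" "n \<in> Poly_Mapping.keys R"
    using keys_mult[of "yvar i" R] by (auto simp: yvar_def ymon_def)
  from arg_cong[OF n(1), of ?d] have "?d n = Suc (?d m)"
    by (simp add: lookup_add lookup_single)
  then show False using max[OF n(2)] by simp
qed

lemma yvar_diff_cancel_iff: "(yvar (Suc i) - yvar i) * R = (yvar (Suc i) - yvar i) * R' \<longleftrightarrow> R = R'"
  using yvar_diff_cancel[of i "R - R'"] by (auto simp: right_diff_distrib)

lemma divided_difference_exists: "\<exists>S. (yvar (Suc i) - yvar i) * S = swap_y i P - P"
proof (induction P rule: symy_induct)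
  case (add F G)
  then obtain S S' where "(yvar (Suc i) - yvar i) * S = swap_y i F - F"
    "(yvar (Suc i) - yvar i) * S' = swap_y i G - G" by blast
  then have "(yvar (Suc i) - yvar i) * (S + S') = swap_y i (F + G) - (F + G)"
    by (simp add: distrib_left swap_y_simps)
  then show ?case by blast
next
  case (of_sym F)
  have "(yvar (Suc i) - yvar i) * 0 = swap_y i (of_sym F) - of_sym F" by simp
  then show ?case by blast
next
  case (yvar j F)
  then obtain S where S: "(yvar (Suc i) - yvar i) * S = swap_y i F - F" by blast
  then have F: "swap_y i F = F + (yvar (Suc i) - yvar i) * S" by (simp add: algebra_simps)
  \<comment> \<open>Leibniz rule for divided differences: the case distinction is \<open>F\<close>
    times the divided difference of \<open>y_j\<close>, which is 1, -1 or 0.\<close>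
  have "(yvar (Suc i) - yvar i) *
      (yvar (transpose i (Suc i) j) * S + (if j = i then F else if j = Suc i then - F else 0)) =
      swap_y i (yvar j * F) - yvar j * F"
    by (auto simp: swap_y_simps F) (simp_all add: algebra_simps)
  then show ?case by blast
qed

lemma opT_eqI:
  assumes "(yvar (Suc i) - yvar i) * R =
    of_qt (qq - 1) * yvar i * P + (yvar (Suc i) - of_qt qq * yvar i) * swap_y i P"
  shows "opT i P = R"
  unfolding opT_def
proof (rule the_equality)
  show "(yvar (Suc i) - yvar i) * R =
    of_qt (qq - 1) * yvar i * P + (yvar (Suc i) - of_qt qq * yvar i) * swap_y i P"
    by (rule assms)
  fix R' assume "(yvar (Suc i) - yvar i) * R' =
    of_qt (qq - 1) * yvar i * P + (yvar (Suc i) - of_qt qq * yvar i) * swap_y i P"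
  then have "(yvar (Suc i) - yvar i) * R' = (yvar (Suc i) - yvar i) * R" using assms by simp
  then show "R' = R" by (simp only: yvar_diff_cancel_iff)
qed

text \<open>\<open>S\<close> is the divided difference of \<open>P\<close>, hence symmetric. The
  form isolates the deviation of \<open>T_i\<close> from the identity, which \<open>d_-^2\<close>
  has to annihilate.\<close>

lemma opT_symmetric_part:
  obtains S where "opT i P = P + (yvar (Suc i) - of_qt qq * yvar i) * S" "swap_y i S = S"
    "(yvar (Suc i) - yvar i) * S = swap_y i P - P"
proof -
  obtain S where S: "(yvar (Suc i) - yvar i) * S = swap_y i P - P"
    using divided_difference_exists by blast
  then have F: "swap_y i P = P + (yvar (Suc i) - yvar i) * S" by (simp add: algebra_simps)
  have "opT i P = P + (yvar (Suc i) - of_qt qq * yvar i) * S"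
    by (rule opT_eqI) (simp add: F of_qt_simps algebra_simps)
  moreover have "swap_y i S = S"
  proof -
    have 1: "(yvar i - yvar (Suc i)) * swap_y i S = P - swap_y i P"
      using arg_cong[OF S, of "swap_y i"] by (simp add: swap_y_simps)
    have "(yvar (Suc i) - yvar i) * swap_y i S = - ((yvar i - yvar (Suc i)) * swap_y i S)"
      by (simp add: algebra_simps)
    also have "\<dots> = (yvar (Suc i) - yvar i) * S"
      unfolding 1 S by simp
    finally have "(yvar (Suc i) - yvar i) * swap_y i S = (yvar (Suc i) - yvar i) * S" .
    then show ?thesis by (simp only: yvar_diff_cancel_iff)
  qed
  ultimately show ?thesis using S that by blast
qed

lemma opT_eq:
  "(yvar (Suc i) - yvar i) * opT i P =
    of_qt (qq - 1) * yvar i * P + (yvar (Suc i) - of_qt qq * yvar i) * swap_y i P"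
proof -
  obtain S where S: "opT i P = P + (yvar (Suc i) - of_qt qq * yvar i) * S"
    "(yvar (Suc i) - yvar i) * S = swap_y i P - P"
    by (rule opT_symmetric_part)
  then have F: "swap_y i P = P + (yvar (Suc i) - yvar i) * S" by (simp add: algebra_simps)
  show ?thesis by (simp add: S(1) F of_qt_simps algebra_simps)
qed

lemma opT_add: "opT i (P + Q) = opT i P + opT i Q"
  by (rule opT_eqI) (unfold distrib_left opT_eq swap_y_simps, simp add: algebra_simps)

lemma opT_mult: "swap_y i Q = Q \<Longrightarrow> opT i (Q * P) = Q * opT i P"
  by (rule opT_eqI)
    (simp add: mult.left_commute[of _ Q "opT i P"] opT_eq swap_y_simps, simp add: algebra_simps)

lemma opT_fixed: "swap_y i Q = Q \<Longrightarrow> opT i Q = Q"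
  by (rule opT_eqI) (simp add: of_qt_simps algebra_simps)

lemma opT_of_qt: "opT i (of_qt c * P) = of_qt c * opT i P"
  by (rule opT_mult) simp

lemma opT_of_sym [simp]: "opT i (of_sym F) = of_sym F"
  by (rule opT_fixed) simp

lemma opT_0 [simp]: "opT i 0 = 0"
  by (rule opT_fixed) (simp add: swap_y_simps)

lemma opT_uminus: "opT i (- P) = - opT i P"
  using opT_of_qt[of i "-1" P] by (simp add: of_qt_simps)

lemma opT_diff: "opT i (P - Q) = opT i P - opT i Q"
  using opT_add[of i P "- Q"] by (simp add: opT_uminus)

text \<open>With \<open>opT_yvar_Suc\<close> and \<open>opT_yvar_other\<close>, these are the
  Bernstein relations of the affine Hecke algebra. As \<open>T_i\<close> fixes the coefficients from
  \<open>sym\<close>, they determine \<open>T_i\<close>, and the Hecke relations follow by moving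
  one variable at a time to the front.\<close>

lemma opT_yvar:
  "opT i (yvar i * P) = yvar (Suc i) * opT i P - of_qt (qq - 1) * yvar i * P"
proof (rule opT_eqI)
  have "(yvar (Suc i) - yvar i) * (yvar (Suc i) * opT i P - of_qt (qq - 1) * yvar i * P) =
      yvar (Suc i) * ((yvar (Suc i) - yvar i) * opT i P) -
      (yvar (Suc i) - yvar i) * (of_qt (qq - 1) * yvar i * P)"
    by (simp add: algebra_simps)
  then show "(yvar (Suc i) - yvar i) * (yvar (Suc i) * opT i P - of_qt (qq - 1) * yvar i * P) =
      of_qt (qq - 1) * yvar i * (yvar i * P) +
      (yvar (Suc i) - of_qt qq * yvar i) * swap_y i (yvar i * P)"
    unfolding opT_eq by (simp add: swap_y_simps algebra_simps)
qed

lemma opT_yvar_Suc: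
  "opT i (yvar (Suc i) * P) = yvar i * (opT i P + of_qt (qq - 1) * P)"

proof (rule opT_eqI)
  have "(yvar (Suc i) - yvar i) * (yvar i * (opT i P + of_qt (qq - 1) * P)) =
      yvar i * ((yvar (Suc i) - yvar i) * opT i P) +
      (yvar (Suc i) - yvar i) * (of_qt (qq - 1) * yvar i * P)"
    by (simp add: algebra_simps)
  then show "(yvar (Suc i) - yvar i) * (yvar i * (opT i P + of_qt (qq - 1) * P)) =
      of_qt (qq - 1) * yvar i * (yvar (Suc i) * P) +
      (yvar (Suc i) - of_qt qq * yvar i) * swap_y i (yvar (Suc i) * P)"
    unfolding opT_eq by (simp add: swap_y_simps algebra_simps)
qed

lemma opT_yvar_other: "j \<noteq> i \<Longrightarrow> j \<noteq> Suc i \<Longrightarrow> opT i (yvar j * P) = yvar j * opT i P"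
  by (rule opT_mult) simp

lemmas opT_linear = opT_add opT_diff opT_uminus opT_of_qt

lemma ypoly_opT:
  assumes "i \<in> S" "Suc i \<in> S" "F \<in> ypoly S"
  shows "opT i F \<in> ypoly S"
  using assms(3)
proof (induction F rule: ypoly_induct)
  case (yvar j F)
  consider "j = i" | "j = Suc i" | "j \<noteq> i" "j \<noteq> Suc i" by blast
  then show ?case
    by cases (use yvar assms(1,2) in \<open>auto simp: opT_yvar opT_yvar_Suc opT_yvar_other intro!: ypoly_intros\<close>)
qed (auto simp: opT_add intro: ypoly_intros)

lemma opT_quadratic: "opT i (opT i P) = of_qt qq * P - of_qt (qq - 1) * opT i P"
proof (induction P rule: symy_induct)
  case (yvar j P)
  consider "j = i" | "j = Suc i" | "j \<noteq> i" "j \<noteq> Suc i" by blast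
  then show ?case
    by cases (simp_all add: opT_linear mult.assoc opT_yvar opT_yvar_Suc opT_yvar_other yvar,
      simp_all add: of_qt_simps algebra_simps)
qed (simp_all add: opT_linear of_qt_simps algebra_simps)

text \<open>The rule \<open>T_i y_(i+1) T_i = q y_i\<close> carries both commutator relations, and
  in the algebra it becomes the definition of the lower \<open>y_i\<close>.\<close>

lemma opT_yvar_Suc_opT: "opT i (yvar (Suc i) * opT i P) = of_qt qq * yvar i * P"
  by (simp add: opT_yvar_Suc opT_quadratic mult.left_commute mult.assoc)

lemma opT_braid: "opT i (opT (Suc i) (opT i P)) = opT (Suc i) (opT i (opT (Suc i) P))"
proof (induction P rule: symy_induct)
  case (yvar j P)
  consider "j = i" | "j = Suc i" | "j = Suc (Suc i)" | "j \<noteq> i" "j \<noteq> Suc i" "j \<noteq> Suc (Suc i)" by blast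
  then show ?case
    by cases (simp_all add: opT_linear mult.assoc opT_yvar opT_yvar_Suc opT_yvar_other yvar opT_quadratic,
      simp_all add: of_qt_simps algebra_simps)
qed (simp_all add: opT_linear)

lemma opT_commute: "Suc i < j \<Longrightarrow> opT i (opT j P) = opT j (opT i P)"
proof (induction P rule: symy_induct)
  case (yvar k P)
  consider "k = i" | "k = Suc i" | "k = j" | "k = Suc j" | "k \<noteq> i" "k \<noteq> Suc i" "k \<noteq> j" "k \<noteq> Suc j" by blast
  then show ?case
    by cases (use yvar in \<open>simp_all add: opT_linear mult.assoc opT_yvar opT_yvar_Suc opT_yvar_other\<close>)
qed (simp_all add: opT_linear)

text \<open>\<open>T_i\<close> is built from scalars, variables and \<open>s_i\<close> alone, so it
  commutes with every algebra map that respects these.\<close>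

lemma opT_theta:
  assumes "\<And>F. swap_y i (f F) = f (swap_y i F)" "ring_map f"
    "\<And>j. f (yvar j) = yvar j" "\<And>c. f (of_qt c) = of_qt c"
  shows "opT i (f P) = f (opT i P)"
proof (rule opT_eqI)
  have "(yvar (Suc i) - yvar i) * f (opT i P) = f ((yvar (Suc i) - yvar i) * opT i P)"
    by (simp add: ring_mapD[OF assms(2)] assms)
  then show "(yvar (Suc i) - yvar i) * f (opT i P) =
      of_qt (qq - 1) * yvar i * f P + (yvar (Suc i) - of_qt qq * yvar i) * swap_y i (f P)"
    unfolding opT_eq by (simp add: ring_mapD[OF assms(2)] assms)
qed

lemma opT_theta_other:
  assumes "k \<noteq> i" "k \<noteq> Suc i"
  shows "opT i (theta k P) = theta k (opT i P)" "opT i (theta_inv k P) = theta_inv k (opT i P)"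
  by (rule opT_theta; use assms in \<open>simp add: swap_y_theta swap_y_theta_inv ring_map_theta\<close>)+

lemma opT_theta_theta: "opT i (theta i (theta (Suc i) P)) = theta i (theta (Suc i) (opT i P))"
  by (rule opT_theta[of i "\<lambda>P. theta i (theta (Suc i) P)"])
    (simp_all add: swap_y_theta theta_commute[of "Suc i" i] ring_map_comp ring_map_theta)

text \<open>Arranged to match \<open>theta_eps_Suc\<close>, so that both terms of the key identity
  obey one recursion in the exponent.\<close>

lemma opT_power_Suc:
  "opT i (yvar i ^ Suc a) = yvar i * opT i (yvar i ^ a) + yvar (Suc i) ^ Suc a -
    of_qt qq * yvar i * yvar (Suc i) ^ a"
proof (induction a)
  case 0
  have "opT i (yvar i * 1) = yvar (Suc i) - of_qt (qq - 1) * yvar i"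
    unfolding opT_yvar by (simp add: opT_fixed swap_y_simps)
  then show ?case by (simp add: opT_fixed swap_y_simps of_qt_simps algebra_simps)
next
  case (Suc a)
  let ?y = "yvar i" and ?z = "yvar (Suc i)" and ?A = "opT i (yvar i ^ a)"
  have A: "?z * ?A = opT i (?y ^ Suc a) + of_qt (qq - 1) * ?y * ?y ^ a"
    using opT_yvar[of i "?y ^ a"] by simp
  have "opT i (?y ^ Suc (Suc a)) = ?z * opT i (?y ^ Suc a) - of_qt (qq - 1) * ?y * ?y ^ Suc a"
    using opT_yvar[of i "?y ^ Suc a"] by simp
  also have "?z * opT i (?y ^ Suc a) = ?y * (?z * ?A) + ?z ^ Suc (Suc a) - of_qt qq * ?y * ?z ^ Suc a"
    unfolding Suc by (simp add: algebra_simps)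
  finally show ?case
    unfolding A by (simp add: algebra_simps)
qed

subsection \<open>Products of braid operators\<close>

definition Tprod :: "(nat \<Rightarrow> 'v \<Rightarrow> 'v) \<Rightarrow> nat \<Rightarrow> 'v \<Rightarrow> 'v" where
  "Tprod T k x = foldr T [1..<Suc k] x"

lemma Tprod_0 [simp]: "Tprod T 0 x = x"
  by (simp add: Tprod_def)

lemma Tprod_Suc: "Tprod T (Suc k) x = Tprod T k (T (Suc k) x)"
  by (simp add: Tprod_def)

lemma Tprod_closed:
  assumes "\<And>i x. 1 \<le> i \<Longrightarrow> i \<le> k \<Longrightarrow> x \<in> S \<Longrightarrow> T i x \<in> S" "x \<in> S"
  shows "Tprod T k x \<in> S"
  using assms by (induction k arbitrary: x) (simp_all add: Tprod_Suc)

lemma Tprod_commute: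
  assumes "\<And>i x. 1 \<le> i \<Longrightarrow> i \<le> k \<Longrightarrow> f (T i x) = T' i (f x)"
  shows "f (Tprod T k x) = Tprod T' k (f x)"
  using assms by (induction k arbitrary: x) (simp_all add: Tprod_Suc)

text \<open>Abstract in \<open>T\<close>, because it serves twice: for the operators on polynomials
  and for left multiplication by loops in the algebra. The bound \<open>N\<close> reflects that
  vertex \<open>n\<close> carries only \<open>T_1, ..., T_(n-1)\<close>.\<close>

locale braid_family =
  fixes T :: "nat \<Rightarrow> 'v \<Rightarrow> 'v" and N :: nat
  assumes braid: "1 \<le> i \<Longrightarrow> Suc i < N \<Longrightarrow> T i (T (Suc i) (T i x)) = T (Suc i) (T i (T (Suc i) x))"
    and far_commute: "1 \<le> i \<Longrightarrow> Suc i < j \<Longrightarrow> j < N \<Longrightarrow> T i (T j x) = T j (T i x)"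
begin

lemma T_Tprod: "Suc k < j \<Longrightarrow> j < N \<Longrightarrow> T j (Tprod T k x) = Tprod T k (T j x)"
  by (rule Tprod_commute) (rule far_commute[symmetric]; linarith)

lemma T_Suc_Tprod:
  "1 \<le> i \<Longrightarrow> i < k \<Longrightarrow> k < N \<Longrightarrow> T (Suc i) (Tprod T k x) = Tprod T k (T i x)"
proof (induction k arbitrary: x)
  case (Suc k)
  show ?case
  proof (cases "i = k")
    case True
    then obtain l where l: "k = Suc l" using Suc.prems by (cases k) auto
    have "T (Suc k) (Tprod T (Suc k) x) = T (Suc k) (Tprod T l (T k (T (Suc k) x)))"
      by (simp add: Tprod_Suc l)
    also have "\<dots> = Tprod T l (T (Suc k) (T k (T (Suc k) x)))"
      using Suc.prems l by (intro T_Tprod) auto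
    also have "\<dots> = Tprod T l (T k (T (Suc k) (T k x)))"
      using Suc.prems l braid[of k] by simp
    finally show ?thesis by (simp add: Tprod_Suc l True)
  next
    case False
    then have "T (Suc i) (Tprod T (Suc k) x) = Tprod T k (T i (T (Suc k) x))"
      using Suc by (simp add: Tprod_Suc)
    also have "T i (T (Suc k) x) = T (Suc k) (T i x)"
      using False Suc.prems by (intro far_commute) auto
    finally show ?thesis by (simp add: Tprod_Suc)
  qed
qed simp

text \<open>Put \<open>W_k = T_1 ... T_k\<close>. Shifting indices gives
  \<open>W_(k+1) W_k = T_2 ... T_(k+1) W_(k+1)\<close>; a further \<open>T_1\<close> in front yields
  \<open>W_(k+1) W_(k+1) = W_(k+1) W_k T_(k+1)\<close>.\<close>

lemma Tprod_Tprod_T: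
  assumes "Suc k < N"
  shows "T 1 (Tprod T (Suc k) (Tprod T k x)) = Tprod T (Suc k) (Tprod T k (T (Suc k) x))"
proof -
  have *: "Tprod T (Suc k) (foldr T xs x) = foldr T (map Suc xs) (Tprod T (Suc k) x)"
    if "set xs \<subseteq> {1..k}" for xs
    using that
  proof (induction xs)
    case (Cons i xs)
    then show ?case using assms by (simp flip: T_Suc_Tprod)
  qed simp
  have "Tprod T (Suc k) (Tprod T k x) = foldr T (map Suc [1..<Suc k]) (Tprod T (Suc k) x)"
    unfolding Tprod_def[of T k] by (rule *) auto
  then have "T 1 (Tprod T (Suc k) (Tprod T k x)) =
      foldr T (1 # map Suc [1..<Suc k]) (Tprod T (Suc k) x)" by simp
  also have "1 # map Suc [1..<Suc k] = [1..<Suc (Suc k)]"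
    by (simp add: map_Suc_upt upt_conv_Cons del: upt_Suc)
  finally show ?thesis
    by (simp only: Tprod_def[symmetric] Tprod_Suc)
qed

end

interpretation opT: braid_family opT N for N
  by unfold_locales (rule opT_braid, rule opT_commute)

subsection \<open>The operators raising and lowering the vertex\<close>

lemma opdplus_eq: "opdplus k F = Tprod opT k (theta (Suc k) F)"
  by (simp add: opdplus_def Tprod_def theta_def)

definition Ly :: "nat \<Rightarrow> symy \<Rightarrow> symy" where
  "Ly k = pm_lift of_sym (\<lambda>m. ymon (Poly_Mapping.update k 0 m) * of_sym (eps (Poly_Mapping.lookup m k)))"

lemma Ly_add: "Ly k (F + G) = Ly k F + Ly k G"
  unfolding Ly_def by (rule pm_lift_add) (simp_all add: of_sym_simps)

lemma Ly_single:
  "Ly k (Poly_Mapping.single m c) =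
    of_sym c * ymon (Poly_Mapping.update k 0 m) * of_sym (eps (Poly_Mapping.lookup m k))"
  unfolding Ly_def by (simp add: pm_lift_single of_sym_simps mult.assoc)

lemma Ly_0 [simp]: "Ly k 0 = 0"
  by (simp add: Ly_def)

lemma Ly_of_sym: "Ly k (of_sym G * F) = of_sym G * Ly k F"
proof (induction F rule: pm_induct)
  case (single m c)
  have "of_sym G * Poly_Mapping.single m c = Poly_Mapping.single m (G * c)"
    by (simp add: of_sym_def mult_single)
  then show ?case by (simp add: Ly_single of_sym_simps mult.assoc)
qed (simp add: distrib_left Ly_add)

lemma Ly_yvar:
  assumes "j \<noteq> k"
  shows "Ly k (yvar j * F) = yvar j * Ly k F"
proof (induction F rule: pm_induct)
  case (single m c)
  have "Poly_Mapping.update k 0 (Poly_Mapping.single j 1 + m) =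
      Poly_Mapping.single j 1 + Poly_Mapping.update k 0 m"
    by (rule poly_mapping_eqI)
      (use assms in \<open>simp add: lookup_add lookup_single lookup_update when_def\<close>)
  moreover have "yvar j * Poly_Mapping.single m c = Poly_Mapping.single (Poly_Mapping.single j 1 + m) c"
    by (simp add: yvar_def ymon_def mult_single)
  ultimately show ?case
    using assms
    by (simp add: Ly_single lookup_add lookup_single ymon_add ymon_single mult_ac
        del: One_nat_def)
qed (simp add: distrib_left Ly_add)

lemma Ly_mult: "Q \<in> ypoly S \<Longrightarrow> k \<notin> S \<Longrightarrow> Ly k (Q * F) = Q * Ly k F"
proof (induction Q rule: ypoly_induct)
  case (yvar i Q)
  then have "i \<noteq> k" by auto
  with yvar show ?case by (simp add: mult.assoc Ly_yvar)
qed (simp_all add: distrib_right Ly_add Ly_of_sym)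

lemma Ly_of_qt: "Ly k (of_qt c * F) = of_qt c * Ly k F"
  by (simp add: of_qt_def Ly_of_sym)

lemma Ly_uminus: "Ly k (- F) = - Ly k F"
  using Ly_of_qt[of k "-1" F] by (simp add: of_qt_simps)

lemma Ly_diff: "Ly k (F - G) = Ly k F - Ly k G"
  using Ly_add[of k F "- G"] by (simp add: Ly_uminus)

lemma Ly_power: "Ly k (yvar k ^ n) = of_sym (eps n)"
proof -
  have "Poly_Mapping.update k 0 (Poly_Mapping.single k n) = 0"
    by (rule poly_mapping_eqI) (simp add: lookup_update lookup_single)
  then show ?thesis
    by (simp add: ymon_def Ly_single of_sym_simps ymon_0 flip: ymon_single)
qed

lemma ypoly_Ly:
  assumes "F \<in> ypoly S"
  shows "Ly k F \<in> ypoly (S - {k})"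
  using assms
proof (induction F rule: ypoly_decomp[where k = k])
  case (power n G)
  have "Ly k (G * yvar k ^ n) = G * Ly k (yvar k ^ n)"
    using power by (rule Ly_mult) simp
  then show ?case
    using power by (simp add: mult.commute[of G] Ly_power ypoly_intros)
qed (simp add: Ly_add ypoly_add)

text \<open>The variable \<open>z\<close> marks the degree: \<open>h_n[-zX] = h_n[-X] z^n\<close> by
  uniqueness in Newton's recursion, so the infinite sum merely lists coefficients.\<close>

lemma Exp_minus_zX_nth: "fps_nth Exp_minus_zX n = of_sym (hneg n)"
proof -
  let ?\<iota> = "\<lambda>c. fps_const (of_qt c)"
  let ?a = "\<lambda>n. - (fps_X ^ n * fps_const (of_sym (powersum n)))"
  let ?E = "Abs_fps (\<lambda>n. of_sym (hneg n))"
  have \<iota>: "ring_map ?\<iota>"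
    by (rule ring_mapI) (simp_all add: of_qt_simps flip: fps_const_add fps_const_mult)
  have "newton ?a (\<lambda>n. fps_const (of_sym (hneg n)) * fps_X ^ n)"
    unfolding newton_def
  proof (intro conjI allI)
    fix n
    have r: "ring_map (\<lambda>x. fps_const (of_sym x))"
      by (rule ring_mapI) (simp_all add: of_sym_simps flip: fps_const_add fps_const_mult)
    have "of_nat n * (fps_const (of_sym (hneg n)) * fps_X ^ n) = fps_const (of_sym (of_nat n * hneg n)) * fps_X ^ n"
      by (simp add: ring_mapD[OF r] mult.assoc)
    also have "\<dots> = (\<Sum>i=1..n. fps_const (of_sym (- powersum i * hneg (n - i))) * fps_X ^ n)"
      unfolding newtonD(2)[OF newton_hneg] ring_mapD(9)[OF r] sum_distrib_right ..
    also have "\<dots> = (\<Sum>i=1..n. ?a i * (fps_const (of_sym (hneg (n - i))) * fps_X ^ (n - i)))"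
    proof (rule sum.cong[OF refl])
      fix i assume "i \<in> {1..n}"
      then have "fps_X ^ n = (fps_X ^ i * fps_X ^ (n - i) :: symy fps)" by (simp flip: power_add)
      then show "fps_const (of_sym (- powersum i * hneg (n - i))) * fps_X ^ n =
          ?a i * (fps_const (of_sym (hneg (n - i))) * fps_X ^ (n - i))"
        by (simp add: ring_mapD[OF r] algebra_simps)
    qed
    finally show "of_nat n * (fps_const (of_sym (hneg n)) * fps_X ^ n) =
      (\<Sum>i=1..n. ?a i * (fps_const (of_sym (hneg (n - i))) * fps_X ^ (n - i)))" .
  qed (simp add: of_sym_simps)
  then have "pleth ?\<iota> ?a (hsym n) = fps_const (of_sym (hneg n)) * fps_X ^ n" for n
    by (rule newton_unique[OF \<iota> newton_pleth[OF \<iota>]])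
  then have "Exp_minus_zX = suminf (\<lambda>n. fps_const (fps_nth ?E n) * fps_X ^ n)"
    by (simp add: Exp_minus_zX_def pleth_Exp_def)
  also have "\<dots> = ?E"
    using fps_notation[of ?E] by (simp add: sums_def_le atMost_atLeast0 sums_unique[symmetric])
  finally show ?thesis unfolding fps_eq_iff by simp
qed

lemma opdminus_eq: "opdminus k F = Ly k (theta_inv k F)"
proof -
  define G where "G = theta_inv k F"
  \<comment> \<open>\<open>y_k^j\<close> is \<open>z^(-j)\<close>, so the coefficient of
    \<open>z\<close> meets the term of index \<open>j + 1\<close> of the exponential; this is the
    shift in \<open>eps\<close>.\<close>
  have "fls_nth (fls_const c * fls_X_intpow (- int j) * fps_to_fls Exp_minus_zX) 1 =
      c * of_sym (hneg (Suc j))" for c j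
    unfolding mult.assoc unfolding fls_X_intpow_times_conv_shift(1)
    by (simp add: Exp_minus_zX_nth nat_add_distrib)
  then have "fls_nth (laurent_y k G * fps_to_fls Exp_minus_zX) 1 =
      (\<Sum>m\<in>Poly_Mapping.keys G. Poly_Mapping.single (Poly_Mapping.update k 0 m) (Poly_Mapping.lookup G m) *
        of_sym (hneg (Suc (Poly_Mapping.lookup m k))))"
    by (simp add: laurent_y_def sum_distrib_right fls_nth_sum)
  also have "\<dots> = - Ly k G"
    by (simp add: Ly_def pm_lift_def eps_def of_sym_simps sum_negf single_eq_of_sym_ymon mult.assoc)
  finally show ?thesis
    by (simp add: opdminus_def G_def theta_inv_def)
qed

subsection \<open>Relations between the operators\<close>

text \<open>Multiplying the generating function of \<open>G\<close> by \<open>1 - a z\<close> subtracts \<open>a\<^sup>n\<close> from the \<open>n\<close>-th power sum.\<close>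

lemma newton_shift:
  assumes "newton p G"
  shows "newton (\<lambda>n. p n - a ^ n) (\<lambda>n. G n - (if n = 0 then 0 else a * G (n - 1)))"
  unfolding newton_def
proof (intro conjI allI)
  let ?c = "\<lambda>n. if n = 0 then 0 else a * G (n - 1)"
  show "G 0 - ?c 0 = 1" using assms by (simp add: newtonD)
  fix n
  show "of_nat n * (G n - ?c n) = (\<Sum>i=1..n. (p i - a ^ i) * (G (n - i) - ?c (n - i)))"
  proof (cases n)
    case (Suc m)
    have c: "(\<Sum>i=1..n. x i * ?c (n - i)) = a * (\<Sum>i=1..m. x i * G (m - i))" for x
    proof -
      have "(\<Sum>i=1..n. x i * ?c (n - i)) = (\<Sum>i=1..m. x i * ?c (n - i))"
        by (simp add: Suc)
      also have "\<dots> = (\<Sum>i=1..m. a * (x i * G (m - i)))"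
        by (rule sum.cong) (auto simp: Suc Suc_diff_le algebra_simps)
      finally show ?thesis by (simp add: sum_distrib_left)
    qed
    have "(\<Sum>i=1..n. a ^ i * G (n - i)) = (\<Sum>i=0..m. a ^ Suc i * G (m - i))"
      using sum.shift_bounds_cl_Suc_ivl[of "\<lambda>i. a ^ i * G (Suc m - i)" 0 m] by (simp add: Suc)
    also have "\<dots> = a * G m + (\<Sum>i=1..m. a ^ Suc i * G (m - i))"
      by (subst sum.atLeast_Suc_atMost) auto
    finally have s: "(\<Sum>i=1..n. a ^ i * G (n - i)) = a * G m + a * (\<Sum>i=1..m. a ^ i * G (m - i))"
      by (simp add: sum_distrib_left mult.assoc)
    have "(\<Sum>i=1..n. (p i - a ^ i) * (G (n - i) - ?c (n - i))) =
        (\<Sum>i=1..n. p i * G (n - i)) - (\<Sum>i=1..n. p i * ?c (n - i)) -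
        (\<Sum>i=1..n. a ^ i * G (n - i)) + (\<Sum>i=1..n. a ^ i * ?c (n - i))"
      by (simp only: left_diff_distrib right_diff_distrib sum_subtractf) (simp add: algebra_simps)
    also have "\<dots> = of_nat n * G n - a * (of_nat m * G m) - a * G m"
      unfolding c s using newtonD(2)[OF assms, of n] newtonD(2)[OF assms, of m]
      by (simp only:) (simp add: algebra_simps)
    finally show ?thesis by (simp add: Suc algebra_simps)
  qed simp
qed

lemma newton_of_sym_hneg: "newton (\<lambda>n. - of_sym (powersum n)) (\<lambda>n. of_sym (hneg n))"
  by (rule newton_map[OF ring_map_of_sym newton_hneg]) (simp add: of_sym_simps)

text \<open>Since \<open>Exp[-z(q-1)y_k] = (1 - q y_k z) / (1 - y_k z)\<close>, the transformed
  series times \<open>1 - y_k z\<close> is the original one times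
  \<open>1 - q y_k z\<close>.\<close>

lemma theta_hneg:
  "theta k (of_sym (hneg (Suc n))) - yvar k * theta k (of_sym (hneg n)) =
    of_sym (hneg (Suc n)) - of_qt qq * yvar k * of_sym (hneg n)"
proof -
  have "newton (\<lambda>n. - of_sym (powersum n) - of_qt (qq ^ n - 1) * yvar k ^ n) (\<lambda>n. theta k (of_sym (hneg n)))"
    by (rule newton_map[OF ring_map_theta(1) newton_of_sym_hneg])
      (simp add: theta_simps theta_powersum)
  from newton_shift[OF this, of "yvar k"] newton_shift[OF newton_of_sym_hneg, of "of_qt qq * yvar k"]
  show ?thesis
    using newton_unique[OF ring_map_of_qt, of _ "\<lambda>n. theta k (of_sym (hneg n)) - (if n = 0 then 0 else yvar k * theta k (of_sym (hneg (n - 1))))"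
        "\<lambda>n. of_sym (hneg n) - (if n = 0 then 0 else of_qt qq * yvar k * of_sym (hneg (n - 1)))" "Suc n"]
    by (simp add: of_qt_simps power_mult_distrib algebra_simps)
qed

lemma theta_inv_hneg:
  "theta_inv k (of_sym (hneg (Suc n))) - of_qt qq * yvar k * theta_inv k (of_sym (hneg n)) =
    of_sym (hneg (Suc n)) - yvar k * of_sym (hneg n)"
  using arg_cong[OF theta_hneg[of k n], of "theta_inv k"] by (simp add: theta_simps)

lemma theta_eps_0: "theta k (of_sym (eps 0)) = of_sym (eps 0) + of_qt (qq - 1) * yvar k"
  using theta_hneg[of k 0]
  by (simp add: eps_def of_sym_simps theta_simps of_qt_simps algebra_simps)

lemma theta_eps_Suc:
  "theta k (of_sym (eps (Suc a))) =
    yvar k * theta k (of_sym (eps a)) + of_sym (eps (Suc a)) - of_qt qq * yvar k * of_sym (eps a)"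
  using theta_hneg[of k "Suc a"]
  by (simp add: eps_def of_sym_simps theta_simps algebra_simps)

lemma theta_inv_eps_Suc:
  "theta_inv k (of_sym (eps (Suc a))) - of_qt qq * yvar k * theta_inv k (of_sym (eps a)) =
    of_sym (eps (Suc a)) - yvar k * of_sym (eps a)"
  using theta_inv_hneg[of k "Suc a"]
  by (simp add: eps_def of_sym_simps theta_simps algebra_simps)

text \<open>The key identity on powers: by the matching recursions the difference is multiplied by
  \<open>y_k\<close> when \<open>a\<close> grows by one, starting from
  \<open>(q-1) y_k\<close>.\<close>

lemma Ly_opT_power:
  "theta k (of_sym (eps a)) - Ly (Suc k) (opT k (yvar k ^ a)) = of_qt (qq - 1) * yvar k ^ Suc a"
proof (induction a)
  case 0
  show ?case
    using Ly_power[of "Suc k" 0] by (simp add: theta_eps_0 opT_fixed swap_y_simps)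
next
  case (Suc a)
  have "Ly (Suc k) (opT k (yvar k ^ Suc a)) =
      yvar k * Ly (Suc k) (opT k (yvar k ^ a)) + of_sym (eps (Suc a)) - of_qt qq * yvar k * of_sym (eps a)"
    unfolding opT_power_Suc mult.assoc Ly_diff Ly_add Ly_of_qt by (simp only: Ly_yvar Ly_power n_not_Suc_n not_False_eq_True)
  then show ?case
    using arg_cong[OF Suc, of "\<lambda>x. yvar k * x"] by (simp add: theta_eps_Suc algebra_simps)
qed

section \<open>The key identity and the relations for the lowering operator\<close>

lemma opdminus_add: "opdminus k (F + G) = opdminus k F + opdminus k G"
  by (simp add: opdminus_eq theta_simps Ly_add)

lemma opdminus_of_qt: "opdminus k (of_qt c * F) = of_qt c * opdminus k F"
  by (simp add: opdminus_eq theta_simps Ly_of_qt)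

lemma opdminus_0 [simp]: "opdminus k 0 = 0"
  by (simp add: opdminus_eq theta_simps)

lemma opdminus_yvar: "j \<noteq> k \<Longrightarrow> opdminus k (yvar j * F) = yvar j * opdminus k F"
  by (simp add: opdminus_eq theta_simps Ly_yvar)

lemma opdminus_theta_mult:
  assumes "G \<in> ypoly (- {k})"
  shows "opdminus k (theta k G * yvar k ^ n) = G * of_sym (eps n)"
proof -
  have "opdminus k (theta k G * yvar k ^ n) = Ly k (G * yvar k ^ n)"
    by (simp add: opdminus_eq theta_simps)
  also have "\<dots> = G * Ly k (yvar k ^ n)"
    using assms by (rule Ly_mult) simp
  finally show ?thesis by (simp add: Ly_power)
qed

text \<open>With \<open>F = theta k F'\<close> the inverse inside \<open>d_-\<close> cancels. For
  \<open>F' = y_k^n G\<close> with \<open>G\<close> free of \<open>y_k\<close> and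
  \<open>y_(k+1)\<close>, the image of \<open>G\<close> under both automorphisms is symmetric in
  these variables and passes through \<open>T_k\<close>, leaving
  \<open>Ly_opT_power\<close>.\<close>

lemma theta_opdminus:
  assumes "F \<in> ypoly (- {Suc k})"
  shows "theta k (opdminus k F) - opdminus (Suc k) (opT k (theta (Suc k) F)) = of_qt (qq - 1) * yvar k * F"
proof -
  define F' where "F' = theta_inv k F"
  have "F' \<in> ypoly (- {Suc k})"
    unfolding F'_def by (rule ypoly_theta) (use assms in auto)
  then have "theta k (opdminus k (theta k F')) - opdminus (Suc k) (opT k (theta (Suc k) (theta k F'))) =
      of_qt (qq - 1) * yvar k * theta k F'"
  proof (induction F' rule: ypoly_decomp[where k = k])
    case (add G H)
    then show ?case
      by (simp add: theta_simps opdminus_add opT_add distrib_left add_diff_add)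
  next
    case (power n G)
    have s: "swap_y k (theta (Suc k) (theta k G)) = theta (Suc k) (theta k G)"
    proof -
      have "swap_y k G = G"
        using power by (intro swap_y_fixed) (auto elim!: ypoly_mono[rotated])
      then show ?thesis by (simp add: swap_y_theta theta_commute[of "Suc k" k])
    qed
    have "opT k (theta (Suc k) (theta k (yvar k ^ n * G))) =
        theta (Suc k) (theta k G) * opT k (yvar k ^ n)"
      using opT_mult[OF s] by (simp add: theta_simps mult.commute)
    then have "opdminus (Suc k) (opT k (theta (Suc k) (theta k (yvar k ^ n * G)))) =
        Ly (Suc k) (theta k G * theta_inv (Suc k) (opT k (yvar k ^ n)))"
      by (simp add: opdminus_eq theta_simps)
    also have "theta_inv (Suc k) (opT k (yvar k ^ n)) = opT k (yvar k ^ n)"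
      by (induction n) (simp_all only: opT_power_Suc theta_simps theta_fixes power_0, simp add: opT_fixed swap_y_simps theta_simps)
    also have "Ly (Suc k) (theta k G * opT k (yvar k ^ n)) = theta k G * Ly (Suc k) (opT k (yvar k ^ n))"
      by (rule Ly_mult[of _ "- {Suc k}"], rule ypoly_theta)
        (use power in \<open>auto elim!: ypoly_mono[rotated]\<close>)
    finally have 1: "opdminus (Suc k) (opT k (theta (Suc k) (theta k (yvar k ^ n * G)))) =
        theta k G * Ly (Suc k) (opT k (yvar k ^ n))" .
    have "opdminus k (theta k (yvar k ^ n * G)) = G * of_sym (eps n)"
      using opdminus_theta_mult[of G k n] power
      by (simp add: theta_simps mult.commute ypoly_mono[of "- {Suc k} - {k}" "- {k}"] subset_eq)
    then have "theta k (opdminus k (theta k (yvar k ^ n * G))) = theta k G * theta k (of_sym (eps n))"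
      by (simp add: theta_simps)
    then have "theta k (opdminus k (theta k (yvar k ^ n * G))) -
        opdminus (Suc k) (opT k (theta (Suc k) (theta k (yvar k ^ n * G)))) =
        theta k G * (theta k (of_sym (eps n)) - Ly (Suc k) (opT k (yvar k ^ n)))"
      unfolding 1 by (simp add: right_diff_distrib)
    then show ?case
      unfolding Ly_opT_power by (simp add: theta_simps mult_ac)
  qed
  then show ?thesis by (simp add: F'_def)
qed

lemma opT_Ly:
  assumes "i \<noteq> k" "Suc i \<noteq> k"
  shows "opT i (Ly k F) = Ly k (opT i F)"
proof (induction F rule: ypoly_decomp[OF ypoly_UNIV, where k = k])
  case (2 n G)
  have "opT i (yvar k ^ n * G) = opT i G * yvar k ^ n"
    using opT_mult[of i "yvar k ^ n" G] assms by (simp add: swap_y_simps mult.commute)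
  moreover have "opT i G \<in> ypoly (UNIV - {k})"
    using 2 assms by (intro ypoly_opT) auto
  ultimately have "Ly k (opT i (yvar k ^ n * G)) = opT i G * of_sym (eps n)"
    by (simp add: Ly_mult Ly_power)
  moreover have "Ly k (yvar k ^ n * G) = of_sym (eps n) * G"
    using 2 Ly_mult[of G "UNIV - {k}" k "yvar k ^ n"] by (simp add: Ly_power mult.commute)
  ultimately show ?case
    using opT_mult[of i "of_sym (eps n)" G] by (simp add: mult.commute)
qed (simp add: Ly_add opT_add)

lemma opT_opdminus: "Suc i < k \<Longrightarrow> opT i (opdminus k F) = opdminus k (opT i F)"
  by (simp add: opdminus_eq opT_Ly opT_theta_other)

text \<open>\<open>K((y\<^sub>i\<^sub>+\<^sub>1 - q y\<^sub>i) P)\<close> is antisymmetric under exchanging \<open>y\<^sub>i\<close> and \<open>y\<^sub>i\<^sub>+\<^sub>1\<close> in \<open>P\<close>, for the operator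
  \<open>K\<close> such that \<open>d\<^sub>-\<^sup>2 \<theta>\<^sub>i \<theta>\<^sub>i\<^sub>+\<^sub>1 = K\<close>; hence \<open>K (T\<^sub>i P) = K P\<close>.\<close>

lemma opdminus_opdminus_opT:
  "opdminus i (opdminus (Suc i) (opT i F)) = opdminus i (opdminus (Suc i) F)"
proof -
  define K where "K P = Ly i (theta_inv i (Ly (Suc i) (theta i P)))" for P
  have K: "opdminus i (opdminus (Suc i) (theta i (theta (Suc i) P))) = K P" for P
    by (simp add: opdminus_eq K_def theta_inv_theta_commute theta_commute[of i "Suc i"])
  have K_add: "K (P + Q) = K P + K Q" for P Q
    by (simp add: K_def theta_simps Ly_add)
  have K_diff: "K (P - Q) = K P - K Q" for P Q
    by (simp add: K_def theta_simps Ly_diff)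
  have K_qt: "K (of_qt c * P) = of_qt c * K P" for c P
    by (simp add: K_def theta_simps Ly_of_qt)
  let ?y = "yvar i" and ?z = "yvar (Suc i)"
  have K1: "K (?y ^ a * (?z ^ b * Q)) = Q * Ly i (?y ^ a * theta_inv i (of_sym (eps b)))"
    if Q: "Q \<in> ypoly (- {i, Suc i})" for a b Q
  proof -
    have "theta i (?y ^ a * (?z ^ b * Q)) = (?y ^ a * theta i Q) * ?z ^ b"
      by (simp add: theta_simps mult_ac)
    moreover have "?y ^ a * theta i Q \<in> ypoly (- {Suc i})"
      by (intro ypoly_mult ypoly_power ypoly_yvar ypoly_theta) (use Q in \<open>auto elim!: ypoly_mono[rotated]\<close>)
    ultimately have "Ly (Suc i) (theta i (?y ^ a * (?z ^ b * Q))) = ?y ^ a * theta i Q * of_sym (eps b)"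
      by (simp add: Ly_mult Ly_power)
    then have "K (?y ^ a * (?z ^ b * Q)) = Ly i (Q * (?y ^ a * theta_inv i (of_sym (eps b))))"
      by (simp add: K_def theta_simps mult_ac)
    also have "\<dots> = Q * Ly i (?y ^ a * theta_inv i (of_sym (eps b)))"
      using Q by (rule Ly_mult) simp
    finally show ?thesis .
  qed
  define J where "J P = K ((?z - of_qt qq * ?y) * P)" for P
  have J_add: "J (P + Q) = J P + J Q" for P Q
    by (simp add: J_def distrib_left K_add)
  have J1: "J (?y ^ a * (?z ^ b * Q)) =
      Q * (of_sym (eps a) * of_sym (eps (Suc b)) - of_sym (eps (Suc a)) * of_sym (eps b))"
    if Q: "Q \<in> ypoly (- {i, Suc i})" for a b Q
  proof -
    have "(?z - of_qt qq * ?y) * (?y ^ a * (?z ^ b * Q)) =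
        ?y ^ a * (?z ^ Suc b * Q) - of_qt qq * (?y ^ Suc a * (?z ^ b * Q))"
      by (simp add: algebra_simps)
    then have "J (?y ^ a * (?z ^ b * Q)) =
        K (?y ^ a * (?z ^ Suc b * Q)) - of_qt qq * K (?y ^ Suc a * (?z ^ b * Q))"
      by (simp only: J_def K_diff K_qt)
    also have "\<dots> = Q * Ly i (?y ^ a * (theta_inv i (of_sym (eps (Suc b))) -
        of_qt qq * ?y * theta_inv i (of_sym (eps b))))"
    proof -
      have "Ly i (?y ^ a * (of_qt qq * ?y * theta_inv i (of_sym (eps b)))) =
          of_qt qq * Ly i (?y ^ Suc a * theta_inv i (of_sym (eps b)))"
        by (simp add: mult_ac flip: Ly_of_qt)
      then show ?thesis by (simp only: K1[OF Q] right_diff_distrib Ly_diff) (simp add: mult_ac)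
    qed
    also have "\<dots> = Q * Ly i (of_sym (eps (Suc b)) * ?y ^ a - of_sym (eps b) * ?y ^ Suc a)"
      unfolding theta_inv_eps_Suc by (simp add: right_diff_distrib mult_ac)
    also have "\<dots> = Q * (of_sym (eps a) * of_sym (eps (Suc b)) - of_sym (eps (Suc a)) * of_sym (eps b))"
      by (simp only: Ly_diff Ly_of_sym Ly_power) (simp add: mult_ac)
    finally show ?thesis .
  qed
  \<comment> \<open>The value found in \<open>J1\<close> changes sign when \<open>a\<close> and
    \<open>b\<close> are exchanged.\<close>
  have J_swap: "J (swap_y i P) = - J P" for P
  proof (induction P rule: ypoly_decomp[OF ypoly_UNIV, where k = i])
    case (2 a G)
    then show ?case
    proof (induction G rule: ypoly_decomp[where k = "Suc i"])
      case (add F G)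
      then show ?case by (simp add: distrib_left J_add swap_y_simps)
    next
      case (power b Q)
      then have Q: "Q \<in> ypoly (- {i, Suc i})" by (auto elim!: ypoly_mono[rotated])
      have "swap_y i (?y ^ a * (?z ^ b * Q)) = ?y ^ b * (?z ^ a * Q)"
        by (simp add: swap_y_simps swap_y_fixed[OF Q] mult_ac)
      then show ?case by (simp only: J1[OF Q]) (simp add: algebra_simps)
    qed
  qed (simp add: J_add swap_y_simps)
  have "K (opT i P) = K P" for P
  proof -
    obtain S where S: "opT i P = P + (?z - of_qt qq * ?y) * S" "swap_y i S = S"
      by (rule opT_symmetric_part)
    \<comment> \<open>\<open>S\<close> is symmetric, so \<open>J S = - J S\<close>, and 2 is
      invertible.\<close>
    have "of_nat 2 * J S = of_nat 2 * 0" using J_swap[of S] S(2) by simp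
    then have "J S = 0" by (rule of_nat_cancel_qt_algebra[OF ring_map_of_qt, rotated]) simp
    then show ?thesis by (simp add: S(1) K_add J_def)
  qed
  moreover define P where "P = theta_inv i (theta_inv (Suc i) F)"
  have F: "F = theta i (theta (Suc i) P)"
    by (simp add: P_def theta_commute[of i "Suc i"])
  ultimately show ?thesis
    unfolding F opT_theta_theta K by simp
qed

section \<open>Relations involving the raising operator\<close>

lemma Tprod_opT_linear:
  "Tprod opT k (P - Q) = Tprod opT k P - Tprod opT k Q"
  "Tprod opT k (P + Q) = Tprod opT k P + Tprod opT k Q"
  "Tprod opT k (of_qt c * P) = of_qt c * Tprod opT k P"
  by (induction k arbitrary: P Q) (simp_all add: Tprod_Suc opT_linear)

lemma opdplus_add: "opdplus k (F + G) = opdplus k F + opdplus k G"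
  by (simp add: opdplus_eq theta_simps Tprod_opT_linear)

lemma opdplus_of_qt: "opdplus k (of_qt c * F) = of_qt c * opdplus k F"
  by (simp add: opdplus_eq theta_simps Tprod_opT_linear)

lemma opdplus_0 [simp]: "opdplus k 0 = 0"
  using opdplus_of_qt[of k 0 0] by (simp add: of_qt_simps)

lemma opT_V: "1 \<le> i \<Longrightarrow> i < k \<Longrightarrow> F \<in> V k \<Longrightarrow> opT i F \<in> V k"
  unfolding V_eq_ypoly by (rule ypoly_opT) auto

lemma opdplus_V: "F \<in> V k \<Longrightarrow> opdplus k F \<in> V (Suc k)"
  unfolding opdplus_eq V_eq_ypoly
  by (intro Tprod_closed ypoly_opT ypoly_theta) (auto elim!: ypoly_mono[rotated])

lemma opdminus_V: "F \<in> V (Suc k) \<Longrightarrow> opdminus (Suc k) F \<in> V k"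
proof -
  assume "F \<in> V (Suc k)"
  then have "Ly (Suc k) (theta_inv (Suc k) F) \<in> ypoly ({1..Suc k} - {Suc k})"
    unfolding V_eq_ypoly by (intro ypoly_Ly ypoly_theta) auto
  then show ?thesis
    unfolding V_eq_ypoly opdminus_eq by (rule ypoly_mono[rotated]) auto
qed

lemma opdplus_opT: "1 \<le> i \<Longrightarrow> i < k \<Longrightarrow> opdplus k (opT i F) = opT (Suc i) (opdplus k F)"
  unfolding opdplus_eq by (simp add: opT.T_Suc_Tprod[of i k "Suc k"] opT_theta_other)

lemma theta_Tprod: "k < j \<Longrightarrow> theta (Suc j) (Tprod opT k F) = Tprod opT k (theta (Suc j) F)"
  by (rule Tprod_commute) (simp add: opT_theta_other)

text \<open>\<open>T_1\<close> passes through both braid products and becomes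
  \<open>T_(k+1)\<close>. It then acts on \<open>theta_(k+2) theta_(k+1) F\<close>, which is
  symmetric in \<open>y_(k+1)\<close> and \<open>y_(k+2)\<close> because \<open>F\<close> contains
  neither.\<close>

lemma opT_opdplus_opdplus:
  assumes "F \<in> V k"
  shows "opT 1 (opdplus (Suc k) (opdplus k F)) = opdplus (Suc k) (opdplus k F)"
proof -
  let ?F = "theta (Suc (Suc k)) (theta (Suc k) F)"
  have eq: "opdplus (Suc k) (opdplus k F) = Tprod opT (Suc k) (Tprod opT k ?F)"
    by (simp add: opdplus_eq theta_Tprod)
  have "swap_y (Suc k) F = F"
    using assms unfolding V_eq_ypoly by (intro swap_y_fixed) (auto elim!: ypoly_mono[rotated])
  then have "swap_y (Suc k) ?F = ?F"
    by (simp add: swap_y_theta theta_commute[of "Suc (Suc k)" "Suc k"])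
  then show ?thesis
    unfolding eq opT.Tprod_Tprod_T[of k "Suc (Suc k)", OF lessI] by (simp add: opT_fixed)
qed

lemma opdplus_opdminus_commutator:
  assumes "F \<in> V (Suc l)"
  shows "opdplus l (opdminus (Suc l) F) - opdminus (Suc (Suc l)) (opdplus (Suc l) F) =
    of_qt (qq - 1) * Tprod opT l (yvar (Suc l) * F)"
proof -
  have "opdminus (Suc (Suc l)) (opdplus (Suc l) F) =
      Tprod opT l (opdminus (Suc (Suc l)) (opT (Suc l) (theta (Suc (Suc l)) F)))"
    unfolding opdplus_eq Tprod_Suc by (rule Tprod_commute) (simp add: opT_opdminus)
  then have "opdplus l (opdminus (Suc l) F) - opdminus (Suc (Suc l)) (opdplus (Suc l) F) =
      Tprod opT l (theta (Suc l) (opdminus (Suc l) F) -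
        opdminus (Suc (Suc l)) (opT (Suc l) (theta (Suc (Suc l)) F)))"
    by (simp add: opdplus_eq Tprod_opT_linear)
  also have "theta (Suc l) (opdminus (Suc l) F) -
        opdminus (Suc (Suc l)) (opT (Suc l) (theta (Suc (Suc l)) F)) = of_qt (qq - 1) * yvar (Suc l) * F"
    using assms unfolding V_eq_ypoly by (intro theta_opdminus) (auto elim!: ypoly_mono[rotated])
  finally show ?thesis by (simp add: Tprod_opT_linear mult.assoc)
qed

lemma Tprod_opT_yvar: "k < j \<Longrightarrow> yvar (Suc j) * Tprod opT k F = Tprod opT k (yvar (Suc j) * F)"
  by (rule Tprod_commute) (simp add: opT_yvar_other)

text \<open>The commutator formula applies to both sides; the last factor of the braid product then
  forms \<open>T_(l+1) y_(l+2) T_(l+1) = q y_(l+1)\<close>. The companion for \<open>d_+\<close>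
  rests on the same rule.\<close>

lemma opdminus_commutator:
  assumes "F \<in> V (Suc (Suc l))"
  shows "opdminus (Suc (Suc l)) (opdplus (Suc l) (opdminus (Suc (Suc l)) (opT (Suc l) F)) -
      opdminus (Suc (Suc (Suc l))) (opdplus (Suc (Suc l)) (opT (Suc l) F))) =
    of_qt qq * (opdplus l (opdminus (Suc l) (opdminus (Suc (Suc l)) F)) -
      opdminus (Suc (Suc l)) (opdplus (Suc l) (opdminus (Suc (Suc l)) F)))"
proof -
  have 1: "opT (Suc l) F \<in> V (Suc (Suc l))" using assms by (intro opT_V) auto
  have 2: "opdminus (Suc (Suc l)) F \<in> V (Suc l)" using assms by (rule opdminus_V)
  have "opdminus (Suc (Suc l)) (Tprod opT (Suc l) (yvar (Suc (Suc l)) * opT (Suc l) F)) =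
      Tprod opT l (opdminus (Suc (Suc l)) (of_qt qq * (yvar (Suc l) * F)))"
    unfolding Tprod_Suc opT_yvar_Suc_opT mult.assoc by (rule Tprod_commute) (simp add: opT_opdminus)
  then show ?thesis
    unfolding opdplus_opdminus_commutator[OF 1] opdplus_opdminus_commutator[OF 2]
    by (simp add: opdminus_of_qt opdminus_yvar Tprod_opT_linear mult.left_commute)
qed

lemma commutator_opdplus:
  assumes "F \<in> V (Suc l)"
  shows "opT 1 (opdplus (Suc l) (opdminus (Suc (Suc l)) (opdplus (Suc l) F)) -
      opdminus (Suc (Suc (Suc l))) (opdplus (Suc (Suc l)) (opdplus (Suc l) F))) =
    of_qt qq * opdplus (Suc l) (opdplus l (opdminus (Suc l) F) -
      opdminus (Suc (Suc l)) (opdplus (Suc l) F))"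
proof -
  let ?F = "theta (Suc (Suc l)) F"
  have 1: "opdplus (Suc l) F \<in> V (Suc (Suc l))" using assms by (rule opdplus_V)
  have "opT 1 (Tprod opT (Suc l) (yvar (Suc (Suc l)) * opdplus (Suc l) F)) =
      opT 1 (Tprod opT (Suc l) (Tprod opT l (yvar (Suc (Suc l)) * opT (Suc l) ?F)))"
    by (simp add: opdplus_eq Tprod_Suc Tprod_opT_yvar)
  also have "\<dots> = Tprod opT (Suc l) (Tprod opT l (of_qt qq * yvar (Suc l) * ?F))"
    unfolding opT.Tprod_Tprod_T[of l "Suc (Suc l)", OF lessI] opT_yvar_Suc_opT ..
  also have "\<dots> = of_qt qq * Tprod opT (Suc l) (theta (Suc (Suc l)) (Tprod opT l (yvar (Suc l) * F)))"
    by (simp add: theta_Tprod theta_simps mult.assoc Tprod_opT_linear)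
  finally show ?thesis
    unfolding opdplus_opdminus_commutator[OF 1] opdplus_opdminus_commutator[OF assms]
    by (simp add: opdplus_of_qt opT_linear mult.left_commute flip: opdplus_eq)
qed

subsection \<open>The action of the path algebra\<close>

type_synonym vstar = "nat \<Rightarrow>\<^sub>0 symy"

text \<open>Multiplication of \<open>vstar\<close> adds the vertex indices, so an element at index 0
  scales every component; scaling thus becomes a ring product, as \<open>pm_lift\<close>
  requires.\<close>

definition vconst :: "qt \<Rightarrow> vstar" where
  "vconst c = Poly_Mapping.single 0 (of_qt c)"

lemma ring_map_vconst: "ring_map vconst"
  unfolding vconst_def by (rule ring_mapI) (simp_all add: of_qt_simps single_add mult_single)

lemma scaleV_eq: "scaleV c v = vconst c * v"
  by (simp add: scaleV_def vconst_def mult_map_scale_conv_mult)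

lemma lookup_scaleV: "Poly_Mapping.lookup (vconst c * v) k = of_qt c * Poly_Mapping.lookup v k"
  by (simp add: scaleV_def map.rep_eq when_def flip: scaleV_eq)

lemma inV_simps:
  "inV k F + inV k G = inV k (F + G)" "inV k F - inV k G = inV k (F - G)"
  "vconst c * inV k F = inV k (of_qt c * F)" "inV k 0 = 0"
  by (simp_all add: inV_def single_add single_diff vconst_def mult_single)

lemma lookup_inV [simp]: "Poly_Mapping.lookup (inV k F) j = (if j = k then F else 0)"
  by (simp add: inV_def lookup_single when_def)

lemma V_0: "0 \<in> V k" and V_add: "F \<in> V k \<Longrightarrow> G \<in> V k \<Longrightarrow> F + G \<in> V k"
  and V_of_qt: "F \<in> V k \<Longrightarrow> of_qt c * F \<in> V k"
  by (simp_all add: V_eq_ypoly ypoly_intros)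

lemma inV_Vstar: "F \<in> V k \<Longrightarrow> inV k F \<in> Vstar"
  by (simp add: Vstar_def V_0)

lemma lookup_Vstar: "v \<in> Vstar \<Longrightarrow> Poly_Mapping.lookup v k \<in> V k"
  by (simp add: Vstar_def)

fun act_arrow :: "arrow \<Rightarrow> vstar \<Rightarrow> vstar" where
  "act_arrow (Dplus k) v = inV (k + 1) (opdplus k (Poly_Mapping.lookup v k))"
| "act_arrow (Dminus k) v = inV (k - 1) (opdminus k (Poly_Mapping.lookup v k))"
| "act_arrow (Loop i k) v = inV k (opT i (Poly_Mapping.lookup v k))"

lemma act_arrow_linear:
  "act_arrow a (v + w) = act_arrow a v + act_arrow a w"
  "act_arrow a (vconst c * v) = vconst c * act_arrow a v"
  "act_arrow a 0 = 0"
  by (cases a; simp add: lookup_add lookup_scaleV inV_simps opdplus_add opdminus_add opT_add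
      opdplus_of_qt opdminus_of_qt opT_of_qt)+

lemma act_arrow_inV: "act_arrow a (inV (arrow_src a) (Poly_Mapping.lookup v (arrow_src a))) = act_arrow a v"
  by (cases a) simp_all

lemma act_arrow_Vstar: "is_arrow a \<Longrightarrow> v \<in> Vstar \<Longrightarrow> act_arrow a v \<in> Vstar"
proof (cases a)
  case (Dminus k)
  assume "is_arrow a" "v \<in> Vstar"
  then obtain l where "k = Suc l" using Dminus by (cases k) auto
  then show ?thesis
    using \<open>v \<in> Vstar\<close> Dminus by (auto intro!: inV_Vstar opdminus_V lookup_Vstar)
qed (auto intro!: inV_Vstar opdplus_V opT_V lookup_Vstar)

text \<open>The projection to the initial vertex is applied first, so that empty paths act as
  idempotents and paths that do not fit together compose to zero.\<close>

fun act_list :: "nat \<times> arrow list \<Rightarrow> vstar \<Rightarrow> vstar" where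
  "act_list (k, as) v = foldr act_arrow as (inV k (Poly_Mapping.lookup v k))"

declare act_list.simps [simp del]

lemma act_list_Nil: "act_list (k, []) v = inV k (Poly_Mapping.lookup v k)"
  and act_list_Cons: "act_list (k, a # as) v = act_arrow a (act_list (k, as) v)"
  by (simp_all add: act_list.simps)

lemma act_list_linear:
  "act_list p (v + w) = act_list p v + act_list p w"
  "act_list p (vconst c * v) = vconst c * act_list p v"
  "act_list p 0 = 0"
proof -
  obtain k as where p: "p = (k, as)" by fastforce
  show "act_list p (v + w) = act_list p v + act_list p w"
    unfolding p by (induction as) (simp_all add: act_list_Nil act_list_Cons act_arrow_linear lookup_add inV_simps)
  show "act_list p (vconst c * v) = vconst c * act_list p v"
    unfolding p by (induction as) (simp_all add: act_list_Nil act_list_Cons act_arrow_linear lookup_scaleV inV_simps)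
  show "act_list p 0 = 0"
    unfolding p by (induction as) (simp_all add: act_list_Nil act_list_Cons act_arrow_linear inV_simps)
qed

lemma act_list_Vstar:
  assumes "is_path p" "v \<in> Vstar"
  shows "act_list p v \<in> Vstar"
proof -
  obtain k as where p: "p = (k, as)" by fastforce
  show ?thesis
    using assms unfolding p
    by (induction as) (simp_all add: act_list_Nil act_list_Cons act_arrow_Vstar inV_Vstar lookup_Vstar)
qed

lemma act_list_tgt: "act_list r v = inV (list_tgt r) (Poly_Mapping.lookup (act_list r v) (list_tgt r))"
proof -
  obtain k as where r: "r = (k, as)" by fastforce
  show ?thesis
  proof (cases as)
    case (Cons a bs)
    then show ?thesis by (cases a) (simp_all add: r act_list_Cons)
  qed (simp add: r act_list_Nil)
qed

lemma act_list_append: "act_list (list_tgt (l, bs), as) (act_list (l, bs) v) = act_list (l, as @ bs) v"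
proof (induction as)
  case Nil
  show ?case using act_list_tgt[of "(l, bs)" v] by (simp add: act_list_Nil)
qed (simp add: act_list_Cons)

lemma act_list_mismatch: "k \<noteq> list_tgt r \<Longrightarrow> act_list (k, as) (act_list r v) = 0"
proof (induction as)
  case Nil
  then show ?case by (subst act_list_tgt[of r]) (simp add: act_list_Nil inV_simps)
qed (simp add: act_list_Cons act_arrow_linear)

definition act_path :: "path \<Rightarrow> vstar \<Rightarrow> vstar" where
  "act_path p = act_list (Rep_path p)"

lemmas act_path_linear = act_list_linear[where p = "Rep_path p" for p, folded act_path_def]

lemma act_path_comp:
  "act_path p (act_path r v) = (case path_comp p r of None \<Rightarrow> 0 | Some s \<Rightarrow> act_path s v)"
proof (cases "path_comp p r")
  case None
  then have "fst (Rep_path p) \<noteq> list_tgt (Rep_path r)"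
    by transfer (auto split: if_splits)
  then show ?thesis
    using act_list_mismatch[of "fst (Rep_path p)" "Rep_path r" "snd (Rep_path p)"] None
    by (simp add: act_path_def)
next
  case (Some s)
  then have "fst (Rep_path p) = list_tgt (Rep_path r)"
    "Rep_path s = (fst (Rep_path r), snd (Rep_path p) @ snd (Rep_path r))"
    by (transfer; auto split: if_splits)+
  then show ?thesis
    using act_list_append[of "fst (Rep_path r)" "snd (Rep_path r)" "snd (Rep_path p)" v] Some
    by (metis act_path_def option.simps(5) prod.collapse)
qed

definition mact :: "(path \<Rightarrow>\<^sub>0 qt) \<Rightarrow> vstar \<Rightarrow> vstar" where
  "mact f v = pm_lift vconst (\<lambda>p. act_path p v) f"

lemma mact_add_left: "mact (f + g) v = mact f v + mact g v"
  unfolding mact_def by (rule pm_lift_add) (simp_all add: ring_mapD[OF ring_map_vconst])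

lemma mact_single: "mact (Poly_Mapping.single p c) v = vconst c * act_path p v"
  unfolding mact_def by (rule pm_lift_single) (simp add: ring_mapD[OF ring_map_vconst])

lemma mact_0_left [simp]: "mact 0 v = 0"
  by (simp add: mact_def)

lemma mact_linear: "mact f (v + w) = mact f v + mact f w" "mact f (vconst c * v) = vconst c * mact f v"
  by (induction f rule: pm_induct)
    (simp_all add: mact_add_left mact_single act_path_linear distrib_left mult.left_commute)

lemma mact_mult: "mact (path_mult f g) v = mact f (mact g v)"
proof (induction f rule: pm_induct)
  case (add f f')
  then show ?case by (simp add: path_mult_add_left mact_add_left)
next
  case (single p c)
  show ?case
  proof (induction g rule: pm_induct)
    case (add g g')
    then show ?case by (simp add: path_mult_add_right mact_add_left mact_linear)
  next
    case (single r d)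
    show ?case
      by (simp add: path_mult_single basis_mult_def mact_single act_path_linear act_path_comp
          ring_mapD[OF ring_map_vconst] mult.assoc split: option.split)
  qed
qed

lemma mact_scale: "mact (Poly_Mapping.map ((*) c) f) v = vconst c * mact f v"
proof (induction f rule: pm_induct)
  case (add f g)
  have "Poly_Mapping.map ((*) c) (f + g) = Poly_Mapping.map ((*) c) f + Poly_Mapping.map ((*) c) g"
    by (rule poly_mapping_eqI) (simp add: lookup_scale lookup_add distrib_left)
  then show ?case by (simp add: add mact_add_left distrib_left)
next
  case (single p d)
  have "Poly_Mapping.map ((*) c) (Poly_Mapping.single p d) = Poly_Mapping.single p (c * d)"
    by (rule poly_mapping_eqI) (simp add: lookup_scale lookup_single when_def)
  then show ?case by (simp add: mact_single ring_mapD[OF ring_map_vconst] mult.assoc)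
qed

section \<open>The action on path algebra elements and its compatibility with the relations\<close>

definition pact :: "pathalg \<Rightarrow> vstar \<Rightarrow> vstar" where
  "pact x = mact (Rep_pathalg x)"

lemma pact_add: "pact (x + y) v = pact x v + pact y v"
  by (simp add: pact_def plus_pathalg.rep_eq mact_add_left)

lemma pact_0 [simp]: "pact 0 v = 0"
  by (simp add: pact_def zero_pathalg.rep_eq)

lemma pact_scale: "pact (path_scale c x) v = vconst c * pact x v"
  by (simp add: pact_def path_scale.rep_eq mact_scale)

lemma pact_diff: "pact (x - y) v = pact x v - pact y v"
  using pact_add[of "x - y" y v] by simp

lemma pact_mult: "pact (x * y) v = pact x (pact y v)"
  by (simp add: pact_def times_pathalg.rep_eq mact_mult)

lemma pact_linear: "pact x (v + w) = pact x v + pact x w" "pact x (vconst c * v) = vconst c * pact x v"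
  by (simp_all add: pact_def mact_linear)

lemma pact_0_right [simp]: "pact x 0 = 0"
  using pact_linear(1)[of x 0 0] by simp

lemma pathalg_induct [case_names add basis]:
  assumes "\<And>x y. P x \<Longrightarrow> P y \<Longrightarrow> P (x + y)" "\<And>c p. P (path_scale c (path_basis p))"
  shows "P x"
proof -
  have "P (Abs_pathalg f)" for f
  proof (induction f rule: pm_induct)
    case (add f g)
    have "Abs_pathalg (f + g) = Abs_pathalg f + Abs_pathalg g"
      by (rule Rep_pathalg_inject[THEN iffD1]) (simp add: plus_pathalg.rep_eq Abs_pathalg_inverse)
    then show ?case using add assms(1) by simp
  next
    case (single p c)
    have "Poly_Mapping.map ((*) c) (Poly_Mapping.single p 1) = Poly_Mapping.single p c"
      by (rule poly_mapping_eqI) (simp add: lookup_scale lookup_single when_def)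
    then have "Abs_pathalg (Poly_Mapping.single p c) = path_scale c (path_basis p)"
      by (intro Rep_pathalg_inject[THEN iffD1])
        (simp add: path_scale.rep_eq path_basis_def Abs_pathalg_inverse)
    then show ?case using assms(2) by simp
  qed
  then show ?thesis by (metis Rep_pathalg_inverse)
qed

lemma pact_path_basis: "pact (path_basis p) v = act_path p v"
  by (simp add: pact_def path_basis_def Abs_pathalg_inverse mact_single ring_mapD[OF ring_map_vconst])

lemma pact_pe: "pact (pe k) v = inV k (Poly_Mapping.lookup v k)"
  by (simp add: pe_def pact_path_basis act_path_def Abs_path_inverse act_list_Nil)

lemma pact_arrow: "is_arrow a \<Longrightarrow> pact (arrow_elem a) v = act_arrow a v"
  by (simp add: arrow_elem_def pact_path_basis act_path_def Abs_path_inverse act_list_Nil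
      act_list_Cons act_arrow_inV)

lemma vconst_Vstar: "v \<in> Vstar \<Longrightarrow> vconst c * v \<in> Vstar"
  by (simp add: Vstar_def lookup_scaleV V_of_qt)

lemma Vstar_add: "v \<in> Vstar \<Longrightarrow> w \<in> Vstar \<Longrightarrow> v + w \<in> Vstar"
  by (simp add: Vstar_def lookup_add V_add)

lemma pact_Vstar: "v \<in> Vstar \<Longrightarrow> pact x v \<in> Vstar"
proof (induction x rule: pathalg_induct)
  case (basis c p)
  then show ?case
    using Rep_path[of p]
    by (auto simp: pact_scale pact_path_basis act_path_def intro!: vconst_Vstar act_list_Vstar)
qed (simp add: pact_add Vstar_add)

text \<open>Restricted to \<open>Vstar\<close>, because \<open>T_1 d_+^2 = d_+^2\<close> and the two
  commutator relations are derived for polynomials without variables beyond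
  \<open>y_k\<close>.\<close>

lemma pact_dyck_rel:
  assumes "dyck_rel x y" and v: "v \<in> Vstar"
  shows "pact x v = pact y v"
  using assms(1)
proof cases
  case (quadratic i k)
  from quadratic(3,4) have "pact ((pT i k - pe k) * (pT i k + path_scale qq (pe k))) v = 0"
    by (simp add: pact_mult pact_diff pact_add pact_scale pact_pe pact_arrow inV_simps opT_linear
        opT_quadratic) (simp add: of_qt_simps algebra_simps inV_simps)
  then show ?thesis by (simp only: quadratic(1,2) pact_0)
next
  case (braid i k)
  then show ?thesis by (simp add: pact_mult pact_arrow opT_braid)
next
  case (commute i k j)
  then show ?thesis
    using opT_commute[of i j "Poly_Mapping.lookup v k"] opT_commute[of j i "Poly_Mapping.lookup v k"]
    by (auto simp: pact_mult pact_arrow)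
next
  case (T_dminus i k)
  then show ?thesis by (simp add: pact_mult pact_arrow opT_opdminus)
next
  case (dplus_T i k)
  then show ?thesis by (simp add: pact_mult pact_arrow opdplus_opT)
next
  case (T_dplus_dplus k)
  then show ?thesis
    using opT_opdplus_opdplus[OF lookup_Vstar[OF v], of k] by (simp add: pact_mult pact_arrow)
next
  case (dminus_dminus_T k)
  then show ?thesis
    using opdminus_opdminus_opT[of "k - 1"] by (simp add: pact_mult pact_arrow)
next
  case (dminus_commutator k)
  then obtain l where "k = Suc (Suc l)" by (metis add_2_eq_Suc le_Suc_ex)
  then show ?thesis
    using opdminus_commutator[OF lookup_Vstar[OF v], of l] dminus_commutator
    by (simp add: pact_mult pact_arrow pact_diff pact_scale inV_simps)
next
  case (commutator_dplus k)
  then obtain l where "k = Suc l" by (cases k) auto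
  then show ?thesis
    using commutator_opdplus[OF lookup_Vstar[OF v], of l] commutator_dplus
    by (simp add: pact_mult pact_arrow pact_diff pact_scale inV_simps)
qed

lemma pact_dyck_ideal: "x \<in> dyck_ideal \<Longrightarrow> v \<in> Vstar \<Longrightarrow> pact x v = 0"
  by (induction x arbitrary: v rule: dyck_ideal.induct)
    (simp_all add: pact_diff pact_dyck_rel pact_add pact_scale pact_mult pact_Vstar)

subsection \<open>The representation of the Dyck path algebra\<close>

text \<open>Goes through a chosen representative, because the ideal is shown to act by zero on
  \<open>Vstar\<close> only and not on all of \<open>vstar\<close>.\<close>

definition dyck_act :: "dyck \<Rightarrow> vstar \<Rightarrow> vstar" where
  "dyck_act a = pact (rep_dyck a)"

lemma dyck_act_abs: "v \<in> Vstar \<Longrightarrow> dyck_act (abs_dyck x) v = pact x v"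
proof -
  assume v: "v \<in> Vstar"
  have "dyck_eq x x" by (simp add: dyck_eq_def dyck_ideal.zero)
  then have "dyck_eq (rep_dyck (abs_dyck x)) x"
    by (rule Quotient3_rep_abs[OF Quotient3_dyck])
  then have "pact (rep_dyck (abs_dyck x) - x) v = 0"
    unfolding dyck_eq_def using v by (rule pact_dyck_ideal)
  then show ?thesis by (simp add: dyck_act_def pact_diff)
qed

lemma dyck_act_linear: "dyck_act a (v + w) = dyck_act a v + dyck_act a w"
  "dyck_act a (vconst c * v) = vconst c * dyck_act a v"
  by (simp_all add: dyck_act_def pact_linear)

lemma dyck_act_Vstar: "v \<in> Vstar \<Longrightarrow> dyck_act a v \<in> Vstar"
  by (simp add: dyck_act_def pact_Vstar)

lemma dyck_act_simps:
  assumes v: "v \<in> Vstar"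
  shows "dyck_act (a + b) v = dyck_act a v + dyck_act b v"
    "dyck_act (dyck_scale c a) v = vconst c * dyck_act a v"
    "dyck_act (a * b) v = dyck_act a (dyck_act b v)"
proof -
  show "dyck_act (a + b) v = dyck_act a v + dyck_act b v"
    by (induction a rule: dyck.abs_induct, induction b rule: dyck.abs_induct)
      (simp add: plus_dyck.abs_eq dyck_act_abs v pact_add)
  show "dyck_act (dyck_scale c a) v = vconst c * dyck_act a v"
    by (induction a rule: dyck.abs_induct) (simp add: dyck_scale.abs_eq dyck_act_abs v pact_scale)
  show "dyck_act (a * b) v = dyck_act a (dyck_act b v)"
    by (induction a rule: dyck.abs_induct, induction b rule: dyck.abs_induct)
      (simp add: times_dyck.abs_eq dyck_act_abs v pact_mult pact_Vstar)
qed

lemma dyck_act_generators: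
  assumes "v \<in> Vstar"
  shows "dyck_act (dyck_e k) v = inV k (Poly_Mapping.lookup v k)"
    "dyck_act (dyck_dplus k) v = inV (Suc k) (opdplus k (Poly_Mapping.lookup v k))"
    "1 \<le> k \<Longrightarrow> dyck_act (dyck_dminus k) v = inV (k - 1) (opdminus k (Poly_Mapping.lookup v k))"
    "1 \<le> i \<Longrightarrow> i < k \<Longrightarrow> dyck_act (dyck_T i k) v = inV k (opT i (Poly_Mapping.lookup v k))"
  by (simp_all add: dyck_e.abs_eq dyck_dplus.abs_eq dyck_dminus.abs_eq dyck_T.abs_eq dyck_act_abs
      assms pact_pe pact_arrow)

lemma acts_by_operators_dyck_act: "acts_by_operators dyck_act"
  by (simp add: acts_by_operators_def dyck_act_generators)

lemma dyck_representation_dyck_act: "dyck_representation Vstar scaleV dyck_act"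
  by (simp add: dyck_representation_def linear_map_on_def scaleV_eq dyck_act_simps dyck_act_linear
      dyck_act_Vstar)

lemma dyck_scale_mult:
  "dyck_scale c x * y = dyck_scale c (x * y)" "x * dyck_scale c y = dyck_scale c (x * y)"
proof -
  have eq: "dyck_eq x y" if "x = y" for x y
    using that by (simp add: dyck_eq_def dyck_ideal.zero)
  show "dyck_scale c x * y = dyck_scale c (x * y)" "x * dyck_scale c y = dyck_scale c (x * y)"
    by (transfer fixing: c, rule eq, simp add: path_scale_mult)+
qed

lemma dyck_representation_Ae0: "dyck_representation Ae0 dyck_scale (*)"
proof -
  have "a * (b * dyck_e 0) \<in> Ae0" for a b
    unfolding Ae0_def mult.assoc[symmetric] by blast
  then show ?thesis
    by (auto simp: dyck_representation_def linear_map_on_def Ae0_def distrib_left distrib_right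
        dyck_scale_mult mult.assoc)
qed

lemma qq_neq: "qq \<noteq> 0" "qq \<noteq> 1" "qq - 1 \<noteq> 0"
  by (auto simp: qq_def Zero_fract_def One_fract_def eq_fract one_pCons)

subsection \<open>Relations in the Dyck path algebra\<close>

abbreviation (input) "de \<equiv> dyck_e"
abbreviation (input) "dp \<equiv> dyck_dplus"
abbreviation (input) "dm \<equiv> dyck_dminus"
abbreviation (input) "dT \<equiv> dyck_T"
abbreviation (input) "sc \<equiv> dyck_scale"

lemma path_basis_mult:
  "path_basis p * path_basis r = (case path_comp p r of None \<Rightarrow> 0 | Some s \<Rightarrow> path_basis s)"
proof (rule Rep_pathalg_inject[THEN iffD1])
  show "Rep_pathalg (path_basis p * path_basis r) =
      Rep_pathalg (case path_comp p r of None \<Rightarrow> 0 | Some s \<Rightarrow> path_basis s)"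
    by (simp add: times_pathalg.rep_eq path_basis_def Abs_pathalg_inverse path_mult_single
        basis_mult_def zero_pathalg.rep_eq split: option.split)
qed

lemma path_comp_Abs:
  assumes "is_path p" "is_path r"
  shows "path_comp (Abs_path p) (Abs_path r) =
    (if fst p = list_tgt r then Some (Abs_path (fst r, snd p @ snd r)) else None)"
  using assms by (simp add: path_comp.abs_eq eq_onp_def)

lemma pe_mult: "pe k * path_basis p = (if k = list_tgt (Rep_path p) then path_basis p else 0)"
  using path_comp_Abs[of "(k, [])" "Rep_path p"] Rep_path[of p]
  by (simp add: pe_def path_basis_mult Rep_path_inverse)

lemma mult_pe: "path_basis p * pe k = (if k = fst (Rep_path p) then path_basis p else 0)"
  using path_comp_Abs[of "Rep_path p" "(k, [])"] Rep_path[of p]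
  by (auto simp: pe_def path_basis_mult Rep_path_inverse prod.collapse)

lemma pe_arrow_elem:
  "pe (arrow_tgt a) * arrow_elem a = arrow_elem a" "arrow_elem a * pe (arrow_src a) = arrow_elem a"
  by (simp_all add: arrow_elem_def pe_mult mult_pe Abs_path_inverse)

lemma path_basis_Cons:
  assumes "is_path (k, a # as)"
  shows "path_basis (Abs_path (k, a # as)) = arrow_elem a * path_basis (Abs_path (k, as))"
  using assms by (simp add: arrow_elem_def path_basis_mult path_comp_Abs)

lemma de_units [simp]:
  "de k * de k = de k" "de k * dT i k = dT i k" "dT i k * de k = dT i k"
  "de (Suc k) * dp k = dp k" "dp k * de k = dp k" "dm k * de k = dm k"
  "de k * dm (Suc k) = dm (Suc k)"
proof -
  have "pe k * pe k = pe k"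
    using pe_mult[of k "Abs_path (k, [])"] by (simp add: Abs_path_inverse flip: pe_def)
  then show "de k * de k = de k" by (simp add: dyck_e.abs_eq times_dyck.abs_eq)
qed (use pe_arrow_elem[of "Loop i k"] pe_arrow_elem[of "Dplus k"] pe_arrow_elem[of "Dminus k"]
    pe_arrow_elem[of "Dminus (Suc k)"] in
    \<open>simp_all add: dyck_e.abs_eq dyck_T.abs_eq dyck_dplus.abs_eq dyck_dminus.abs_eq times_dyck.abs_eq\<close>)

lemma dyck_rel_eq: "dyck_rel x y \<Longrightarrow> abs_dyck x = abs_dyck y"
  using Quotient3_rel_abs[OF Quotient3_dyck, of x y] dyck_ideal.rel by (simp add: dyck_eq_def)

lemmas dyck_abs_simps = dyck_e.abs_eq dyck_T.abs_eq dyck_dplus.abs_eq dyck_dminus.abs_eq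
  times_dyck.abs_eq minus_dyck.abs_eq plus_dyck.abs_eq dyck_scale.abs_eq zero_dyck.abs_eq

lemma dT_quadratic:
  assumes "1 \<le> i" "i < k"
  shows "dT i k * dT i k = sc qq (de k) - sc (qq - 1) (dT i k)"
proof -
  have "(dT i k - de k) * (dT i k + sc qq (de k)) = 0"
    using dyck_rel_eq[OF dyck_rel.quadratic[OF assms]] by (simp add: dyck_abs_simps)
  then show ?thesis
    by (simp add: algebra_simps dyck_scale_mult dyck.scale_left_diff_distrib)
qed

text \<open>The relations are stated as equalities of left multiplications, so that they apply to products
  associated to the right.\<close>

lemma dT_dT: "1 \<le> i \<Longrightarrow> i < k \<Longrightarrow> dT i k * (dT i k * x) = sc qq (de k * x) - sc (qq - 1) (dT i k * x)"
  by (simp add: dT_quadratic left_diff_distrib dyck_scale_mult flip: mult.assoc)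

lemma dT_braid:
  assumes "1 \<le> i" "Suc i < k"
  shows "dT i k * (dT (Suc i) k * (dT i k * x)) = dT (Suc i) k * (dT i k * (dT (Suc i) k * x))"
  using dyck_rel_eq[OF dyck_rel.braid[of i k]] assms
  by (simp add: dyck_abs_simps[symmetric] flip: mult.assoc)

lemma dT_far:
  assumes "1 \<le> i" "Suc i < j" "j < k"
  shows "dT i k * (dT j k * x) = dT j k * (dT i k * x)"
  using dyck_rel_eq[OF dyck_rel.commute[of i k j]] assms
  by (simp add: dyck_abs_simps[symmetric] flip: mult.assoc)

lemma dT_dm:
  assumes "1 \<le> i" "i < k"
  shows "dT i k * (dm (Suc k) * x) = dm (Suc k) * (dT i (Suc k) * x)"
  using dyck_rel_eq[OF dyck_rel.T_dminus[of i "Suc k"]] assms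
  by (simp add: dyck_abs_simps[symmetric] flip: mult.assoc)

lemma dp_dT:
  assumes "1 \<le> i" "i < k"
  shows "dp k * (dT i k * x) = dT (Suc i) (Suc k) * (dp k * x)"
  using dyck_rel_eq[OF dyck_rel.dplus_T[of i k]] assms
  by (simp add: dyck_abs_simps[symmetric] flip: mult.assoc)

lemma dT_dp_dp: "dT 1 (Suc (Suc k)) * (dp (Suc k) * (dp k * x)) = dp (Suc k) * (dp k * x)"
  using dyck_rel_eq[OF dyck_rel.T_dplus_dplus[of k]]
  by (simp add: dyck_abs_simps[symmetric] flip: mult.assoc)

lemma dm_dm_dT:
  "dm (Suc k) * (dm (Suc (Suc k)) * (dT (Suc k) (Suc (Suc k)) * x)) = dm (Suc k) * (dm (Suc (Suc k)) * x)"
  using dyck_rel_eq[OF dyck_rel.dminus_dminus_T[of "Suc (Suc k)"]]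
  by (simp add: dyck_abs_simps[symmetric] flip: mult.assoc)

definition dcomm :: "nat \<Rightarrow> dyck" where
  "dcomm k = dp (k - 1) * dm k - dm (k + 1) * dp k"

lemma dm_dcomm_dT:
  "dm (Suc (Suc k)) * (dcomm (Suc (Suc k)) * (dT (Suc k) (Suc (Suc k)) * x)) =
    sc qq (dcomm (Suc k) * (dm (Suc (Suc k)) * x))"
  using dyck_rel_eq[OF dyck_rel.dminus_commutator[of "Suc (Suc k)"]]
  by (simp add: dyck_abs_simps[symmetric] dcomm_def flip: mult.assoc dyck_scale_mult(1))

lemma dT_dcomm_dp:
  "dT 1 (Suc (Suc k)) * (dcomm (Suc (Suc k)) * (dp (Suc k) * x)) =
    sc qq (dp (Suc k) * (dcomm (Suc k) * x))"
  using dyck_rel_eq[OF dyck_rel.commutator_dplus[of "Suc k"]]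
  by (simp add: dyck_abs_simps[symmetric] dcomm_def flip: mult.assoc dyck_scale_mult(1))

text \<open>The inverse of \<open>T_i\<close>, read off from
  \<open>T_i^2 + (q-1) T_i = q e_k\<close>.\<close>

definition dTi :: "nat \<Rightarrow> nat \<Rightarrow> dyck" where
  "dTi i k = sc (1 / qq) (dT i k + sc (qq - 1) (de k))"

lemma dTi_inverse:
  assumes "1 \<le> i" "i < k"
  shows "dTi i k * dT i k = de k" "dT i k * dTi i k = de k"
  using qq_neq
  by (simp_all add: dTi_def distrib_right distrib_left dyck_scale_mult dT_quadratic[OF assms]
      flip: dyck.scale_right_distrib)

lemma dTi_dT: "1 \<le> i \<Longrightarrow> i < k \<Longrightarrow> dTi i k * (dT i k * x) = de k * x"
  and dT_dTi: "1 \<le> i \<Longrightarrow> i < k \<Longrightarrow> dT i k * (dTi i k * x) = de k * x"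
  by (simp_all add: dTi_inverse flip: mult.assoc)

lemma dTi_units [simp]: "de k * dTi i k = dTi i k" "dTi i k * de k = dTi i k"
  by (simp_all add: dTi_def distrib_right distrib_left dyck_scale_mult)

lemma dcomm_units [simp]: "de (Suc k) * dcomm (Suc k) = dcomm (Suc k)" "dcomm k * de k = dcomm k"
  by (simp_all add: dcomm_def left_diff_distrib right_diff_distrib mult.assoc)
    (simp_all flip: mult.assoc)

text \<open>\<open>dW k n\<close> is \<open>T\<^sub>1 \<cdots> T\<^sub>k\<close> at the vertex \<open>n\<close>, and \<open>dR k n\<close> its inverse.\<close>

primrec dW :: "nat \<Rightarrow> nat \<Rightarrow> dyck" where
  "dW 0 n = de n"
| "dW (Suc k) n = dW k n * dT (Suc k) n"

primrec dR :: "nat \<Rightarrow> nat \<Rightarrow> dyck" where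
  "dR 0 n = de n"
| "dR (Suc k) n = dTi (Suc k) n * dR k n"

lemma dWR_units [simp]: "de n * dW k n = dW k n" "dW k n * de n = dW k n"
  "de n * dR k n = dR k n" "dR k n * de n = dR k n"
proof -
  show "de n * dW k n = dW k n" by (induction k) (simp_all flip: mult.assoc)
  show "dW k n * de n = dW k n" by (cases k) (simp_all add: mult.assoc)
  show "de n * dR k n = dR k n" by (cases k) (simp_all flip: mult.assoc)
  show "dR k n * de n = dR k n" by (induction k) (simp_all add: mult.assoc)
qed

lemma de_mult_left [simp]:
  "de k * (de k * x) = de k * x" "de k * (dT i k * x) = dT i k * x" "de k * (dTi i k * x) = dTi i k * x"
  "de (Suc k) * (dp k * x) = dp k * x" "de k * (dm (Suc k) * x) = dm (Suc k) * x"
  "de k * (dW l k * x) = dW l k * x" "de k * (dR l k * x) = dR l k * x"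
  "de (Suc k) * (dcomm (Suc k) * x) = dcomm (Suc k) * x"
  by (simp_all flip: mult.assoc)

lemma mult_de_left [simp]:
  "dT i k * (de k * x) = dT i k * x" "dTi i k * (de k * x) = dTi i k * x"
  "dp k * (de k * x) = dp k * x" "dm k * (de k * x) = dm k * x"
  "dW l k * (de k * x) = dW l k * x" "dR l k * (de k * x) = dR l k * x"
  "dcomm k * (de k * x) = dcomm k * x"
  by (simp_all flip: mult.assoc)

lemma dW_eq_Tprod: "dW k n * x = Tprod (\<lambda>i x. dT i n * x) k (de n * x)"
proof (induction k arbitrary: x)
  case (Suc k)
  have "dW (Suc k) n * x = dW k n * (dT (Suc k) n * x)" by (simp add: mult.assoc)
  also have "\<dots> = Tprod (\<lambda>i x. dT i n * x) k (de n * (dT (Suc k) n * x))" by (rule Suc)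
  finally show ?case by (simp only: Tprod_Suc de_mult_left mult_de_left)
qed simp

lemma braid_family_dT: "braid_family (\<lambda>i x. dT i n * x) n"
  by unfold_locales (simp_all add: dT_braid, rule dT_far, auto)

lemma dT_Suc_dW:
  "1 \<le> i \<Longrightarrow> i < k \<Longrightarrow> k < n \<Longrightarrow> dT (Suc i) n * (dW k n * x) = dW k n * (dT i n * x)"
  using braid_family.T_Suc_Tprod[OF braid_family_dT, of i k n "de n * x"]
  by (simp add: dW_eq_Tprod)

lemma dT_dW_dW:
  "Suc k < n \<Longrightarrow>
    dT 1 n * (dW (Suc k) n * (dW k n * x)) = dW (Suc k) n * (dW k n * (dT (Suc k) n * x))"
proof -
  let ?T = "\<lambda>i x. dT i n * x"
  assume "Suc k < n"
  moreover have "dW (Suc k) n * (dW k n * x) = Tprod ?T (Suc k) (Tprod ?T k (de n * x))" for x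
    by (simp only: dW_eq_Tprod[of "Suc k"] de_mult_left) (simp only: dW_eq_Tprod)
  ultimately show ?thesis
    using braid_family.Tprod_Tprod_T[OF braid_family_dT, of k n "de n * x"]
    by (simp only: de_mult_left mult_de_left)
qed

lemma dR_dW: "k < n \<Longrightarrow> dR k n * (dW k n * x) = de n * x"
  by (induction k arbitrary: x) (simp_all add: mult.assoc dTi_dT)

lemma dW_dR: "k < n \<Longrightarrow> dW k n * (dR k n * x) = de n * x"
  by (induction k arbitrary: x) (simp_all add: mult.assoc dT_dTi)

lemma dT_dR: "1 \<le> i \<Longrightarrow> i < k \<Longrightarrow> k < n \<Longrightarrow> dT i n * (dR k n * x) = dR k n * (dT (Suc i) n * x)"
proof -
  assume *: "1 \<le> i" "i < k" "k < n"
  have "dT i n * (dR k n * x) = dR k n * (dW k n * (dT i n * (dR k n * x)))"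
    using * by (simp add: dR_dW)
  also have "\<dots> = dR k n * (dT (Suc i) n * x)"
    using * by (simp add: dW_dR flip: dT_Suc_dW)
  finally show ?thesis .
qed

text \<open>\<open>d_+\<close> shifts the index of a loop by one and \<open>d_-\<close> preserves
  it, so both terms of the commutator shift it by one.\<close>

lemma dcomm_dT:
  assumes "1 \<le> i" "Suc i < k"
  shows "dT (Suc i) k * (dcomm k * x) = dcomm k * (dT i k * x)"
proof -
  obtain l where k: "k = Suc l" using assms by (cases k) auto
  have "dT (Suc i) (Suc l) * (dp l * (dm (Suc l) * x)) = dp l * (dm (Suc l) * (dT i (Suc l) * x))"
    using assms k by (simp add: dT_dm flip: dp_dT)
  moreover have "dT (Suc i) (Suc l) * (dm (Suc (Suc l)) * (dp (Suc l) * x)) =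
      dm (Suc (Suc l)) * (dp (Suc l) * (dT i (Suc l) * x))"
    using assms k by (simp add: dT_dm dp_dT)
  ultimately show ?thesis
    by (simp add: dcomm_def k left_diff_distrib right_diff_distrib mult.assoc)
qed

text \<open>\<open>dtheta k\<close> and \<open>dz k\<close> act on \<open>V\<^sub>k\<close> as \<open>F \<mapsto> F[X + (q-1) y\<^sub>k\<^sub>+\<^sub>1]\<close> and as multiplication by \<open>y\<^sub>k\<close>.\<close>

definition dtheta :: "nat \<Rightarrow> dyck" where
  "dtheta k = dR k (Suc k) * dp k"

definition dz :: "nat \<Rightarrow> dyck" where
  "dz k = sc (1 / (qq - 1)) (dR (k - 1) k * dcomm k)"

lemma dtheta_units [simp]: "de (Suc k) * dtheta k = dtheta k" "dtheta k * de k = dtheta k"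
  "de (Suc k) * (dtheta k * x) = dtheta k * x" "dtheta k * (de k * x) = dtheta k * x"
  by (simp_all add: dtheta_def mult.assoc)

lemma dz_units [simp]: "de k * dz k = dz k" "dz k * de k = dz k"
  "de k * (dz k * x) = dz k * x" "dz k * (de k * x) = dz k * x"
  by (simp_all add: dz_def mult.assoc dyck_scale_mult)

lemma dp_eq: "dp k * x = dW k (Suc k) * (dtheta k * x)"
  by (simp add: dtheta_def mult.assoc dW_dR)

lemma dcomm_eq: "dcomm (Suc k) * x = sc (qq - 1) (dW k (Suc k) * (dz (Suc k) * x))"
  using qq_neq by (simp add: dz_def mult.assoc dW_dR dyck_scale_mult)

lemma dtheta_dT:
  assumes "1 \<le> i" "i < k"
  shows "dtheta k * (dT i k * x) = dT i (Suc k) * (dtheta k * x)"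
  using assms by (simp add: dtheta_def mult.assoc dp_dT dT_dR)

lemma dz_dT:
  assumes "1 \<le> i" "Suc i < k"
  shows "dz k * (dT i k * x) = dT i k * (dz k * x)"
proof -
  obtain l where "k = Suc l" using assms by (cases k) auto
  then show ?thesis
    using assms by (simp add: dz_def mult.assoc dyck_scale_mult dT_dR flip: dcomm_dT)
qed

lemma dW_inject:
  assumes "k < n" "dW k n * x = dW k n * y" "de n * x = x" "de n * y = y"
  shows "x = y"
  using arg_cong[OF assms(2), of "\<lambda>x. dR k n * x"] assms(1,3,4) by (simp add: dR_dW)

lemma dz_dW: "Suc k < n \<Longrightarrow> dz n * (dW k n * x) = dW k n * (dz n * x)"
  by (induction k arbitrary: x) (simp_all add: mult.assoc dz_dT)

lemma dtheta_dW: "k < n \<Longrightarrow> dtheta n * (dW k n * x) = dW k (Suc n) * (dtheta n * x)"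
  by (induction k arbitrary: x) (simp_all add: mult.assoc dtheta_dT)

text \<open>Left multiplication by the invertible product of \<open>T_1 ... T_(k+1)\<close> and
  \<open>T_1 ... T_k\<close> turns the claim into \<open>dT_dcomm_dp\<close>: the outer loop comes
  to the front as \<open>T_1\<close>, and the braid products recombine with \<open>dz\<close> and
  \<open>dtheta\<close> into the commutator and \<open>d_+\<close>.\<close>

lemma dT_dz_dT_dtheta:
  "dT (Suc k) (Suc (Suc k)) * (dz (Suc (Suc k)) * (dT (Suc k) (Suc (Suc k)) * (dtheta (Suc k) * x))) =
    sc qq (dtheta (Suc k) * (dz (Suc k) * x))"
  (is "?l = ?r")
proof -
  let ?n = "Suc (Suc k)" and ?W = "\<lambda>x. dW (Suc k) (Suc (Suc k)) * (dW k (Suc (Suc k)) * x)"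
  have "?W ?l = dT 1 ?n * (?W (dz ?n * (dT (Suc k) ?n * (dtheta (Suc k) * x))))"
    by (rule dT_dW_dW[symmetric]) simp
  also have "\<dots> = dT 1 ?n * (dW (Suc k) ?n * (dz ?n * (dW (Suc k) ?n * (dtheta (Suc k) * x))))"
    by (simp add: dz_dW mult.assoc)
  also have "sc (qq - 1) \<dots> = dT 1 ?n * (dcomm ?n * (dp (Suc k) * x))"
    by (simp only: dcomm_eq dp_eq[of "Suc k"] dyck_scale_mult)
  also have "\<dots> = sc qq (dp (Suc k) * (dcomm (Suc k) * x))"
    by (rule dT_dcomm_dp)
  also have "\<dots> = sc (qq - 1) (?W ?r)"
    by (simp only: dcomm_eq dp_eq[of "Suc k"] dyck_scale_mult dtheta_dW[OF lessI] dyck.scale_scale mult.commute)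
  finally have "?W ?l = ?W ?r" using qq_neq by simp
  then have "dW k ?n * ?l = dW k ?n * ?r" by (rule dW_inject[rotated]) simp_all
  then show ?thesis by (rule dW_inject[rotated]) (simp_all add: dyck_scale_mult)
qed

lemma dm_dW: "k < n \<Longrightarrow> dm (Suc n) * (dW k (Suc n) * x) = dW k n * (dm (Suc n) * x)"
  by (induction k arbitrary: x) (simp_all add: mult.assoc dT_dm[symmetric])

text \<open>The relation \<open>dm_dcomm_dT\<close> with the braid products stripped off; divided by
  \<open>q\<close> it says that \<open>d_-\<close> carries \<open>y_(k+1)\<close> at vertex
  \<open>k + 2\<close> to \<open>y_(k+1)\<close> at vertex \<open>k + 1\<close>.\<close>

lemma dm_dT_dz_dT:
  "dm (Suc (Suc k)) * (dT (Suc k) (Suc (Suc k)) * (dz (Suc (Suc k)) * (dT (Suc k) (Suc (Suc k)) * x))) =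
    sc qq (dz (Suc k) * (dm (Suc (Suc k)) * x))"
  (is "?l = ?r")
proof -
  let ?n = "Suc (Suc k)"
  have "sc (qq - 1) (dW k (Suc k) * ?l) = dm ?n * (dcomm ?n * (dT (Suc k) ?n * x))"
    by (simp add: dcomm_eq dyck_scale_mult mult.assoc dm_dW)
  also have "\<dots> = sc qq (dcomm (Suc k) * (dm ?n * x))"
    by (rule dm_dcomm_dT)
  also have "\<dots> = sc (qq - 1) (dW k (Suc k) * ?r)"
    by (simp add: dcomm_eq dyck_scale_mult mult.commute)
  finally have "dW k (Suc k) * ?l = dW k (Suc k) * ?r" using qq_neq by simp
  then show ?thesis by (rule dW_inject[rotated]) (simp_all add: dyck_scale_mult)
qed

lemma dtheta_dm:
  "dtheta k * (dm (Suc k) * x) =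
    dm (Suc (Suc k)) * (dT (Suc k) (Suc (Suc k)) * (dtheta (Suc k) * x)) + sc (qq - 1) (dz (Suc k) * x)"
proof -
  have "dcomm (Suc k) * x = dp k * (dm (Suc k) * x) - dm (Suc (Suc k)) * (dp (Suc k) * x)"
    by (simp add: dcomm_def left_diff_distrib mult.assoc)
  also have "\<dots> = dW k (Suc k) * (dtheta k * (dm (Suc k) * x) -
      dm (Suc (Suc k)) * (dT (Suc k) (Suc (Suc k)) * (dtheta (Suc k) * x)))"
    by (simp add: dp_eq right_diff_distrib mult.assoc dm_dW)
  finally have "dW k (Suc k) * (dtheta k * (dm (Suc k) * x) -
      dm (Suc (Suc k)) * (dT (Suc k) (Suc (Suc k)) * (dtheta (Suc k) * x))) =
      dW k (Suc k) * sc (qq - 1) (dz (Suc k) * x)"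
    by (simp add: dcomm_eq dyck_scale_mult)
  then have "dtheta k * (dm (Suc k) * x) -
      dm (Suc (Suc k)) * (dT (Suc k) (Suc (Suc k)) * (dtheta (Suc k) * x)) = sc (qq - 1) (dz (Suc k) * x)"
    by (rule dW_inject[rotated]) (simp_all add: dyck_scale_mult right_diff_distrib)
  then show ?thesis by (simp add: algebra_simps)
qed

subsection \<open>The elements \<open>y\<^sub>i\<close>\<close>

text \<open>Solves \<open>T_i y_(i+1) T_i = q y_i\<close> downwards; the first argument is the
  distance from the top index, where the commutator supplies \<open>dz\<close>.\<close>

primrec dyd :: "nat \<Rightarrow> nat \<Rightarrow> dyck" where
  "dyd 0 k = dz k"
| "dyd (Suc d) k = sc (1 / qq) (dT (k - Suc d) k * (dyd d k * dT (k - Suc d) k))"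

text \<open>Zero outside \<open>1..k\<close>, so that commutativity holds for all indices, as the
  folds over multisets demand.\<close>

definition dy :: "nat \<Rightarrow> nat \<Rightarrow> dyck" where
  "dy i k = (if 1 \<le> i \<and> i \<le> k then dyd (k - i) k else 0)"

lemma dy_top: "1 \<le> k \<Longrightarrow> dy k k = dz k"
  by (simp add: dy_def)

lemma dy_eq:
  assumes "1 \<le> i" "i < k"
  shows "dy i k * x = sc (1 / qq) (dT i k * (dy (Suc i) k * (dT i k * x)))"
proof -
  have "k - i = Suc (k - Suc i)" "k - Suc (k - Suc i) = i" using assms by auto
  then show ?thesis using assms by (simp add: dy_def dyck_scale_mult mult.assoc)
qed

lemma dy_units [simp]: "de k * dy i k = dy i k" "dy i k * de k = dy i k"
  "de k * (dy i k * x) = dy i k * x" "dy i k * (de k * x) = dy i k * x"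
proof -
  have "de k * dyd d k = dyd d k" "dyd d k * de k = dyd d k" for d
    by (induction d) (simp_all add: dyck_scale_mult mult.assoc)
  then show "de k * dy i k = dy i k" "dy i k * de k = dy i k" by (simp_all add: dy_def)
  then show "de k * (dy i k * x) = dy i k * x" "dy i k * (de k * x) = dy i k * x"
    by (simp_all flip: mult.assoc)
qed

lemma dT_dy_same:
  assumes "1 \<le> i" "i < k"
  shows "dT i k * (dy i k * x) = dy (Suc i) k * (dT i k * x) - sc (qq - 1) (dy i k * x)"
  using qq_neq assms
  by (simp add: dy_eq dyck_scale_mult dT_dT dyck.scale_right_diff_distrib mult.commute)

lemma dT_dy_Suc:
  assumes "1 \<le> i" "i < k"
  shows "dT i k * (dy (Suc i) k * x) = dy i k * (dT i k * x) + sc (qq - 1) (dy i k * x)"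
  using qq_neq assms
  by (simp add: dy_eq dyck_scale_mult dT_dT dyck.scale_right_diff_distrib right_diff_distrib mult.commute)

lemma dT_dy_other:
  assumes "1 \<le> i" "i \<le> k" "1 \<le> j" "j < k" "i \<noteq> j" "i \<noteq> Suc j"
  shows "dT j k * (dy i k * x) = dy i k * (dT j k * x)"
  using assms
proof (induction "k - i" arbitrary: i j x rule: less_induct)
  case less
  show ?case
  proof (cases "i = k")
    case True
    then show ?thesis using less.prems by (simp add: dy_top dz_dT)
  next
    case False
    then have i: "1 \<le> i" "i < k" using less.prems by auto
    note dy = dy_eq[OF i]
    consider "Suc j < i" | "Suc i < j" | "j = Suc i" using less.prems by linarith
    then show ?thesis
    proof cases
      case 1
      then have "dT j k * (dy (Suc i) k * w) = dy (Suc i) k * (dT j k * w)" for w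
        using less.prems i by (intro less.hyps) auto
      moreover have "dT j k * (dT i k * w) = dT i k * (dT j k * w)" for w
        using 1 less.prems i by (intro dT_far) auto
      ultimately show ?thesis by (simp add: dy dyck_scale_mult)
    next
      case 2
      then have "dT j k * (dy (Suc i) k * w) = dy (Suc i) k * (dT j k * w)" for w
        using less.prems i by (intro less.hyps) auto
      moreover have "dT j k * (dT i k * w) = dT i k * (dT j k * w)" for w
        using 2 less.prems i by (intro dT_far[symmetric]) auto
      ultimately show ?thesis by (simp add: dy dyck_scale_mult)
    next
      case 3
      then have i': "Suc i < k" using less.prems by simp
      have c: "dT i k * (dy (Suc (Suc i)) k * w) = dy (Suc (Suc i)) k * (dT i k * w)" for w
        using i i' by (intro less.hyps) auto
      \<comment> \<open>Up to the factor \<open>q^2\<close>, \<open>y_i\<close> is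
        \<open>T_i T_(i+1) y_(i+2) T_(i+1) T_i\<close>. The braid relation on the left turns
        \<open>T_(i+1)\<close> into \<open>T_i\<close>, which commutes with \<open>y_(i+2)\<close>,
        and the one on the right turns it back.\<close>
      have "dT (Suc i) k * (dT i k * (dT (Suc i) k * (dy (Suc (Suc i)) k * (dT (Suc i) k * (dT i k * x))))) =
          dT i k * (dT (Suc i) k * (dT i k * (dy (Suc (Suc i)) k * (dT (Suc i) k * (dT i k * x)))))"
        by (rule dT_braid[OF i(1) i', symmetric])
      also have "\<dots> = dT i k * (dT (Suc i) k * (dy (Suc (Suc i)) k * (dT (Suc i) k * (dT i k * (dT (Suc i) k * x)))))"
        by (simp only: c dT_braid[OF i(1) i'])
      finally have "dT (Suc i) k * (dT i k * (dT (Suc i) k * (dy (Suc (Suc i)) k * (dT (Suc i) k * (dT i k * x))))) =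
          dT i k * (dT (Suc i) k * (dy (Suc (Suc i)) k * (dT (Suc i) k * (dT i k * (dT (Suc i) k * x)))))" .
      moreover have "dy (Suc i) k * w = sc (1 / qq) (dT (Suc i) k * (dy (Suc (Suc i)) k * (dT (Suc i) k * w)))" for w
        using i' by (intro dy_eq) auto
      ultimately show ?thesis by (simp add: 3 dy dyck_scale_mult)
    qed
  qed
qed

lemma dtheta_dy:
  assumes "1 \<le> i" "i \<le> k"
  shows "dtheta k * (dy i k * x) = dy i (Suc k) * (dtheta k * x)"
  using assms(2,1)
proof (induction i arbitrary: x rule: inc_induct)
  case base
  then obtain l where k: "k = Suc l" by (cases k) auto
  have "sc qq (dtheta (Suc l) * (dz (Suc l) * x)) =
      sc qq (dy (Suc l) (Suc (Suc l)) * (dtheta (Suc l) * x))"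
    using qq_neq by (simp add: dy_eq dy_top flip: dT_dz_dT_dtheta)
  then show ?case using qq_neq by (simp add: k dy_top)
next
  case (step i)
  then show ?case
    by (simp add: dy_eq[of i] dyck_scale_mult dtheta_dT)
qed

lemma dm_dy:
  assumes "1 \<le> i" "i \<le> k"
  shows "dm (Suc k) * (dy i (Suc k) * x) = dy i k * (dm (Suc k) * x)"
  using assms(2,1)
proof (induction i arbitrary: x rule: inc_induct)
  case base
  then obtain l where k: "k = Suc l" by (cases k) auto
  then show ?case
    using qq_neq by (simp add: dy_eq dy_top dyck_scale_mult dm_dT_dz_dT)
next
  case (step i)
  then show ?case
    by (simp add: dy_eq[of i] dyck_scale_mult flip: dT_dm)
qed

text \<open>By \<open>dtheta_dm\<close>, \<open>(q-1) dz k\<close> is composed of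
  \<open>d_-\<close>, \<open>dtheta\<close> and one loop, and for \<open>i < k\<close> each of these
  can already be moved past \<open>y_i\<close>.\<close>

lemma dz_dy:
  assumes "1 \<le> i" "i < k"
  shows "dz k * (dy i k * x) = dy i k * (dz k * x)"
proof -
  obtain l where k: "k = Suc l" using assms by (cases k) auto
  have z: "sc (qq - 1) (dz (Suc l) * w) = dtheta l * (dm (Suc l) * w) -
      dm (Suc (Suc l)) * (dT (Suc l) (Suc (Suc l)) * (dtheta (Suc l) * w))" for w
    by (simp add: dtheta_dm)
  have i: "1 \<le> i" "i \<le> l" using assms k by auto
  have "sc (qq - 1) (dz (Suc l) * (dy i (Suc l) * x)) = dy i (Suc l) * sc (qq - 1) (dz (Suc l) * x)"
    unfolding z using i
    by (simp add: dm_dy dtheta_dy dT_dy_other right_diff_distrib)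
  then show ?thesis using qq_neq by (simp add: k dyck_scale_mult)
qed

lemma dy_dy_less:
  assumes "j \<le> k" "1 \<le> i" "i < j"
  shows "dy i k * (dy j k * x) = dy j k * (dy i k * x)"
  using assms
proof (induction j arbitrary: x rule: inc_induct)
  case base
  then show ?case by (simp add: dy_top dz_dy)
next
  case (step j)
  then have "dy i k * (dT j k * w) = dT j k * (dy i k * w)" for w
    by (intro dT_dy_other[symmetric]) auto
  with step show ?case
    by (simp add: dy_eq[of j] dyck_scale_mult)
qed

lemma dy_dy: "dy i k * (dy j k * x) = dy j k * (dy i k * x)"
proof -
  consider "i = j" | "1 \<le> i" "i < j" "j \<le> k" | "1 \<le> j" "j < i" "i \<le> k" | "dy i k = 0 \<or> dy j k = 0"
    by (fastforce simp: dy_def)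
  then show ?thesis
  proof cases
    case 2
    then show ?thesis by (intro dy_dy_less)
  next
    case 3
    then show ?thesis by (intro dy_dy_less[symmetric])
  qed auto
qed

primrec dyp :: "nat \<Rightarrow> nat \<Rightarrow> nat \<Rightarrow> dyck" where
  "dyp i k 0 = de k"
| "dyp i k (Suc n) = dy i k * dyp i k n"

lemma dyp_units [simp]: "de k * dyp i k n = dyp i k n" "dyp i k n * de k = dyp i k n"
  "de k * (dyp i k n * x) = dyp i k n * x" "dyp i k n * (de k * x) = dyp i k n * x"
proof -
  show "de k * dyp i k n = dyp i k n" "dyp i k n * de k = dyp i k n"
    by (induction n) (simp_all add: mult.assoc)
  then show "de k * (dyp i k n * x) = dyp i k n * x" "dyp i k n * (de k * x) = dyp i k n * x"
    by (simp_all flip: mult.assoc)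
qed

lemma dy_dyp: "dy j k * (dyp i k n * x) = dyp i k n * (dy j k * x)"
  by (induction n arbitrary: x) (simp_all add: mult.assoc dy_dy)

lemma dyp_dyp: "dyp j k m * (dyp i k n * x) = dyp i k n * (dyp j k m * x)"
  by (induction m arbitrary: x) (simp_all add: mult.assoc dy_dyp)

lemma dtheta_dyp: "1 \<le> i \<Longrightarrow> i \<le> k \<Longrightarrow> dtheta k * (dyp i k n * x) = dyp i (Suc k) n * (dtheta k * x)"
  by (induction n arbitrary: x) (simp_all add: mult.assoc dtheta_dy)

lemma dm_dyp: "1 \<le> i \<Longrightarrow> i \<le> k \<Longrightarrow> dm (Suc k) * (dyp i (Suc k) n * x) = dyp i k n * (dm (Suc k) * x)"
  by (induction n arbitrary: x) (simp_all add: mult.assoc dm_dy)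

subsection \<open>The subalgebra at the vertex 0\<close>

primrec du :: "nat \<Rightarrow> dyck" where
  "du 0 = de 0"
| "du (Suc k) = dp k * du k"

lemma du_units [simp]: "de k * du k = du k" "du k * de 0 = du k"
  "de k * (du k * x) = du k * x" "du k * (de 0 * x) = du k * x"
proof -
  show "de k * du k = du k" by (cases k) (simp_all flip: mult.assoc)
  moreover show "du k * de 0 = du k" by (induction k) (simp_all add: mult.assoc)
  ultimately show "de k * (du k * x) = du k * x" "du k * (de 0 * x) = du k * x"
    by (simp_all flip: mult.assoc)
qed

lemma dT_du: "1 \<le> i \<Longrightarrow> i < k \<Longrightarrow> dT i k * (du k * x) = du k * x"
proof (induction k arbitrary: i)
  case (Suc k)
  obtain l where k: "k = Suc l" using Suc.prems by (cases k) auto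
  show ?case
  proof (cases "i = 1")
    case True
    then show ?thesis using dT_dp_dp[of l "du l * x"] by (simp add: k mult.assoc)
  next
    case False
    then obtain j where j: "i = Suc j" "1 \<le> j" "j < k" using Suc.prems by (cases i) auto
    then show ?thesis using Suc.IH[of j] by (simp add: mult.assoc flip: dp_dT)
  qed
qed simp

lemma dR_du: "j < k \<Longrightarrow> dR j k * (du k * x) = du k * x"
proof (induction j)
  case (Suc j)
  have "dTi (Suc j) k * (du k * x) = dTi (Suc j) k * (dT (Suc j) k * (du k * x))"
    using Suc.prems by (simp add: dT_du)
  then show ?case using Suc by (simp add: mult.assoc dTi_dT)
qed simp

lemma dtheta_du: "dtheta k * (du k * x) = du (Suc k) * x"
  using dR_du[of k "Suc k" x] by (simp add: dtheta_def mult.assoc)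

definition dE :: "nat \<Rightarrow> dyck" where
  "dE n = dm 1 * (dyp 1 1 n * du 1)"

lemma dE_units [simp]: "de 0 * dE n = dE n" "dE n * de 0 = dE n"
  "de 0 * (dE n * x) = dE n * x" "dE n * (de 0 * x) = dE n * x"
proof -
  show "de 0 * dE n = dE n" by (simp add: dE_def flip: mult.assoc)
  moreover show "dE n * de 0 = dE n" by (simp add: dE_def mult.assoc)
  ultimately show "de 0 * (dE n * x) = dE n * x" "dE n * (de 0 * x) = dE n * x"
    by (simp_all flip: mult.assoc)
qed

text \<open>The complete homogeneous polynomial of degree \<open>a - 1\<close> in \<open>y\<^sub>1, y\<^sub>2\<close>.\<close>

primrec dH :: "nat \<Rightarrow> dyck" where
  "dH 0 = 0"
| "dH (Suc a) = dy 2 2 * dH a + dyp 1 2 a"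

lemma dH_Suc: "dH (Suc a) * x = dy 1 2 * (dH a * x) + dyp 2 2 a * x"
proof (induction a)
  case (Suc a)
  have "dH (Suc (Suc a)) * x = dy 2 2 * (dH (Suc a) * x) + dy 1 2 * (dyp 1 2 a * x)"
    by (simp add: distrib_right mult.assoc)
  also have "\<dots> = dy 1 2 * (dy 2 2 * (dH a * x) + dyp 1 2 a * x) + dy 2 2 * (dyp 2 2 a * x)"
    unfolding Suc by (simp add: distrib_left dy_dy[of 2 2 "Suc 0"] add_ac)
  finally show ?case by (simp add: distrib_right distrib_left mult.assoc)
qed simp

lemma dH_commute: "dH a * (dyp 1 2 b * x) = dyp 1 2 b * (dH a * x)"
  by (induction a arbitrary: x) (simp_all add: distrib_right distrib_left mult.assoc dy_dyp dyp_dyp)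

lemma dT_dyp:
  "dT 1 2 * (dyp 1 2 a * x) = dyp 2 2 a * (dT 1 2 * x) - sc (qq - 1) (dy 1 2 * (dH a * x))"
proof (induction a)
  case (Suc a)
  have "dT 1 2 * (dyp 1 2 (Suc a) * x) =
      dy 2 2 * (dT 1 2 * (dyp 1 2 a * x)) - sc (qq - 1) (dy 1 2 * (dyp 1 2 a * x))"
    using dT_dy_same[of 1 2 "dyp 1 2 a * x"] by (simp add: mult.assoc numeral_2_eq_2)
  then show ?case
    unfolding Suc
    by (simp add: right_diff_distrib distrib_left distrib_right mult.assoc dyck_scale_mult
        dyck.scale_right_distrib dy_dy[of 2 2 "Suc 0"])
qed simp

lemma dyp_dT:
  "dyp 1 2 a * (dT 1 2 * x) = dT 1 2 * (dyp 2 2 a * x) - sc (qq - 1) (dy 1 2 * (dH a * x))"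
proof (induction a)
  case (Suc a)
  have "dyp 1 2 (Suc a) * (dT 1 2 * x) = dy 1 2 * (dyp 1 2 a * (dT 1 2 * x))"
    by (simp add: mult.assoc)
  also have "\<dots> = dy 1 2 * (dT 1 2 * (dyp 2 2 a * x)) - sc (qq - 1) (dy 1 2 * (dy 1 2 * (dH a * x)))"
    unfolding Suc by (simp add: right_diff_distrib dyck_scale_mult)
  also have "dy 1 2 * (dT 1 2 * (dyp 2 2 a * x)) =
      dT 1 2 * (dyp 2 2 (Suc a) * x) - sc (qq - 1) (dy 1 2 * (dyp 2 2 a * x))"
    using dT_dy_Suc[of 1 2 "dyp 2 2 a * x"] by (simp add: mult.assoc numeral_2_eq_2)
  finally show ?case
    unfolding dH_Suc by (simp add: distrib_left dyck.scale_right_distrib algebra_simps)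
qed simp

text \<open>\<open>E_a E_b\<close> is \<open>d_-^2 y_1^a T_1 y_1^b d_+^2\<close> plus a term
  symmetric in \<open>a\<close> and \<open>b\<close>. For \<open>(a, b)\<close> push
  \<open>T_1\<close> left into \<open>d_-^2\<close>, for \<open>(b, a)\<close> push it right into
  \<open>d_+^2\<close>; both leave the same expression, with the same correction
  \<open>(q-1) y_1 dH(a) y_1^b\<close>.\<close>

lemma dE_dE: "dE a * (dE b * x) = dE b * (dE a * x)"
proof -
  let ?D = "\<lambda>w. dm 1 * (dm 2 * w)"
  have D: "?D (dT 1 2 * w) = ?D w" for w
    using dm_dm_dT[of 0 w] by (simp add: numeral_2_eq_2)
  let ?G = "\<lambda>a b. ?D (dyp 1 2 a * (dT 1 2 * (dyp 1 2 b * (du 2 * x))))"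
  have E: "dE a * (dE b * x) = ?G a b + sc (qq - 1) (dE (Suc (a + b)) * x)" for a b
  proof -
    have 1: "dp 0 * (dm 1 * w) = dm 2 * (dp 1 * w) + sc (qq - 1) (dz 1 * w)" for w
      using dcomm_eq[of 0 w] by (simp add: dcomm_def left_diff_distrib mult.assoc numeral_2_eq_2 algebra_simps)
    have "dp 1 * w = dT 1 2 * (dtheta 1 * w)" for w
      using dp_eq[of 1 w] by (simp add: mult.assoc numeral_2_eq_2)
    moreover have "dtheta 1 * (dyp 1 1 b * (du 1 * x)) = dyp 1 2 b * (du 2 * x)"
      unfolding numeral_2_eq_2 using dtheta_dyp[of 1 1 b "du 1 * x"] dtheta_du[of 1 x]
      by (simp del: du.simps dyp.simps)
    ultimately have 2: "dp 1 * (dyp 1 1 b * (du 1 * x)) = dT 1 2 * (dyp 1 2 b * (du 2 * x))"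
      by simp
    have p: "dyp 1 1 a * (dz 1 * (dyp 1 1 b * w)) = dyp 1 1 (Suc (a + b)) * w" for w
      by (induction a) (simp_all add: mult.assoc dy_top dy_dyp[symmetric])
    have "dE a * (dE b * x) = dm 1 * (dyp 1 1 a * (dp 0 * (dm 1 * (dyp 1 1 b * (du 1 * x)))))"
      by (simp add: dE_def mult.assoc)
    also have "\<dots> = ?G a b + sc (qq - 1) (dE (Suc (a + b)) * x)"
      unfolding 1 2 distrib_left dyck_scale_mult p using dm_dyp[of 1 1 a]
      by (simp add: dE_def mult.assoc numeral_2_eq_2 del: dyp.simps du.simps)
    finally show ?thesis .
  qed
  have T: "dT 1 2 * (du 2 * x) = du 2 * x" by (rule dT_du) simp_all
  have "?G a b = ?D (dyp 2 2 a * (dyp 1 2 b * (du 2 * x)) - sc (qq - 1) (dy 1 2 * (dyp 1 2 b * (dH a * (du 2 * x)))))"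
    unfolding dyp_dT by (simp only: right_diff_distrib D dH_commute)
  also have "\<dots> = ?G b a"
    unfolding dT_dyp T by (simp add: right_diff_distrib dyck_scale_mult dyp_dyp[of 2 2 a "Suc 0" b] dy_dyp)
  finally show ?thesis by (simp add: E add.commute)
qed

interpretation dE: comp_fun_commute "\<lambda>n x. dE n * x"
  by unfold_locales (simp add: fun_eq_iff dE_dE)

interpretation dy: comp_fun_commute "\<lambda>i x. dy i k * x" for k
  by unfold_locales (simp add: fun_eq_iff dy_dy)

definition dEm :: "nat multiset \<Rightarrow> dyck" where
  "dEm M = fold_mset (\<lambda>n x. dE n * x) (de 0) M"

definition dymul :: "nat \<Rightarrow> nat multiset \<Rightarrow> dyck \<Rightarrow> dyck" where
  "dymul k A x = fold_mset (\<lambda>i x. dy i k * x) x A"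

lemma dEm_simps [simp]: "dEm {#} = de 0" "dEm (add_mset n M) = dE n * dEm M"
  by (simp_all add: dEm_def)

lemma dymul_simps [simp]: "dymul k {#} x = x" "dymul k (add_mset i A) x = dy i k * dymul k A x"
  by (simp_all add: dymul_def)

lemma dEm_units [simp]: "de 0 * dEm M = dEm M" "dEm M * de 0 = dEm M"
proof -
  show "de 0 * dEm M = dEm M" by (cases M) simp_all
  show "dEm M * de 0 = dEm M" by (induction M) (simp_all add: mult.assoc)
qed

lemma dEm_mult_dE: "dEm M * dE n = dEm (add_mset n M)"
  by (induction M) (simp_all add: mult.assoc dE_dE)

subsection \<open>A spanning set of \<open>e\<^sub>k A e\<^sub>0\<close>\<close>

text \<open>The module over the \<open>y_i\<close> generated by the elements
  \<open>d_+^k E_M\<close>; the aim is closure under left multiplication by every arrow.\<close>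

inductive_set dS :: "nat \<Rightarrow> dyck set" for k where
  base: "du k * dEm M \<in> dS k"
| add: "x \<in> dS k \<Longrightarrow> y \<in> dS k \<Longrightarrow> x + y \<in> dS k"
| scale: "x \<in> dS k \<Longrightarrow> sc c x \<in> dS k"
| y: "1 \<le> i \<Longrightarrow> i \<le> k \<Longrightarrow> x \<in> dS k \<Longrightarrow> dy i k * x \<in> dS k"

lemma dS_0: "0 \<in> dS k"
  using dS.scale[OF dS.base, of 0] by simp

lemma dS_diff: "x \<in> dS k \<Longrightarrow> y \<in> dS k \<Longrightarrow> x - y \<in> dS k"
  using dS.add[of x k "sc (-1) y"] dS.scale[of y k "-1"] by simp

lemma du_dS: "du k \<in> dS k"
  using dS.base[of k "{#}"] by simp

lemma dyp_dS: "1 \<le> i \<Longrightarrow> i \<le> k \<Longrightarrow> x \<in> dS k \<Longrightarrow> de k * x = x \<Longrightarrow> dyp i k n * x \<in> dS k"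
  by (induction n) (simp_all add: mult.assoc dS.y)

lemma dS_units: "x \<in> dS k \<Longrightarrow> de k * x = x" "x \<in> dS k \<Longrightarrow> x * de 0 = x"
  by (induction x rule: dS.induct)
    (simp_all add: distrib_left distrib_right dyck_scale_mult mult.assoc)

lemma dS_dE: "x \<in> dS k \<Longrightarrow> x * dE n \<in> dS k"
proof (induction x rule: dS.induct)
  case (base M)
  then show ?case using dS.base[of k "add_mset n M"] by (simp add: mult.assoc dEm_mult_dE)
qed (simp_all add: distrib_right dyck_scale_mult mult.assoc dS.intros)

lemma dS_dEm: "x \<in> dS k \<Longrightarrow> x * dEm M \<in> dS k"
proof (induction M arbitrary: x)
  case (add n M)
  then show ?case using dS_dE[of x k n] by (simp flip: mult.assoc)
qed (simp add: dS_units)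

lemma dS_dtheta: "x \<in> dS k \<Longrightarrow> dtheta k * x \<in> dS (Suc k)"
proof (induction x rule: dS.induct)
  case (base M)
  show ?case unfolding dtheta_du by (rule dS.base)
qed (auto simp: distrib_left dyck_scale_mult dtheta_dy intro: dS.intros)

lemma dS_dT:
  assumes i: "1 \<le> i" "i < k" and "x \<in> dS k"
  shows "dT i k * x \<in> dS k"
  using assms(3)
proof (induction x rule: dS.induct)
  case (y j x)
  consider "j = i" | "j = Suc i" | "j \<noteq> i" "j \<noteq> Suc i" by blast
  then show ?case
  proof cases
    case 1
    then show ?thesis using y i by (simp add: dT_dy_same dS_diff dS.intros)
  next
    case 2
    then show ?thesis using y i by (simp add: dT_dy_Suc dS.intros)
  next
    case 3
    then show ?thesis using y i by (simp add: dT_dy_other dS.intros)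
  qed
qed (use i in \<open>auto simp: distrib_left dyck_scale_mult dT_du intro: dS.intros\<close>)

lemma dS_dp: "x \<in> dS k \<Longrightarrow> dp k * x \<in> dS (Suc k)"
proof -
  assume "x \<in> dS k"
  have "dW j (Suc k) * w \<in> dS (Suc k)" if "j \<le> k" "w \<in> dS (Suc k)" for j w
    using that by (induction j arbitrary: w) (simp_all add: dS_units mult.assoc dS_dT)
  from this[OF order_refl dS_dtheta[OF \<open>x \<in> dS k\<close>]] show ?thesis by (simp add: dp_eq)
qed

text \<open>Counterpart of \<open>opT_power_Suc\<close>, with \<open>du k\<close> in the role of the
  constant 1 that every loop fixes.\<close>

lemma dT_dyp_du:
  assumes "1 \<le> i" "i < k"
  shows "dT i k * (dyp i k (Suc n) * du k) = dy i k * (dT i k * (dyp i k n * du k)) +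
    dyp (Suc i) k (Suc n) * du k - sc qq (dy i k * (dyp (Suc i) k n * du k))"
proof (induction n)
  have T: "dT i k * du k = du k" using dT_du[OF assms, of "de 0"] by simp
  case 0
  have "sc (qq - 1) (dy i k * du k) = sc qq (dy i k * du k) - dy i k * du k"
    by (simp add: dyck.scale_left_diff_distrib)
  then show ?case using assms by (simp add: mult.assoc T dT_dy_same)
next
  case (Suc n)
  let ?t = "\<lambda>n. dT i k * (dyp i k n * du k)"
  have t: "?t (Suc n) = dy (Suc i) k * ?t n - sc (qq - 1) (dy i k * (dyp i k n * du k))" for n
    using assms by (simp add: mult.assoc dT_dy_same)
  have "dy (Suc i) k * ?t (Suc n) = dy i k * (dy (Suc i) k * ?t n) +
      dyp (Suc i) k (Suc (Suc n)) * du k - sc qq (dy i k * (dyp (Suc i) k (Suc n) * du k))"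
    unfolding Suc
    by (simp add: distrib_left right_diff_distrib dyck_scale_mult mult.assoc dy_dy[of "Suc i" k i])
  also have "dy (Suc i) k * ?t n = ?t (Suc n) + sc (qq - 1) (dy i k * (dyp i k n * du k))"
    unfolding t by simp
  finally show ?case
    unfolding t[of "Suc n"] by (simp add: distrib_left dyck_scale_mult mult.assoc)
qed

text \<open>Induction on \<open>k\<close>, then on \<open>n\<close>. By \<open>dtheta_dm\<close> and
  the hypothesis for \<open>k\<close>, the variant with \<open>T_(k+1) y_(k+1)^n\<close> in place of
  \<open>y_(k+2)^n\<close> lies in the span; \<open>dT_dyp_du\<close> then expresses the next power
  of the top variable by such variants and the previous power.\<close>

lemma dm_dyp_du_dS: "dm (Suc k) * (dyp (Suc k) (Suc k) n * du (Suc k)) \<in> dS k"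
proof (induction k arbitrary: n)
  case 0
  have "dm (Suc 0) * (dyp (Suc 0) (Suc 0) n * du (Suc 0)) = dE n" by (simp add: dE_def)
  moreover have "du 0 * dEm {#n#} = dE n" by simp
  ultimately show ?case using dS.base[of 0 "{#n#}"] by simp
next
  case (Suc k)
  let ?k = "Suc k" and ?n = "Suc (Suc k)"
  let ?w = "\<lambda>n. dm ?n * (dyp ?n ?n n * du ?n)"
  let ?t = "\<lambda>n. dm ?n * (dT ?k ?n * (dyp ?k ?n n * du ?n))"
  have t: "?t n \<in> dS ?k" for n
  proof -
    have "dtheta ?k * (dyp ?k ?k n * du ?k) = dyp ?k ?n n * du ?n"
      using dtheta_du[of ?k "de 0"] by (simp add: dtheta_dyp mult.assoc del: du.simps)
    then have "?t n = dtheta k * (dm ?k * (dyp ?k ?k n * du ?k)) - sc (qq - 1) (dy ?k ?k * (dyp ?k ?k n * du ?k))"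
      unfolding dtheta_dm by (simp add: dy_top)
    moreover have "dyp ?k ?k n * du ?k \<in> dS ?k"
      using du_dS[of ?k] by (intro dyp_dS) (auto simp: dS_units)
    ultimately show ?thesis
      using Suc.IH[of n] by (auto intro!: dS_diff dS.scale dS.y dS_dtheta)
  qed
  show ?case
  proof (induction n)
    case 0
    have "dT ?k ?n * du ?n = du ?n" using dT_du[of ?k ?n "de 0"] by (simp del: du.simps)
    then show ?case using t[of 0] by (simp del: du.simps)
  next
    case (Suc n)
    have d: "dm ?n * (dy ?k ?n * x) = dy ?k ?k * (dm ?n * x)" for x
      by (rule dm_dy) simp_all
    have "dT ?k ?n * (dyp ?k ?n (Suc n) * du ?n) = dy ?k ?n * (dT ?k ?n * (dyp ?k ?n n * du ?n)) +
        dyp ?n ?n (Suc n) * du ?n - sc qq (dy ?k ?n * (dyp ?n ?n n * du ?n))"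
      by (rule dT_dyp_du) simp_all
    then have "?t (Suc n) = dy ?k ?k * ?t n + ?w (Suc n) - sc qq (dy ?k ?k * ?w n)"
      by (simp only: distrib_left right_diff_distrib dyck_scale_mult d)
    then have "?w (Suc n) = ?t (Suc n) - dy ?k ?k * ?t n + sc qq (dy ?k ?k * ?w n)"
      by (simp only:) (simp add: algebra_simps del: dyp.simps du.simps)
    moreover have "?t (Suc n) - dy ?k ?k * ?t n + sc qq (dy ?k ?k * ?w n) \<in> dS ?k"
      by (intro dS.add dS_diff dS.scale dS.y t Suc.IH) simp_all
    ultimately show ?case by (simp only:)
  qed
qed

lemma dS_dm: 
  assumes "x \<in> dS (Suc k)"
  shows "dm (Suc k) * x \<in> dS k"
proof -
  \<comment> \<open>Powers of \<open>y_(k+1)\<close> are carried through the induction, since only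
    the other \<open>y_i\<close> are moved across \<open>d_-\<close>.\<close>
  have "dm (Suc k) * (dyp (Suc k) (Suc k) n * x) \<in> dS k" for n
    using assms
  proof (induction x arbitrary: n rule: dS.induct)
    case (base M)
    show ?case
      using dS_dEm[OF dm_dyp_du_dS, of k n M] by (simp only: mult.assoc)
  next
    case (y i x)
    show ?case
    proof (cases "i = Suc k")
      case True
      then show ?thesis
        using y.IH[of "Suc n"] by (simp add: mult.assoc dy_dyp)
    next
      case False
      then have "i \<le> k" using y by simp
      then have "dm (Suc k) * (dyp (Suc k) (Suc k) n * (dy i (Suc k) * x)) =
          dy i k * (dm (Suc k) * (dyp (Suc k) (Suc k) n * x))"
        using y(1) by (simp add: dm_dy flip: dy_dyp)
      then show ?thesis using y \<open>i \<le> k\<close> by (simp add: dS.y)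
    qed
  qed (simp_all add: distrib_left dyck_scale_mult dS.intros)
  from this[of 0] show ?thesis using dS_units[OF assms] by simp
qed

lemma dS_path: "is_path (0, as) \<Longrightarrow> abs_dyck (path_basis (Abs_path (0, as))) \<in> dS (list_tgt (0, as))"
proof (induction as)
  case Nil
  have "abs_dyck (path_basis (Abs_path (0, []))) = du 0"
    by (simp add: dyck_e.abs_eq pe_def)
  then show ?case using du_dS[of 0] by simp
next
  case (Cons a as)
  let ?x = "abs_dyck (path_basis (Abs_path (0, as)))"
  have x: "?x \<in> dS (arrow_src a)" and a: "is_arrow a" using Cons by auto
  have "abs_dyck (arrow_elem a) * ?x \<in> dS (arrow_tgt a)"
  proof (cases a)
    case (Dplus k)
    then show ?thesis using x dS_dp[of ?x k] by (simp add: dyck_dplus.abs_eq)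
  next
    case (Dminus k)
    then obtain l where "k = Suc l" using a by (cases k) auto
    then show ?thesis using x Dminus dS_dm[of ?x l] by (simp add: dyck_dminus.abs_eq)
  next
    case (Loop i k)
    then show ?thesis using x a dS_dT[of i k ?x] by (simp add: dyck_T.abs_eq)
  qed
  then show ?case
    unfolding path_basis_Cons[OF Cons.prems] by (simp add: times_dyck.abs_eq)
qed

lemma ekAe0_eq: "ekAe0 k = dS k"
proof
  show "dS k \<subseteq> ekAe0 k"
  proof
    fix x assume "x \<in> dS k"
    then have "x = de k * x * de 0" by (simp add: dS_units)
    then show "x \<in> ekAe0 k" unfolding ekAe0_def by blast
  qed
  have "abs_dyck (pe k * (x * pe 0)) \<in> dS k" for x
  proof (induction x rule: pathalg_induct)
    case (add x y)
    have "abs_dyck (pe k * ((x + y) * pe 0)) = abs_dyck (pe k * (x * pe 0)) + abs_dyck (pe k * (y * pe 0))"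
      by (simp add: plus_dyck.abs_eq distrib_left distrib_right)
    then show ?case using add by (simp add: dS.add)
  next
    case (basis c p)
    obtain s as where p: "Rep_path p = (s, as)" by fastforce
    have p': "p = Abs_path (s, as)" "is_path (s, as)"
      using Rep_path_inverse[of p] Rep_path[of p] by (simp_all add: p)
    have "abs_dyck (pe k * (path_basis p * pe 0)) \<in> dS k"
    proof -
      have "abs_dyck (path_basis p) \<in> dS (list_tgt (0, as))" if "s = 0"
        using dS_path[of as] p' that by simp
      then show ?thesis
        using dS_0[of k] by (auto simp: mult_pe pe_mult p zero_dyck.abs_eq[symmetric])
    qed
    then have "sc c (abs_dyck (pe k * (path_basis p * pe 0))) \<in> dS k" by (rule dS.scale)
    then show ?case by (simp add: dyck_scale.abs_eq path_scale_mult)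
  qed
  then have "de k * a * de 0 \<in> dS k" for a
    by (induction a rule: dyck.abs_induct) (simp add: dyck_e.abs_eq times_dyck.abs_eq mult.assoc)
  then show "ekAe0 k \<subseteq> dS k" by (auto simp: ekAe0_def)
qed

text \<open>The algebra has no unit, but only finitely many end vertices occur in an element.
  Quantifying over all larger \<open>K'\<close> lets the sets of two summands be united.\<close>

lemma dyck_decomposition: "\<exists>K. finite K \<and> (\<forall>K'. finite K' \<longrightarrow> K \<subseteq> K' \<longrightarrow> (\<Sum>k\<in>K'. de k * x) = x)"
proof -
  have "\<exists>K. finite K \<and> (\<forall>K'. finite K' \<longrightarrow> K \<subseteq> K' \<longrightarrow> (\<Sum>k\<in>K'. de k * abs_dyck x) = abs_dyck x)" for x
  proof (induction x rule: pathalg_induct)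
    case (add x y)
    then obtain K L where "finite K" "finite L"
      "\<And>K'. finite K' \<Longrightarrow> K \<subseteq> K' \<Longrightarrow> (\<Sum>k\<in>K'. de k * abs_dyck x) = abs_dyck x"
      "\<And>K'. finite K' \<Longrightarrow> L \<subseteq> K' \<Longrightarrow> (\<Sum>k\<in>K'. de k * abs_dyck y) = abs_dyck y" by blast
    then show ?case
      by (intro exI[of _ "K \<union> L"])
        (simp add: plus_dyck.abs_eq[symmetric] distrib_left sum.distrib)
  next
    case (basis c p)
    let ?t = "list_tgt (Rep_path p)"
    have *: "de k * abs_dyck (path_basis p) = (if k = ?t then abs_dyck (path_basis p) else 0)" for k
      by (simp add: dyck_e.abs_eq times_dyck.abs_eq pe_mult zero_dyck.abs_eq)
    show ?case
      by (intro exI[of _ "{?t}"])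
        (simp add: dyck_scale.abs_eq[symmetric] dyck_scale_mult * if_distrib[of "sc c"] cong: if_cong)
  qed
  then show ?thesis by (induction x rule: dyck.abs_induct) blast
qed

subsection \<open>The isomorphism\<close>

lemma dyck_act_inV:
  assumes F: "F \<in> V k"
  shows "dyck_act (de k) (inV k F) = inV k F"
    "1 \<le> i \<Longrightarrow> i < k \<Longrightarrow> dyck_act (dT i k) (inV k F) = inV k (opT i F)"
    "dyck_act (dp k) (inV k F) = inV (Suc k) (opdplus k F)"
    "k = Suc l \<Longrightarrow> dyck_act (dm k) (inV k F) = inV l (opdminus k F)"
  using inV_Vstar[OF F] by (simp_all add: dyck_act_generators)

lemma dyck_act_dW: "j < n \<Longrightarrow> F \<in> V n \<Longrightarrow> dyck_act (dW j n) (inV n F) = inV n (Tprod opT j F)"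
  by (induction j arbitrary: F)
    (simp_all add: dyck_act_inV dyck_act_simps inV_Vstar Tprod_Suc opT_V)

lemma dyck_act_dR:
  assumes "j < n" "F \<in> V n"
  shows "dyck_act (dR j n) (inV n (Tprod opT j F)) = inV n F"
proof -
  have "dR j n * dW j n = de n" using dR_dW[OF assms(1), of "de n"] by simp
  then have "dyck_act (dR j n * dW j n) (inV n F) = inV n F"
    using assms by (simp add: dyck_act_inV)
  then show ?thesis using assms by (simp add: dyck_act_simps inV_Vstar dyck_act_dW)
qed

lemma theta_V: "F \<in> V k \<Longrightarrow> theta (Suc k) F \<in> V (Suc k)"
  unfolding V_eq_ypoly by (rule ypoly_theta) (auto elim!: ypoly_mono[rotated])

lemma yvar_V: "1 \<le> i \<Longrightarrow> i \<le> k \<Longrightarrow> F \<in> V k \<Longrightarrow> yvar i * F \<in> V k"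
  unfolding V_eq_ypoly by (intro ypoly_mult ypoly_yvar) auto

lemma dyck_act_dtheta: "F \<in> V k \<Longrightarrow> dyck_act (dtheta k) (inV k F) = inV (Suc k) (theta (Suc k) F)"
  by (simp add: dtheta_def dyck_act_simps inV_Vstar dyck_act_inV opdplus_eq dyck_act_dR theta_V)

lemma dyck_act_minus: "v \<in> Vstar \<Longrightarrow> dyck_act (a - b) v = dyck_act a v - dyck_act b v"
  using dyck_act_simps(1)[of v "a - b" b] by simp

lemma dyck_act_dz:
  assumes F: "F \<in> V (Suc l)"
  shows "dyck_act (dz (Suc l)) (inV (Suc l) F) = inV (Suc l) (yvar (Suc l) * F)"
proof -
  have y: "yvar (Suc l) * F \<in> V (Suc l)" using F by (intro yvar_V) auto
  have "dyck_act (dcomm (Suc l)) (inV (Suc l) F) =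
      inV (Suc l) (opdplus l (opdminus (Suc l) F) - opdminus (Suc (Suc l)) (opdplus (Suc l) F))"
    using F by (simp add: dcomm_def dyck_act_minus dyck_act_simps inV_Vstar dyck_act_inV opdminus_V
        opdplus_V inV_simps)
  also have "\<dots> = inV (Suc l) (Tprod opT l (of_qt (qq - 1) * (yvar (Suc l) * F)))"
    unfolding opdplus_opdminus_commutator[OF F] by (simp add: Tprod_opT_linear)
  finally have "dyck_act (dz (Suc l)) (inV (Suc l) F) =
      vconst (1 / (qq - 1)) * inV (Suc l) (of_qt (qq - 1) * (yvar (Suc l) * F))"
    using F y by (simp add: dz_def dyck_act_simps inV_Vstar dyck_act_dR V_of_qt)
  then show ?thesis
    using qq_neq by (simp add: inV_simps of_qt_simps(2)[symmetric] of_qt_simps(3) flip: mult.assoc)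
qed

lemma dyck_act_dy:
  assumes "1 \<le> i" "i \<le> k" "F \<in> V k"
  shows "dyck_act (dy i k) (inV k F) = inV k (yvar i * F)"
  using assms(2,1,3)
proof (induction i arbitrary: F rule: inc_induct)
  case base
  then obtain l where "k = Suc l" by (cases k) auto
  then show ?case using base by (simp add: dy_top dyck_act_dz)
next
  case (step i)
  have "dy i k = sc (1 / qq) (dT i k * (dy (Suc i) k * dT i k))"
    using dy_eq[of i k "de k"] step by simp
  then have "dyck_act (dy i k) (inV k F) =
      vconst (1 / qq) * inV k (opT i (yvar (Suc i) * opT i F))"
    using step by (simp add: dyck_act_simps inV_Vstar dyck_act_inV opT_V yvar_V)
  then show ?case
    using qq_neq
    by (simp add: opT_yvar_Suc_opT inV_simps of_qt_simps(2)[symmetric] of_qt_simps(3) flip: mult.assoc)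
qed

lemma dyck_act_dyp:
  assumes "1 \<le> i" "i \<le> k" "F \<in> V k"
  shows "dyck_act (dyp i k n) (inV k F) = inV k (yvar i ^ n * F) \<and> yvar i ^ n * F \<in> V k"
  using assms
  by (induction n) (simp_all add: dyck_act_inV dyck_act_simps inV_Vstar dyck_act_dy yvar_V mult.assoc)

section \<open>The comparison map\<close>

definition dphi :: "dyck \<Rightarrow> vstar" where
  "dphi x = dyck_act x (inV 0 1)"

lemma one_V: "1 \<in> V k"
  by (simp add: V_eq_ypoly ypoly_1)

lemma of_sym_V: "of_sym F \<in> V k"
  by (simp add: V_eq_ypoly ypoly_of_sym)

lemma dphi_simps:
  "dphi (x + y) = dphi x + dphi y" "dphi (x - y) = dphi x - dphi y" "dphi 0 = 0"
  "dphi (sc c x) = vconst c * dphi x" "dphi (a * x) = dyck_act a (dphi x)"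
  using dyck_act_minus[of "inV 0 1" 0 0]
  by (simp_all add: dphi_def dyck_act_simps dyck_act_minus inV_Vstar one_V)

lemma dphi_sum: "dphi (sum f A) = (\<Sum>a\<in>A. dphi (f a))"
  by (induction A rule: infinite_finite_induct) (simp_all add: dphi_simps)

lemma dphi_de_0: "dphi (de 0) = inV 0 1"
  by (simp add: dphi_def dyck_act_inV one_V)

lemma dphi_Vstar: "dphi x \<in> Vstar"
  by (simp add: dphi_def dyck_act_Vstar inV_Vstar one_V)

text \<open>\<open>Theta k\<close> is the automorphism \<open>F \<mapsto> F[X + (q-1)(y\<^sub>1 + \<dots> + y\<^sub>k)]\<close>.\<close>

primrec Theta :: "nat \<Rightarrow> symy \<Rightarrow> symy" where
  "Theta 0 F = F"
| "Theta (Suc k) F = theta (Suc k) (Theta k F)"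

primrec Theta_inv :: "nat \<Rightarrow> symy \<Rightarrow> symy" where
  "Theta_inv 0 F = F"
| "Theta_inv (Suc k) F = Theta_inv k (theta_inv (Suc k) F)"

lemma Theta_Theta_inv: "Theta k (Theta_inv k F) = F" "Theta_inv k (Theta k F) = F"
  by (induction k arbitrary: F) simp_all

lemma Theta_simps: "Theta k (F + G) = Theta k F + Theta k G" "Theta k (F * G) = Theta k F * Theta k G"
  "Theta k (yvar i) = yvar i" "Theta k (of_qt c) = of_qt c" "Theta k 0 = 0"
  by (induction k) (simp_all add: theta_simps)

lemma ypoly_Theta: "{1..k} \<subseteq> S \<Longrightarrow> F \<in> ypoly S \<Longrightarrow> Theta k F \<in> ypoly S"
  "{1..k} \<subseteq> S \<Longrightarrow> F \<in> ypoly S \<Longrightarrow> Theta_inv k F \<in> ypoly S"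
  by (induction k arbitrary: F) (simp_all add: ypoly_theta atLeastAtMostSuc_conv)

lemma Theta_V: "F \<in> V k \<Longrightarrow> Theta k F \<in> V k" "F \<in> V k \<Longrightarrow> Theta_inv k F \<in> V k"
  by (simp_all add: V_eq_ypoly ypoly_Theta)

lemma dphi_du: "dphi x = inV 0 (of_sym G) \<Longrightarrow> dphi (du k * x) = inV k (Theta k (of_sym G))"
proof (induction k)
  case 0
  then show ?case by (simp add: dphi_simps dyck_act_inV of_sym_V)
next
  case (Suc k)
  have "Theta k (of_sym G) \<in> V k" by (rule Theta_V(1)) (rule of_sym_V)
  then show ?case
    using Suc by (simp only: dtheta_du[symmetric] dphi_simps(5)[of "dtheta k"]) (simp add: dyck_act_dtheta)
qed

text \<open>The automorphism \<open>theta 1\<close> produced by \<open>d_+\<close> cancels against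
  the inverse in \<open>d_-\<close>, so \<open>E_n\<close> acts on \<open>V_0\<close> as
  multiplication by \<open>eps n\<close>.\<close>

lemma dphi_dE:
  assumes "dphi x = inV 0 (of_sym G)"
  shows "dphi (dE n * x) = inV 0 (of_sym (eps n * G))"
proof -
  let ?F = "theta 1 (of_sym G)"
  have F: "?F \<in> V 1" using theta_V[OF of_sym_V[of G 0]] by simp
  have "dphi (du 1 * x) = inV 1 ?F"
    using dphi_du[OF assms, of 1] by simp
  then have "dphi (dE n * x) = dyck_act (dm 1) (dyck_act (dyp 1 1 n) (inV 1 ?F))"
    by (simp only: dE_def mult.assoc dphi_simps(5)[of "dm 1"] dphi_simps(5)[of "dyp 1 1 n"])
  also have "\<dots> = inV 0 (opdminus 1 (yvar 1 ^ n * ?F))"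
    using dyck_act_dyp[OF _ _ F, of 1 n] by (simp add: dyck_act_inV)
  also have "opdminus 1 (yvar 1 ^ n * ?F) = of_sym G * of_sym (eps n)"
    using opdminus_theta_mult[OF ypoly_of_sym, of 1 G n] by (simp add: mult.commute)
  finally show ?thesis by (simp add: of_sym_simps mult.commute)
qed

lemma dphi_dEm: "dphi (dEm M) = inV 0 (of_sym (prod_mset (image_mset eps M)))"
proof (induction M)
  case empty
  show ?case by (simp add: dphi_de_0 of_sym_simps)
next
  case (add n M)
  then show ?case using dphi_dE[of "dEm M"] by simp
qed

lemma eeval_single: "eeval (Poly_Mapping.single M c) = sym_const c * prod_mset (image_mset eps M)"
  by (simp add: eeval_def meval_single ring_map_sym_const)

lemma dphi_du_dEm: "dphi (sc c (du k * dEm M)) = inV k (Theta k (of_sym (eeval (Poly_Mapping.single M c))))"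
  using dphi_du[OF dphi_dEm, of k M]
  by (simp add: dphi_simps inV_simps eeval_single of_sym_simps Theta_simps flip: of_qt_def)

text \<open>\<open>Theta k\<close> is invertible, so it suffices to reach \<open>Theta k P\<close>
  for every \<open>P\<close>, and such \<open>P\<close> are built from products of the
  \<open>eps n\<close>, scalars and the \<open>y_i\<close>.\<close>

lemma dphi_surj_V:
  assumes "Q \<in> V k"
  shows "\<exists>x\<in>dS k. dphi x = inV k Q"
proof -
  define P where "P = Theta_inv k Q"
  have "P \<in> ypoly {1..k}"
    using Theta_V(2)[OF assms] by (simp add: P_def V_eq_ypoly)
  then have "\<exists>x\<in>dS k. dphi x = inV k (Theta k P)"
  proof (induction P rule: ypoly_induct)
    case (add F G)
    then obtain x y where "x \<in> dS k" "y \<in> dS k" "dphi x = inV k (Theta k F)" "dphi y = inV k (Theta k G)"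
      by blast
    then show ?case
      by (intro bexI[of _ "x + y"]) (simp_all add: dphi_simps inV_simps Theta_simps dS.add)
  next
    case (of_sym G)
    obtain h where h: "G = eeval h" using surj_eeval by (metis surjD)
    show ?case
      unfolding h
    proof (induction h rule: pm_induct)
      case (add f g)
      then obtain x y where "x \<in> dS k" "y \<in> dS k" "dphi x = inV k (Theta k (of_sym (eeval f)))"
        "dphi y = inV k (Theta k (of_sym (eeval g)))"
        by blast
      then show ?case
        by (intro bexI[of _ "x + y"])
          (simp_all add: dphi_simps inV_simps Theta_simps dS.add ring_mapD(1)[OF ring_map_eeval] of_sym_simps)
    next
      case (single M c)
      show ?case using dphi_du_dEm[of c k M] dS.scale[OF dS.base] by blast
    qed
  next
    case (yvar i F)
    then obtain x where x: "x \<in> dS k" "dphi x = inV k (Theta k F)" by blast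
    have "Theta k F \<in> V k" using yvar by (intro Theta_V) (simp add: V_eq_ypoly)
    then have "dphi (dy i k * x) = inV k (Theta k (yvar i * F))"
      using x yvar by (simp add: dphi_simps dyck_act_dy Theta_simps)
    moreover have "dy i k * x \<in> dS k" using x yvar by (intro dS.y) auto
    ultimately show ?case by blast
  qed
  then show ?thesis by (simp add: P_def Theta_Theta_inv)
qed

text \<open>The analogue of \<open>pm_lift\<close> for values in the noncommutative ring
  \<open>dyck\<close>, with a separate map for each key.\<close>

definition dext :: "('a \<Rightarrow> 'b::comm_monoid_add \<Rightarrow> dyck) \<Rightarrow> ('a \<Rightarrow>\<^sub>0 'b) \<Rightarrow> dyck" where
  "dext f F = (\<Sum>m\<in>Poly_Mapping.keys F. f m (Poly_Mapping.lookup F m))"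

lemma dext_superset:
  assumes "\<And>m. f m 0 = 0" "finite A" "Poly_Mapping.keys F \<subseteq> A"
  shows "dext f F = (\<Sum>m\<in>A. f m (Poly_Mapping.lookup F m))"
  unfolding dext_def
  by (rule sum.mono_neutral_left) (use assms in \<open>auto simp: in_keys_iff\<close>)

lemma dext_add:
  assumes "\<And>m. f m 0 = 0" "\<And>m x y. f m (x + y) = f m x + f m y"
  shows "dext f (F + G) = dext f F + dext f G"
proof -
  let ?A = "Poly_Mapping.keys F \<union> Poly_Mapping.keys G"
  have "Poly_Mapping.keys (F + G) \<subseteq> ?A"
    by (rule Poly_Mapping.keys_add)
  then show ?thesis
    using dext_superset[of f ?A F] dext_superset[of f ?A G] dext_superset[of f ?A "F + G"] assms
    by (simp add: lookup_add sum.distrib)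
qed

lemma dext_single: "(\<And>m. f m 0 = 0) \<Longrightarrow> dext f (Poly_Mapping.single m c) = f m c"
  by (subst dext_superset[of _ "{m}"]) auto

text \<open>\<open>dpoly k P\<close> is the preimage in \<open>e\<^sub>k A e\<^sub>0\<close> of \<open>Theta k P\<close>.\<close>

definition dsym :: "sym \<Rightarrow> dyck" where
  "dsym G = dext (\<lambda>M c. sc c (dEm M)) (pleth mconst pnew G)"

definition mset_of_monom :: "monom \<Rightarrow> nat multiset" where
  "mset_of_monom m = (\<Sum>i\<in>Poly_Mapping.keys m. replicate_mset (Poly_Mapping.lookup m i) i)"

definition dpoly :: "nat \<Rightarrow> symy \<Rightarrow> dyck" where
  "dpoly k = dext (\<lambda>m G. dymul k (mset_of_monom m) (du k * dsym G))"

lemma count_mset_of_monom: "count (mset_of_monom m) i = Poly_Mapping.lookup m i"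
  by (simp add: mset_of_monom_def count_sum in_keys_iff)

lemma mset_of_monom_simps:
  "mset_of_monom 0 = {#}"
  "mset_of_monom (Poly_Mapping.single i 1 + m) = add_mset i (mset_of_monom m)"
  by (rule multiset_eqI; simp add: count_mset_of_monom lookup_add lookup_single when_def)+

lemma pleth_pnew_simps:
  "pleth mconst pnew (F + G) = pleth mconst pnew F + pleth mconst pnew G"
  "pleth mconst pnew (F * G) = pleth mconst pnew F * pleth mconst pnew G"
  "pleth mconst pnew 0 = 0" "pleth mconst pnew (sym_const c) = mconst c"
  using ring_mapD[OF ring_map_pleth[OF ring_map_mconst]] pleth_const[OF ring_map_mconst] by simp_all

lemma dsym_add: "dsym (F + G) = dsym F + dsym G"
  unfolding dsym_def pleth_pnew_simps by (rule dext_add) (simp_all add: dyck.scale_left_distrib)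

lemma dsym_0 [simp]: "dsym 0 = 0"
  by (simp add: dsym_def pleth_pnew_simps dext_def)

lemma dsym_const: "dsym (sym_const c * F) = sc c (dsym F)"
proof -
  have "dext (\<lambda>M c. sc c (dEm M)) (mconst c * f) = sc c (dext (\<lambda>M c. sc c (dEm M)) f)" for f
    by (induction f rule: pm_induct)
      (simp_all add: distrib_left dext_add dext_single dyck.scale_left_distrib
        dyck.scale_right_distrib mult_single)
  then show ?thesis by (simp add: dsym_def pleth_pnew_simps)
qed

lemma dsym_eps: "dsym (prod_mset (image_mset eps M)) = dEm M"
proof -
  have "prod_mset (image_mset eps M) = eeval (Poly_Mapping.single M 1)"
    by (simp add: eeval_single ring_mapD[OF ring_map_sym_const])
  then show ?thesis by (simp add: dsym_def pleth_pnew_eeval dext_single)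
qed

lemma dymul_linear: "dymul k A (x + y) = dymul k A x + dymul k A y" "dymul k A 0 = 0"
  "dymul k A (sc c x) = sc c (dymul k A x)"
  by (induction A) (simp_all add: distrib_left dyck_scale_mult)

lemma dpoly_add: "dpoly k (P + Q) = dpoly k P + dpoly k Q"
  unfolding dpoly_def by (rule dext_add) (simp_all add: dsym_add distrib_left dymul_linear)

lemma dpoly_single: "dpoly k (Poly_Mapping.single m G) = dymul k (mset_of_monom m) (du k * dsym G)"
  unfolding dpoly_def by (rule dext_single) (simp add: dymul_linear)

lemma dpoly_of_sym: "dpoly k (of_sym G) = du k * dsym G"
  by (simp add: of_sym_def dpoly_single mset_of_monom_simps)

lemma dpoly_of_qt: "dpoly k (of_qt c * P) = sc c (dpoly k P)"
proof (induction P rule: pm_induct)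
  case (single m G)
  have "of_qt c * Poly_Mapping.single m G = Poly_Mapping.single m (sym_const c * G)"
    by (simp add: of_qt_def of_sym_def mult_single)
  then show ?case by (simp add: dpoly_single dsym_const dyck_scale_mult dymul_linear)
qed (simp add: distrib_left dpoly_add dyck.scale_right_distrib)

lemma dpoly_yvar: "dpoly k (yvar i * P) = dy i k * dpoly k P"
proof (induction P rule: pm_induct)
  case (single m G)
  have "yvar i * Poly_Mapping.single m G = Poly_Mapping.single (Poly_Mapping.single i 1 + m) G"
    by (simp add: yvar_def ymon_def mult_single)
  then show ?case by (simp only: dpoly_single mset_of_monom_simps dymul_simps)
qed (simp add: distrib_left dpoly_add)

text \<open>Takes the place of a linear independence argument: \<open>x\<close> is a function of
  \<open>P\<close>, and \<open>P\<close> is recovered from \<open>dphi x\<close> because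
  \<open>Theta k\<close> is invertible.\<close>

lemma dS_eq_dpoly: "x \<in> dS k \<Longrightarrow> \<exists>P\<in>V k. dpoly k P = x \<and> dphi x = inV k (Theta k P)"
proof (induction x rule: dS.induct)
  case (base M)
  show ?case
    by (rule bexI[of _ "of_sym (prod_mset (image_mset eps M))"])
      (simp_all add: of_sym_V dpoly_of_sym dsym_eps dphi_du dphi_dEm)
next
  case (add x y)
  then obtain P Q where "P \<in> V k" "Q \<in> V k" "dpoly k P = x" "dphi x = inV k (Theta k P)"
    "dpoly k Q = y" "dphi y = inV k (Theta k Q)" by blast
  then show ?case
    by (intro bexI[of _ "P + Q"]) (simp_all add: V_add dpoly_add dphi_simps Theta_simps inV_simps)
next
  case (scale x c)
  then obtain P where "P \<in> V k" "dpoly k P = x" "dphi x = inV k (Theta k P)" by blast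
  then show ?case
    by (intro bexI[of _ "of_qt c * P"]) (simp_all add: V_of_qt dpoly_of_qt dphi_simps Theta_simps inV_simps)
next
  case (y i x)
  then obtain P where "P \<in> V k" "dpoly k P = x" "dphi x = inV k (Theta k P)" by blast
  then show ?case
    using y by (intro bexI[of _ "yvar i * P"])
      (simp_all add: yvar_V dpoly_yvar dphi_simps Theta_simps dyck_act_dy Theta_V)
qed

lemma bij_betw_dphi_ekAe0: "bij_betw dphi (ekAe0 k) (inV k ` V k)"
  unfolding ekAe0_eq bij_betw_def
proof
  show "inj_on dphi (dS k)"
  proof (rule inj_onI)
    fix x y assume xy: "x \<in> dS k" "y \<in> dS k" "dphi x = dphi y"
    obtain P Q where PQ: "dpoly k P = x" "dphi x = inV k (Theta k P)"
      "dpoly k Q = y" "dphi y = inV k (Theta k Q)"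
      using dS_eq_dpoly[OF xy(1)] dS_eq_dpoly[OF xy(2)] by blast
    then have "inV k (Theta k P) = inV k (Theta k Q)" using xy(3) by simp
    then have "Theta k P = Theta k Q" by (metis lookup_inV)
    then have "P = Q" by (metis Theta_Theta_inv(2))
    then show "x = y" using PQ by simp
  qed
  show "dphi ` dS k = inV k ` V k"
  proof
    show "dphi ` dS k \<subseteq> inV k ` V k" using dS_eq_dpoly Theta_V(1) by fastforce
    show "inV k ` V k \<subseteq> dphi ` dS k"
    proof safe
      fix Q assume "Q \<in> V k"
      then show "inV k Q \<in> dphi ` dS k" using dphi_surj_V[of Q k] by (metis imageI)
    qed
  qed
qed

lemma bij_betw_dphi_Ae0: "bij_betw dphi Ae0 Vstar"
  unfolding bij_betw_def
proof
  show "inj_on dphi Ae0"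
  proof (rule inj_onI)
    fix x y assume "x \<in> Ae0" "y \<in> Ae0" and eq: "dphi x = dphi y"
    then obtain a b where ab: "x = a * de 0" "y = b * de 0" by (auto simp: Ae0_def)
    \<comment> \<open>Each component lies in \<open>e_k A e_0\<close>, where injectivity is known;
      finitely many components sum to \<open>x - y\<close>.\<close>
    have "de k * (x - y) = 0" for k
    proof (rule inj_onD[OF bij_betw_imp_inj_on[OF bij_betw_dphi_ekAe0[of k]]])
      have "de k * (x - y) = de k * (a - b) * de 0"
        by (simp add: ab left_diff_distrib mult.assoc)
      then show "de k * (x - y) \<in> ekAe0 k" unfolding ekAe0_def by blast
      show "0 \<in> ekAe0 k" by (simp add: ekAe0_eq dS_0)
      show "dphi (de k * (x - y)) = dphi 0"
        using dyck_act_linear(1)[of "de k" 0 0] by (simp add: dphi_simps eq)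
    qed
    moreover obtain K where "(\<Sum>k\<in>K. de k * (x - y)) = x - y"
      using dyck_decomposition[of "x - y"] by blast
    ultimately show "x = y" by simp
  qed
  show "dphi ` Ae0 = Vstar"
  proof
    show "dphi ` Ae0 \<subseteq> Vstar" using dphi_Vstar by blast
    show "Vstar \<subseteq> dphi ` Ae0"
    proof
      fix v assume v: "v \<in> Vstar"
      have "\<forall>k. \<exists>x. x \<in> dS k \<and> dphi x = inV k (Poly_Mapping.lookup v k)"
        using dphi_surj_V[OF lookup_Vstar[OF v]] by blast
      then obtain f where f: "\<And>k. f k \<in> dS k" "\<And>k. dphi (f k) = inV k (Poly_Mapping.lookup v k)"
        by metis
      let ?x = "\<Sum>k\<in>Poly_Mapping.keys v. f k"
      have "dphi ?x = v"
        unfolding dphi_sum f inV_def by (rule sum_singles[symmetric])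
      moreover have "?x = ?x * de 0"
        by (simp add: sum_distrib_right dS_units(2)[OF f(1)])
      then have "?x \<in> Ae0" unfolding Ae0_def by blast
      ultimately show "v \<in> dphi ` Ae0" by (metis imageI)
    qed
  qed
qed

theorem theorem5p2:
  shows "\<exists>\<rho>. dyck_representation Vstar scaleV \<rho> \<and> acts_by_operators \<rho> \<and>
    dyck_representation Ae0 dyck_scale (*) \<and>
    (\<exists>\<phi>. dyck_rep_iso Ae0 dyck_scale (*) Vstar scaleV \<rho> \<phi> \<and>
       \<phi> (dyck_e 0) = inV 0 1 \<and>
       (\<forall>k. bij_betw \<phi> (ekAe0 k) (inV k ` V k)))"
proof (intro exI conjI allI)
  show "dyck_rep_iso Ae0 dyck_scale (*) Vstar scaleV dyck_act dphi"
    by (simp add: dyck_rep_iso_def bij_betw_dphi_Ae0 linear_map_on_def dphi_simps scaleV_eq)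
qed (simp_all add: dyck_representation_dyck_act acts_by_operators_dyck_act dyck_representation_Ae0
    dphi_de_0 bij_betw_dphi_ekAe0)

end
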